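(* Let $(K,v)$ be a valued field and let $E=\{z_\nu\}_{\nu<\lambda}$ be a pseudo convergent sequence of algebraic type in $(K,v)$ without a limit in $K$. Fix an extension $\overline v$ of $v$ to an algebraic closure $\overline K$ of $K$, take the common extension $\overline v_E$ of $v_E$ and $\overline v$ to $\overline K(X)$, and fix an extension of $\overline v_E$ to an algebraic closure $\overline{K(X)}$ of $K(X)$ containing $\overline K(X)$. Let $Q(X)\in K[X]$ be an associated minimal polynomial for $E$. Then: (1) there exists some root $a$ of $Q$ such that $(a,\overline v_E(X-a))$ is a minimal pair of definition for $v_E$ over $K$; (2) $\{Q_\nu\}_{\nu<\lambda}\cup\{Q\}$ is a complete sequence of key polynomials for $v_E$ over $K$, where $Q_\nu:=X-z_\nu$ for all $\nu<\lambda$; (3) $IC(K(X)|K,v_E)=K^h$.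
   Context: Conventions. A valued field $(K,v)$ is a field with a (Krull) valuation, value group $vK$ (written additively). Valuations with the same valuation ring are identified, and if $w$ extends $v$ then $vK$ is regarded as a subgroup of the value group of $w$. Pseudo convergent sequences. Let $\lambda$ be a limit ordinal. $E=\{z_\nu\}_{\nu<\lambda}\subseteq K$ is pseudo convergent (pcs) if $v(z_{\nu_1}-z_{\nu_2})<v(z_{\nu_2}-z_{\nu_3})$ for all $\nu_1<\nu_2<\nu_3<\lambda$; put $\delta_\nu:=v(z_\nu-z_{\nu+1})$. An element $y$ of a valued extension field is a limit of $E$ if $v(y-z_\nu)=\delta_\nu$ for all sufficiently large $\nu$. For $f\in K[X]$ the sequence $\{vf(z_\nu)\}_{\nu<\lambda}$ is either ultimately constant or ultimately strictly increasing; $E$ is of transcendental type if it is ultimately constant for all $f$, and of algebraic type otherwise. In the algebraic type case, an associated minimal polynomial for $E$ (over $K$) is a monic $Q\in K[X]$ of minimal degree such that $\{vQ(z_\nu)\}_{\nu<\lambda}$ is ultimately strictly increasing. Induced valuation. $v_E$ is the valuation of $K(X)$ with valuation ring $\{\phi\in K(X)\mid v\phi(z_\nu)\ge 0$ for all sufficiently large $\nu\}$ (and maximal ideal given by $v\phi(z_\nu)>0$ for all sufficiently large $\nu$); it extends $v$. $\overline v_E$ is the valuation of $\overline K(X)$ defined in the same way from $E$ viewed in $(\overline K,\overline v)$; it extends both $\overline v$ and $v_E$. Let $w$ be an extension of $v$ to $K(X)$ and $\overline w$ an extension of $w$ to $\overline K(X)$ (here $w=v_E$, $\overline w=\overline v_E$).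 Minimal pairs. For $a\in\overline K$ and $\alpha$ in an ordered abelian group containing $\overline v\overline K$, $\overline v_{a,\alpha}$ is the valuation of $\overline K(X)$ with $\overline v_{a,\alpha}(\sum_i c_i(X-a)^i)=\min_i\{\overline v c_i+i\alpha\}$ ($c_i\in\overline K$). A pair $(a,\alpha)\in\overline K\times\overline w\,\overline K(X)$ is a pair of definition for $w$ over $K$ if $\overline w=\overline v_{a,\alpha}$, where $\overline v=\overline w|_{\overline K}$; equivalently, (MP1) $\alpha=\overline w(X-a)=\max\{\overline w(X-c)\mid c\in\overline K\}$. It is a minimal pair of definition for $w$ over $K$ if (MP1) holds and (MP2) for all $b\in\overline K$, $\overline v(a-b)\ge\alpha$ implies $[K(b):K]\ge[K(a):K]$. Key polynomials. For nonconstant $f\in K[X]$ let $\delta(f):=\max\{\overline w(X-c)\mid c\in\overline K$ a root of $f\}$ (independent of the choice of $\overline w$). A monic $Q\in K[X]$ is a key polynomial for $w$ over $K$ if $\delta(f)<\delta(Q)$ for all (nonconstant) $f\in K[X]$ with $\deg f<\deg Q$. For monic $Q$ and the unique expansion $f=\sum_i f_iQ^i$ with $\deg f_i<\deg Q$, put $w_Q(f):=\min_i\{wf_i+i\,wQ\}$. A family $\Lambda$ of key polynomials for $w$ over $K$ is a complete sequence of key polynomials for $w$ over $K$ if: (CSKP1) $\delta(Q)\neq\delta(Q')$ for distinct $Q,Q'\in\Lambda$; (CSKP2) $\Lambda$ is well ordered by $Q<Q'\Leftrightarrow\delta(Q)<\delta(Q')$; (CSKP3) for any $f\in K[X]$ there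 is $Q\in\Lambda$ with $wf=w_Qf$. Implicit constant field. Given an extension of $w$ to $\overline{K(X)}$, henselizations $K^h$, $K(X)^h$ are taken inside $\overline{K(X)}$ with respect to it, and $IC(K(X)|K,w)$ is the relative algebraic closure of $K$ in $K(X)^h$. *)

theory Defs
  imports "HOL-Algebra.Algebraic_Closure_Type" "HOL-Algebra.Generated_Fields"
begin

text \<open>
  All fields are subfields of one algebraically closed field \<^typ>\<open>'a\<close>, which plays the role of
  the algebraic closure of \<open>K(x)\<close>; \<open>x\<close> is an element of it that is transcendental over \<open>K\<close>.
  A polynomial \<open>f\<close> over \<open>K\<close> is an \<^typ>\<open>'a poly\<close> with coefficients in \<open>K\<close>, and \<open>f\<close> seen as an
  element of \<open>K(x)\<close> is \<open>poly f x\<close>.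
\<close>

subsection \<open>Ordered abelian groups with infinity\<close>

datatype 'g extval = Fin 'g | Infty

instantiation extval :: (linorder) linorder
begin

fun less_eq_extval :: "'a extval \<Rightarrow> 'a extval \<Rightarrow> bool" where
  "Fin a \<le> Fin b \<longleftrightarrow> a \<le> b"
| "x \<le> Infty \<longleftrightarrow> True"
| "Infty \<le> Fin b \<longleftrightarrow> False"

definition less_extval :: "'a extval \<Rightarrow> 'a extval \<Rightarrow> bool" where
  "x < y \<longleftrightarrow> x \<le> y \<and> \<not> y \<le> x" for x y :: "'a extval"

instance
proof
  fix x y z :: "'a extval"
  show "x < y \<longleftrightarrow> x \<le> y \<and> \<not> y \<le> x" by (rule less_extval_def)
  show "x \<le> x" by (cases x) auto
  show "x \<le> y \<Longrightarrow> y \<le> z \<Longrightarrow> x \<le> z" by (cases x; cases y; cases z) auto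
  show "x \<le> y \<Longrightarrow> y \<le> x \<Longrightarrow> x = y" by (cases x; cases y) auto
  show "x \<le> y \<or> y \<le> x" by (cases x; cases y) auto
qed

end

instantiation extval :: (linordered_ab_group_add) ordered_comm_monoid_add
begin

definition zero_extval :: "'a extval" where "0 = Fin (0 :: 'a)"

fun plus_extval :: "'a extval \<Rightarrow> 'a extval \<Rightarrow> 'a extval" where
  "Fin a + Fin b = Fin (a + b)"
| "x + Infty = Infty"
| "Infty + Fin b = Infty"

instance
proof
  fix a b c :: "'a extval"
  show "a + b + c = a + (b + c)" by (cases a; cases b; cases c) (auto simp: add.assoc)
  show "a + b = b + a" by (cases a; cases b) (auto simp: add.commute)
  show "0 + a = a" by (cases a) (auto simp: zero_extval_def)
  show "a \<le> b \<Longrightarrow> c + a \<le> c + b" by (cases a; cases b; cases c) auto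
qed

end

subsection \<open>Subfields of the ambient field\<close>

abbreviation ambient :: "'a::field ring" where
  "ambient \<equiv> ring_of_type_algebra"

definition polys_over :: "'a::field set \<Rightarrow> 'a poly set" where
  "polys_over F = {p. \<forall>i. Polynomial.coeff p i \<in> F}"

text \<open>\<open>F(x)\<close> and \<open>[F(x):F]\<close>\<close>

definition adjoin :: "'a::field set \<Rightarrow> 'a \<Rightarrow> 'a set" where
  "adjoin F x = generate_field ambient (insert x F)"

definition simple_ext_degree :: "'a::field set \<Rightarrow> 'a \<Rightarrow> nat" where
  "simple_ext_degree F x = ring.dim ambient F (adjoin F x)"

definition alg_over :: "'a::field set \<Rightarrow> 'a \<Rightarrow> bool" where
  "alg_over F x \<longleftrightarrow> (\<exists>p\<in>polys_over F. p \<noteq> 0 \<and> poly p x = 0)"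

text \<open>The relative algebraic closure of \<open>F\<close> in the ambient field; this is an algebraic closure of
  \<open>F\<close> when the ambient field is algebraically closed.\<close>

definition alg_clos :: "'a::field set \<Rightarrow> 'a set" where
  "alg_clos F = {x. alg_over F x}"

subsection \<open>Valuations\<close>

text \<open>Values of \<open>v\<close> outside \<open>F\<close> are irrelevant.\<close>

definition valuation_on :: "'a::field set \<Rightarrow> ('a \<Rightarrow> 'g::linordered_ab_group_add extval) \<Rightarrow> bool" where
  "valuation_on F v \<longleftrightarrow>
     (\<forall>x\<in>F. v x = Infty \<longleftrightarrow> x = 0) \<and>
     (\<forall>x\<in>F. \<forall>y\<in>F. v (x * y) = v x + v y) \<and>
     (\<forall>x\<in>F. \<forall>y\<in>F. min (v x) (v y) \<le> v (x + y))"

definition extends_on :: "'a set \<Rightarrow> ('a \<Rightarrow> 'b) \<Rightarrow> ('a \<Rightarrow> 'b) \<Rightarrow> bool" where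
  "extends_on F v w \<longleftrightarrow> (\<forall>x\<in>F. w x = v x)"

definition val_ring :: "'a::field set \<Rightarrow> ('a \<Rightarrow> 'g::linordered_ab_group_add extval) \<Rightarrow> 'a set" where
  "val_ring F v = {x\<in>F. 0 \<le> v x}"

definition value_group :: "'a::field set \<Rightarrow> ('a \<Rightarrow> 'g extval) \<Rightarrow> 'g extval set" where
  "value_group F v = v ` (F - {0})"

subsection \<open>Pseudo convergent sequences\<close>

text \<open>
  Sequences are indexed by a well-ordered type without a largest element, i.e. by the ordinals
  below some limit ordinal; every limit ordinal arises in this way. ``For all sufficiently
  large index'' is \<^term>\<open>at_top\<close>.
\<close>

definition succ_index :: "'i::{wellorder, no_top} \<Rightarrow> 'i" where
  "succ_index i = (LEAST j. i < j)"

definition pcs :: "'a::field set \<Rightarrow> ('a \<Rightarrow> 'g::linordered_ab_group_add extval) \<Rightarrow>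
    ('i::{wellorder, no_top} \<Rightarrow> 'a) \<Rightarrow> bool" where
  "pcs K v z \<longleftrightarrow> (\<forall>i. z i \<in> K) \<and>
     (\<forall>i j k. i < j \<longrightarrow> j < k \<longrightarrow> v (z i - z j) < v (z j - z k))"

definition pcs_limit :: "('a::field \<Rightarrow> 'g::linordered_ab_group_add extval) \<Rightarrow>
    ('i::{wellorder, no_top} \<Rightarrow> 'a) \<Rightarrow> 'a \<Rightarrow> bool" where
  "pcs_limit v z y \<longleftrightarrow> (\<forall>\<^sub>F i in at_top. v (y - z i) = v (z i - z (succ_index i)))"

definition ultimately_constant :: "('i::linorder \<Rightarrow> 'b) \<Rightarrow> bool" where
  "ultimately_constant s \<longleftrightarrow> (\<exists>c. \<forall>\<^sub>F i in at_top. s i = c)"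

definition ultimately_strict_mono :: "('i::linorder \<Rightarrow> 'b::order) \<Rightarrow> bool" where
  "ultimately_strict_mono s \<longleftrightarrow> (\<exists>i0. strict_mono_on {i0..} s)"

definition transcendental_type :: "'a::field set \<Rightarrow> ('a \<Rightarrow> 'g::linordered_ab_group_add extval) \<Rightarrow>
    ('i::{wellorder, no_top} \<Rightarrow> 'a) \<Rightarrow> bool" where
  "transcendental_type K v z \<longleftrightarrow>
     (\<forall>f\<in>polys_over K. ultimately_constant (\<lambda>i. v (poly f (z i))))"

definition algebraic_type :: "'a::field set \<Rightarrow> ('a \<Rightarrow> 'g::linordered_ab_group_add extval) \<Rightarrow>
    ('i::{wellorder, no_top} \<Rightarrow> 'a) \<Rightarrow> bool" where
  "algebraic_type K v z \<longleftrightarrow> \<not> transcendental_type K v z"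

definition assoc_min_poly :: "'a::field set \<Rightarrow> ('a \<Rightarrow> 'g::linordered_ab_group_add extval) \<Rightarrow>
    ('i::{wellorder, no_top} \<Rightarrow> 'a) \<Rightarrow> 'a poly \<Rightarrow> bool" where
  "assoc_min_poly K v z Q \<longleftrightarrow>
     Q \<in> polys_over K \<and> Polynomial.lead_coeff Q = 1 \<and>
     ultimately_strict_mono (\<lambda>i. v (poly Q (z i))) \<and>
     (\<forall>f\<in>polys_over K. Polynomial.lead_coeff f = 1 \<longrightarrow>
        ultimately_strict_mono (\<lambda>i. v (poly f (z i))) \<longrightarrow>
        Polynomial.degree Q \<le> Polynomial.degree f)"

text \<open>
  The valuation ring of \<open>v\<^sub>E\<close>, with \<open>\<phi> = p/q\<close>. The denominator \<open>q\<close> has finitely many roots and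
  a pseudo convergent sequence is injective, so \<open>poly q (z i) \<noteq> 0\<close> for all large \<open>i\<close> and
  the convention \<open>c / 0 = 0\<close> plays no role.
\<close>

definition pcs_ring :: "'a::field set \<Rightarrow> ('a \<Rightarrow> 'g::linordered_ab_group_add extval) \<Rightarrow>
    ('i::{wellorder, no_top} \<Rightarrow> 'a) \<Rightarrow> 'a \<Rightarrow> 'a set" where
  "pcs_ring F v z x =
     {poly p x / poly q x | p q. p \<in> polys_over F \<and> q \<in> polys_over F \<and> q \<noteq> 0 \<and>
        (\<forall>\<^sub>F i in at_top. 0 \<le> v (poly p (z i) / poly q (z i)))}"

text \<open>\<open>w\<close> is (a representative of) the valuation \<open>v\<^sub>E\<close> on \<open>F(x)\<close>. Since the valuation ring determines
  \<open>w\<close> only up to equivalence, \<open>w\<close> is also required to take the same values as \<open>v\<close> on \<open>F\<close>.\<close>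

definition induced_valuation :: "'a::field set \<Rightarrow> ('a \<Rightarrow> 'g::linordered_ab_group_add extval) \<Rightarrow>
    ('i::{wellorder, no_top} \<Rightarrow> 'a) \<Rightarrow> 'a \<Rightarrow> ('a \<Rightarrow> 'g extval) \<Rightarrow> bool" where
  "induced_valuation F v z x w \<longleftrightarrow>
     valuation_on (adjoin F x) w \<and> extends_on F v w \<and>
     val_ring (adjoin F x) w = pcs_ring F v z x"

subsection \<open>Minimal pairs and key polynomials\<close>

text \<open>Below, \<open>wb\<close> is a valuation on \<open>Kbar(x)\<close> and \<open>w\<close> its restriction to \<open>K(x)\<close>.\<close>

definition minimal_pair :: "'a::field set \<Rightarrow> 'a \<Rightarrow> ('a \<Rightarrow> 'g::linordered_ab_group_add extval) \<Rightarrow>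
    'a \<Rightarrow> 'g extval \<Rightarrow> bool" where
  "minimal_pair K x wb a \<alpha> \<longleftrightarrow>
     a \<in> alg_clos K \<and> \<alpha> \<in> value_group (adjoin (alg_clos K) x) wb \<and>
     \<alpha> = wb (x - a) \<and> (\<forall>c\<in>alg_clos K. wb (x - c) \<le> \<alpha>) \<and>
     (\<forall>b\<in>alg_clos K. \<alpha> \<le> wb (a - b) \<longrightarrow> simple_ext_degree K a \<le> simple_ext_degree K b)"

definition delta :: "'a::field set \<Rightarrow> 'a \<Rightarrow> ('a \<Rightarrow> 'g::linordered_ab_group_add extval) \<Rightarrow>
    'a poly \<Rightarrow> 'g extval" where
  "delta K x wb f = Max {wb (x - c) | c. c \<in> alg_clos K \<and> poly f c = 0}"

text \<open>A key polynomial is nonconstant, as \<^term>\<open>delta\<close> is defined only for nonconstant polynomials.\<close>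

definition key_polynomial :: "'a::field set \<Rightarrow> 'a \<Rightarrow> ('a \<Rightarrow> 'g::linordered_ab_group_add extval) \<Rightarrow>
    'a poly \<Rightarrow> bool" where
  "key_polynomial K x wb Q \<longleftrightarrow>
     Q \<in> polys_over K \<and> Polynomial.lead_coeff Q = 1 \<and> 0 < Polynomial.degree Q \<and>
     (\<forall>f\<in>polys_over K. 0 < Polynomial.degree f \<longrightarrow> Polynomial.degree f < Polynomial.degree Q \<longrightarrow>
        delta K x wb f < delta K x wb Q)"

text \<open>The \<open>i\<close>-th coefficient of the \<open>Q\<close>-adic expansion of \<open>f\<close>; by the lemmas below, these
  are the coefficients of the unique expansion with \<open>deg f\<^sub>i < deg Q\<close>.\<close>

definition adic_coeff :: "'a::field poly \<Rightarrow> 'a poly \<Rightarrow> nat \<Rightarrow> 'a poly" where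
  "adic_coeff Q f i = (f div Q ^ i) mod Q"

lemma degree_adic_coeff:
  assumes "0 < Polynomial.degree Q"
  shows "Polynomial.degree (adic_coeff Q f i) < Polynomial.degree Q"
  using assms degree_mod_less[of Q "f div Q ^ i"] by (cases "Q = 0") (auto simp: adic_coeff_def)

lemma degree_lt_power:
  assumes "0 < Polynomial.degree (Q :: 'a::field poly)"
    and "Polynomial.degree (f :: 'a poly) < n"
  shows "f div Q ^ n = 0"
proof -
  from assms(1) have "Q \<noteq> 0" by auto
  then have "Polynomial.degree (Q ^ n) = n * Polynomial.degree Q"
    by (simp add: degree_power_eq)
  with assms have "Polynomial.degree f < Polynomial.degree (Q ^ n)"
    by (metis less_le_trans mult.right_neutral mult_le_mono2 less_eq_Suc_le One_nat_def)
  then show ?thesis by (rule div_poly_less)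
qed

lemma adic_expansion_partial:
  "f = (\<Sum>i<n. adic_coeff Q f i * Q ^ i) + (f div Q ^ n) * Q ^ n" for f :: "'a::field poly"
proof (induction n)
  case (Suc n)
  have "f div Q ^ n = (f div Q ^ n) div Q * Q + (f div Q ^ n) mod Q" by simp
  also have "(f div Q ^ n) div Q = f div Q ^ Suc n"
    by (metis poly_div_mult_right power_Suc2)
  finally have "(f div Q ^ n) * Q ^ n =
      adic_coeff Q f n * Q ^ n + (f div Q ^ Suc n) * Q ^ Suc n"
    by (metis (no_types, lifting) adic_coeff_def add.commute distrib_right mult.assoc power_Suc)
  with Suc show ?case by (simp add: add.assoc)
qed simp

lemma adic_expansion:
  assumes "0 < Polynomial.degree Q"
  shows "f = (\<Sum>i\<le>Polynomial.degree f. adic_coeff Q f i * Q ^ i)"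
proof -
  have "f div Q ^ Suc (Polynomial.degree f) = 0"
    by (rule degree_lt_power[OF assms]) simp
  with adic_expansion_partial[of f Q "Suc (Polynomial.degree f)"] show ?thesis
    by (simp add: lessThan_Suc_atMost)
qed

lemma adic_coeff_unique:
  fixes Q :: "'a::field poly"
  assumes "\<And>i. Polynomial.degree (c i) < Polynomial.degree Q" and "i < n"
  shows "adic_coeff Q (\<Sum>j<n. c j * Q ^ j) i = c i"
  using assms
proof (induction n arbitrary: c i)
  case (Suc n)
  define g where "g = (\<Sum>j<n. c (Suc j) * Q ^ j)"
  have "Q \<noteq> 0" using Suc.prems(1)[of 0] by auto
  have f: "(\<Sum>j<Suc n. c j * Q ^ j) = c 0 + g * Q"
    unfolding g_def
    by (simp add: sum.lessThan_Suc_shift sum_distrib_right sum_distrib_left mult_ac del: sum.lessThan_Suc)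
  have small: "c 0 div Q = 0" "c 0 mod Q = c 0"
    using Suc.prems(1)[of 0] by (auto simp: div_poly_less mod_poly_less)
  show ?case
  proof (cases i)
    case 0
    then show ?thesis by (simp add: adic_coeff_def f small del: sum.lessThan_Suc)
  next
    case (Suc k)
    have "(c 0 + g * Q) div Q = g" using \<open>Q \<noteq> 0\<close> small by simp
    then have "adic_coeff Q (c 0 + g * Q) (Suc k) = adic_coeff Q g k"
      unfolding adic_coeff_def by (simp add: poly_div_mult_right)
    also have "\<dots> = c (Suc k)"
      unfolding g_def using Suc.IH[of "\<lambda>j. c (Suc j)" k] Suc.prems Suc by simp
    finally show ?thesis using Suc f by simp
  qed
qed simp

text \<open>The truncation \<open>w\<^sub>Q\<close>. Adding up \<open>i\<close> copies gives the multiple \<open>i wQ\<close>; the coefficients of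
  index greater than \<open>deg f\<close> are zero.\<close>

definition truncation :: "'a::field \<Rightarrow> ('a \<Rightarrow> 'g::linordered_ab_group_add extval) \<Rightarrow>
    'a poly \<Rightarrow> 'a poly \<Rightarrow> 'g extval" where
  "truncation x w Q f =
     (MIN i\<in>{..Polynomial.degree f}. w (poly (adic_coeff Q f i) x) + (\<Sum>j<i. w (poly Q x)))"

definition complete_key_polys :: "'a::field set \<Rightarrow> 'a \<Rightarrow> ('a \<Rightarrow> 'g::linordered_ab_group_add extval) \<Rightarrow>
    ('a \<Rightarrow> 'g extval) \<Rightarrow> 'a poly set \<Rightarrow> bool" where
  "complete_key_polys K x w wb \<Lambda> \<longleftrightarrow>
     (\<forall>Q\<in>\<Lambda>. key_polynomial K x wb Q) \<and>
     (\<forall>Q\<in>\<Lambda>. \<forall>Q'\<in>\<Lambda>. Q \<noteq> Q' \<longrightarrow> delta K x wb Q \<noteq> delta K x wb Q') \<and>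
     well_order_on \<Lambda> {(Q, Q'). Q \<in> \<Lambda> \<and> Q' \<in> \<Lambda> \<and> (Q = Q' \<or> delta K x wb Q < delta K x wb Q')} \<and>
     (\<forall>f\<in>polys_over K. \<exists>Q\<in>\<Lambda>. w (poly f x) = truncation x w Q f)"

subsection \<open>Henselizations and implicit constant fields\<close>

definition henselian :: "'a::field set \<Rightarrow> ('a \<Rightarrow> 'g::linordered_ab_group_add extval) \<Rightarrow> bool" where
  "henselian L v \<longleftrightarrow>
     (\<forall>f\<in>polys_over (val_ring L v). \<forall>b\<in>val_ring L v.
        0 < v (poly f b) \<and> v (poly (pderiv f) b) = 0 \<longrightarrow>
        (\<exists>a\<in>val_ring L v. poly f a = 0 \<and> 0 < v (a - b)))"

text \<open>For a valuation \<open>V\<close> of the algebraically closed ambient field, the henselization of \<open>(F, V)\<close>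
  in it is the smallest henselian subfield containing \<open>F\<close>.\<close>

definition henselization :: "'a::field set \<Rightarrow> ('a \<Rightarrow> 'g::linordered_ab_group_add extval) \<Rightarrow> 'a set" where
  "henselization F V = \<Inter>{L. subfield L ambient \<and> F \<subseteq> L \<and> henselian L V}"

definition implicit_constant_field ::
    "'a::field set \<Rightarrow> 'a \<Rightarrow> ('a \<Rightarrow> 'g::linordered_ab_group_add extval) \<Rightarrow> 'a set" where
  "implicit_constant_field K x V = {a \<in> henselization (adjoin K x) V. alg_over K a}"

end

theory Submission
  imports Defs
begin

text \<open>
  The valuation \<open>v\<^sub>E\<close> compares polynomials by their values at \<open>z\<^sub>\<nu>\<close> for large \<open>\<nu>\<close>. If \<open>a\<close> is a root of \<open>Q\<close>
  that is a limit of \<open>E\<close>, then \<open>v p(z\<^sub>\<nu>)\<close> ultimately equals \<open>v (e (z\<^sub>\<nu> - a)\<^sup>m)\<close>, where \<open>m\<close> counts the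
  roots of \<open>p\<close> that are limits. Hence the limits are the elements \<open>c\<close> for which the value of \<open>X - c\<close> is
  maximal, and the terms \<open>f\<^sub>i Q\<^sup>i\<close> of a \<open>Q\<close>-adic expansion have pairwise distinct values, so that \<open>Q\<close>
  alone already satisfies (CSKP3).

  For the implicit constant field, \<open>X \<mapsto> (z\<^sub>\<nu>)\<close> embeds \<open>Kbar(X)\<close> into the ring of germs of sequences
  along \<open>E\<close>, respecting values. A maximal extension of this embedding is defined on a henselian field
  \<open>M\<close>; the elements of \<open>M\<close> whose germ lies in \<open>K\<^sup>h\<close> form a henselian field that contains \<open>K(X)\<close> and
  meets \<open>Kbar\<close> in \<open>K\<^sup>h\<close>. The extension step adjoins a Hensel root \<open>a\<close> of minimal degree \<open>n\<close> over \<open>M\<close>: no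
  element of smaller degree is as close to \<open>a\<close> as all of \<open>M\<close> is, so the value of \<open>h(a)\<close> with
  \<open>deg h < n\<close> is the value of \<open>h(c)\<close> for some \<open>c\<close> in \<open>M\<close>.
\<close>

text \<open>\<open>henselization\<close> is an intersection of henselian subfields, so an upper
  bound for it only requires exhibiting one suitable henselian field. The obstacle is that values of
  germs are not totally ordered: \<open>at_top\<close> is no ultrafilter, and two sequences may stay
  incomparable in value forever. Every comparison in the source field must therefore be settled from
  some index on. For polynomials at \<open>z i\<close> the monomial form does this, because a
  comparison of two monomials in \<open>z i - a\<close> changes its truth value at most once. For a
  Hensel root \<open>y\<close> of \<open>f\<close> it requires that the value of \<open>h(y)\<close>
  be certified by finitely many inequalities between elements already embedded. The certificate is a
  translate \<open>h(c + f(c) T)\<close> with dominant constant term: \<open>f(c)\<close> has the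
  value of \<open>c - y\<close> but does not mention \<open>y\<close>. Such inequalities survive in
  the germs, where the Hensel root is chosen index by index. Finally, constants are sent to constant
  germs, so a constant whose germ lies in \<open>K^h\<close> lies in \<open>K^h\<close>
  itself.\<close>

hide_const (open) Polynomials.degree Polynomials.lead_coeff up_ring.coeff up_ring.monom

subsection \<open>Subfields and algebraic elements\<close>

definition ring_closed :: "'a::comm_ring_1 set \<Rightarrow> bool" where
  "ring_closed S \<longleftrightarrow> 1 \<in> S \<and> (\<forall>a\<in>S. -a \<in> S) \<and> (\<forall>a\<in>S. \<forall>b\<in>S. a + b \<in> S \<and> a * b \<in> S)"

text \<open>Zero is no exception: \<open>inverse 0 = 0\<close> already lies in a
  \<open>ring_closed\<close> set.\<close>

definition field_closed :: "'a::field set \<Rightarrow> bool" where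
  "field_closed S \<longleftrightarrow> ring_closed S \<and> (\<forall>a\<in>S. inverse a \<in> S)"

lemma ring_closedD:
  assumes "ring_closed S"
  shows "1 \<in> S" "0 \<in> S" "a \<in> S \<Longrightarrow> -a \<in> S" "a \<in> S \<Longrightarrow> b \<in> S \<Longrightarrow> a + b \<in> S"
    "a \<in> S \<Longrightarrow> b \<in> S \<Longrightarrow> a * b \<in> S" "a \<in> S \<Longrightarrow> b \<in> S \<Longrightarrow> a - b \<in> S"
proof -
  show *: "1 \<in> S" "a \<in> S \<Longrightarrow> -a \<in> S" "a \<in> S \<Longrightarrow> b \<in> S \<Longrightarrow> a + b \<in> S"
    "a \<in> S \<Longrightarrow> b \<in> S \<Longrightarrow> a * b \<in> S" for a b
    using assms by (auto simp: ring_closed_def)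
  show "0 \<in> S" using *(1) *(3)[OF *(1) *(2)[OF *(1)]] by simp
  show "a \<in> S \<Longrightarrow> b \<in> S \<Longrightarrow> a - b \<in> S" using *(3)[OF _ *(2), of a b] by simp
qed

lemma ring_closed_of_nat: "ring_closed S \<Longrightarrow> of_nat n \<in> S"
  by (induction n) (auto simp: ring_closedD)

lemma field_closedD:
  assumes "field_closed S"
  shows "ring_closed S" "a \<in> S \<Longrightarrow> inverse a \<in> S" "a \<in> S \<Longrightarrow> b \<in> S \<Longrightarrow> a / b \<in> S"
  using assms unfolding field_closed_def divide_inverse by (auto simp: ring_closedD)

lemma ambient_simps [simp]:
  "carrier ambient = UNIV" "a \<otimes>\<^bsub>ambient\<^esub> b = a * b" "a \<oplus>\<^bsub>ambient\<^esub> b = a + b"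
  "\<one>\<^bsub>ambient\<^esub> = 1" "\<zero>\<^bsub>ambient\<^esub> = 0"
  by (simp_all add: ring_of_type_algebra_def)

interpretation amb: ring "ambient :: 'a::Fields.field ring"
  by (rule ring_from_type_algebra)

lemma amb_field: "field (ambient :: 'a::Fields.field ring)"
  by (rule field_from_type_algebra)

lemma amb_domain: "domain (ambient :: 'a::Fields.field ring)"
  by (rule field.axioms(1)[OF amb_field])

lemma ambient_a_inv [simp]: "\<ominus>\<^bsub>ambient\<^esub> (a::'a::Fields.field) = - a"
  using amb.minus_equality[of "-a" a] by simp

lemma ambient_m_inv [simp]: "a \<noteq> 0 \<Longrightarrow> inv\<^bsub>ambient\<^esub> (a::'a::Fields.field) = inverse a"
  using amb.inv_unique'[of a "inverse a"] by simp

lemma ambient_pow [simp]: "a [^]\<^bsub>ambient\<^esub> (n::nat) = (a::'a::Fields.field) ^ n"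
  by (induction n) (simp_all add: amb.nat_pow_Suc)

lemma subfield_ambient_iff: "subfield S (ambient :: 'a::Fields.field ring) \<longleftrightarrow> field_closed S"
proof
  assume S: "subfield S (ambient :: 'a ring)"
  note R = subringE[OF subfieldE(1)[OF S], simplified]
  have "inverse a \<in> S" if "a \<in> S" for a
    using amb.subfield_m_inv(1)[OF S, of a] that R(2) by (cases "a = 0") auto
  then show "field_closed S"
    using R by (auto simp: field_closed_def ring_closed_def)
next
  assume S: "field_closed S"
  have "subring S (ambient :: 'a ring)"
    by (rule amb.subringI) (use ring_closedD[OF field_closedD(1)[OF S]] in auto)
  then show "subfield S (ambient :: 'a ring)"
    by (rule field.subfieldI'[OF amb_field]) (use field_closedD(2)[OF S] in auto)
qed

lemma field_closed_Inter:
  assumes "\<And>S. S \<in> \<F> \<Longrightarrow> field_closed S" shows "field_closed (\<Inter>\<F>)"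
  using assms by (fastforce simp: field_closed_def ring_closed_def)

lemma field_closed_adjoin: "field_closed (adjoin F x)"
  unfolding adjoin_def
  using field.generate_field_is_subfield[OF amb_field, of "insert x F"] by (simp add: subfield_ambient_iff)

lemma adjoin_incl: "F \<subseteq> adjoin F x" "x \<in> adjoin F x"
  unfolding adjoin_def by (auto intro: generate_field.incl)

lemma adjoin_least: "field_closed S \<Longrightarrow> F \<subseteq> S \<Longrightarrow> x \<in> S \<Longrightarrow> adjoin F x \<subseteq> S"
  unfolding adjoin_def
  by (rule field.generate_field_min_subfield1[OF amb_field]) (auto simp: subfield_ambient_iff)

lemma polys_overI: "(\<And>i. Polynomial.coeff p i \<in> F) \<Longrightarrow> p \<in> polys_over F"
  and polys_overD: "p \<in> polys_over F \<Longrightarrow> Polynomial.coeff p i \<in> F"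
  by (auto simp: polys_over_def)

lemma polys_over_mono: "F \<subseteq> G \<Longrightarrow> p \<in> polys_over F \<Longrightarrow> p \<in> polys_over G"
  by (auto simp: polys_over_def)

context
  fixes S :: "'a::Fields.field set"
  assumes S: "ring_closed S"
begin

lemma polys_over_pCons: "pCons a p \<in> polys_over S \<longleftrightarrow> a \<in> S \<and> p \<in> polys_over S"
  unfolding polys_over_def mem_Collect_eq by (metis coeff_pCons_0 coeff_pCons_Suc nat.exhaust)

lemma polys_over_closed:
  shows "0 \<in> polys_over S" "1 \<in> polys_over S"
    "p \<in> polys_over S \<Longrightarrow> q \<in> polys_over S \<Longrightarrow> p + q \<in> polys_over S"
    "p \<in> polys_over S \<Longrightarrow> q \<in> polys_over S \<Longrightarrow> p - q \<in> polys_over S"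
    "p \<in> polys_over S \<Longrightarrow> q \<in> polys_over S \<Longrightarrow> p * q \<in> polys_over S"
    "a \<in> S \<Longrightarrow> p \<in> polys_over S \<Longrightarrow> smult a p \<in> polys_over S"
    "p \<in> polys_over S \<Longrightarrow> q \<in> polys_over S \<Longrightarrow> pcompose p q \<in> polys_over S"
    "a \<in> S \<Longrightarrow> Polynomial.monom a n \<in> polys_over S"
    "p \<in> polys_over S \<Longrightarrow> pderiv p \<in> polys_over S"
  by (rule polys_overI;
      auto simp: ring_closedD[OF S] polys_overD coeff_pderiv simp del: of_nat_Suc
        intro!: coeff_mult_semiring_closed coeff_pcompose_semiring_closed ring_closedD[OF S]
          ring_closed_of_nat[OF S] dest: polys_overD)+

lemma polys_over_power: "p \<in> polys_over S \<Longrightarrow> p ^ n \<in> polys_over S"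
  by (induction n) (auto simp: polys_over_closed)

lemma poly_in_ring_closed: "p \<in> polys_over S \<Longrightarrow> b \<in> S \<Longrightarrow> poly p b \<in> S"
proof (induction p)
  case (pCons a p)
  then show ?case by (auto simp: polys_over_pCons intro!: ring_closedD[OF S])
qed (simp add: ring_closedD[OF S])

end

text \<open>Long division by \<open>q\<close> divides only by the leading coefficient of
  \<open>q\<close>, so it can be carried out over \<open>S\<close>; uniqueness of quotient and
  remainder identifies the outcome with \<open>div\<close> and \<open>mod\<close> of the ambient
  field.\<close>

lemma poly_div_mod_over:
  assumes S: "field_closed (S :: 'a::Fields.field set)" and "p \<in> polys_over S" "q \<in> polys_over S"
  shows "p div q \<in> polys_over S" "p mod q \<in> polys_over S"
proof -
  note R = field_closedD(1)[OF S]
  have "\<exists>d r. d \<in> polys_over S \<and> r \<in> polys_over S \<and> p = d * q + r \<and>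
      (r = 0 \<or> Polynomial.degree r < Polynomial.degree q)" if "q \<noteq> 0"
    using assms(2)
  proof (induction "Polynomial.degree p" arbitrary: p rule: less_induct)
    case less
    show ?case
    proof (cases "p = 0 \<or> Polynomial.degree p < Polynomial.degree q")
      case True
      then show ?thesis using less.prems polys_over_closed(1)[OF R] 
        by (intro exI[of _ 0] exI[of _ p]) auto
    next
      case False
      define m where "m = Polynomial.monom (Polynomial.lead_coeff p / Polynomial.lead_coeff q)
        (Polynomial.degree p - Polynomial.degree q)"
      have m: "m \<in> polys_over S" unfolding m_def
        by (rule polys_over_closed(8)[OF R], rule field_closedD(3)[OF S])
          (rule polys_overD[OF less.prems], rule polys_overD[OF assms(3)])
      have dm: "Polynomial.degree (m * q) = Polynomial.degree p"
        using False \<open>q \<noteq> 0\<close> by (subst degree_mult_eq) (auto simp: m_def degree_monom_eq)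
      have lm: "Polynomial.coeff (m * q) (Polynomial.degree p) = Polynomial.lead_coeff p"
      proof -
        have "Polynomial.lead_coeff m = Polynomial.lead_coeff p / Polynomial.lead_coeff q"
          unfolding m_def by (rule lead_coeff_monom)
        with lead_coeff_mult[of m q] \<open>q \<noteq> 0\<close> show ?thesis unfolding dm by simp
      qed
      have p1: "p - m * q \<in> polys_over S"
        by (rule polys_over_closed(4)[OF R less.prems polys_over_closed(5)[OF R m assms(3)]])
      show ?thesis
      proof (cases "p - m * q = 0")
        case True
        then show ?thesis using m polys_over_closed(1)[OF R]
          by (intro exI[of _ m] exI[of _ 0]) auto
      next
        case n0: False
        have "Polynomial.degree (p - m * q) < Polynomial.degree p"
        proof (rule le_neq_implies_less)
          show "Polynomial.degree (p - m * q) \<le> Polynomial.degree p"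
            using dm by (intro degree_diff_le) auto
          show "Polynomial.degree (p - m * q) \<noteq> Polynomial.degree p"
            using n0 lm by (metis coeff_diff diff_self leading_coeff_0_iff)
        qed
        from less.hyps[OF this p1] obtain d r where *: "d \<in> polys_over S" "r \<in> polys_over S"
          "p - m * q = d * q + r" "r = 0 \<or> Polynomial.degree r < Polynomial.degree q" by blast
        then show ?thesis using polys_over_closed(3)[OF R m *(1)]
          by (intro exI[of _ "m + d"] exI[of _ r]) (auto simp: algebra_simps)
      qed
    qed
  qed
  then have "p div q \<in> polys_over S \<and> p mod q \<in> polys_over S" if "q \<noteq> 0"
    using that by (auto simp: div_poly_less mod_poly_less)
  then show "p div q \<in> polys_over S" "p mod q \<in> polys_over S"
    using assms(2) polys_over_closed(1)[OF R] by (cases "q = 0"; simp)+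
qed

subsubsection \<open>Comparison with the list polynomials of \<open>HOL-Algebra\<close>\<close>

text \<open>A list polynomial begins with its leading coefficient, whereas \<open>Poly\<close>
  begins with the constant term; hence \<open>rev\<close>.\<close>

lemma eval_ambient: "ring.eval ambient p b = poly (Poly (rev p)) (b::'a::Fields.field)"
  by (induction p) (simp_all add: Poly_append poly_monom)

lemma univ_poly_iff:
  "p \<in> carrier (univ_poly ambient (F::'a::Fields.field set)) \<longleftrightarrow> p = [] \<or> (set p \<subseteq> F \<and> hd p \<noteq> 0)"
  by (auto simp: univ_poly_def polynomial_def)

lemma rev_coeffs_univ_poly:
  "p \<in> polys_over F \<Longrightarrow> rev (coeffs p) \<in> carrier (univ_poly ambient (F::'a::Fields.field set))"
  by (cases "p = 0") (auto simp: univ_poly_iff hd_rev last_coeffs_eq_coeff_degree coeffs_def polys_overD)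

lemma Poly_rev_polys_over:
  assumes "ring_closed F" "p \<in> carrier (univ_poly ambient (F::'a::Fields.field set))"
  shows "Poly (rev p) \<in> polys_over F"
  using assms by (auto simp: univ_poly_iff polys_over_def nth_default_def ring_closedD rev_nth dest!: subsetD)

lemma Poly_rev_neq_0:
  assumes "p \<in> carrier (univ_poly ambient (F::'a::Fields.field set))" "p \<noteq> []"
  shows "Poly (rev p) \<noteq> 0"
proof
  assume "Poly (rev p) = 0"
  then obtain n where "rev p = replicate n 0" by (auto simp: Poly_eq_0)
  then have "set p \<subseteq> {0}" by (metis set_replicate_conv_if empty_subsetI set_rev subset_refl)
  with assms show False by (cases p) (auto simp: univ_poly_iff)
qed

lemma alg_over_iff:
  assumes "field_closed (F::'a::Fields.field set)"
  shows "alg_over F b \<longleftrightarrow> (ring.algebraic ambient over F) b"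
proof
  assume "alg_over F b"
  then obtain p where "p \<in> polys_over F" "p \<noteq> 0" "poly p b = 0" by (auto simp: alg_over_def)
  then show "(amb.algebraic over F) b"
    by (intro amb.algebraicI[of "rev (coeffs p)"]) (auto simp: rev_coeffs_univ_poly eval_ambient)
next
  assume "(amb.algebraic over F) b"
  then obtain p where "p \<in> carrier (univ_poly ambient F)" "p \<noteq> []" "amb.eval p b = \<zero>\<^bsub>ambient\<^esub>"
    using domain.algebraicE[OF amb_domain, of F b] assms by (metis UNIV_I ambient_simps(1) subfieldE(1) subfield_ambient_iff)
  then show "alg_over F b"
    using Poly_rev_polys_over[OF field_closedD(1)[OF assms], of p] Poly_rev_neq_0[of p F]
    unfolding alg_over_def eval_ambient ambient_simps by blast
qed

context
  fixes K :: "'a::Fields.field set"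
  assumes K: "field_closed K"
begin

lemma field_closed_alg_clos: "field_closed (alg_clos K)"
proof -
  have "alg_clos K = {x \<in> carrier ambient. (ring.algebraic ambient over K) x}"
    by (simp add: alg_clos_def alg_over_iff[OF K])
  then show ?thesis
    using field.subfield_of_algebraics[OF amb_field, of K] K by (simp add: subfield_ambient_iff)
qed

lemma alg_clos_incl: "K \<subseteq> alg_clos K"
proof
  fix b assume "b \<in> K"
  then have "[:-b, 1:] \<in> polys_over K"
    using ring_closedD[OF field_closedD(1)[OF K]] by (simp add: polys_over_pCons polys_over_closed field_closedD(1)[OF K])
  then show "b \<in> alg_clos K"
    unfolding alg_clos_def alg_over_def mem_Collect_eq by (intro bexI[of _ "[:-b, 1:]"]) auto
qed

text \<open>The coefficients of a relation for \<open>y\<close> generate a finite extension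
  \<open>F\<close> of \<open>K\<close>. As \<open>y\<close> is algebraic over \<open>F\<close>, the
  field \<open>F(y)\<close> is finite over \<open>K\<close> by the tower law.\<close>

lemma alg_over_trans:
  assumes "alg_over (alg_clos K) y" shows "alg_over K y"
proof -
  let ?sf = "\<lambda>S. subfield S (ambient :: 'a ring)"
  obtain p where p: "p \<in> polys_over (alg_clos K)" "p \<noteq> 0" "poly p y = 0"
    using assms by (auto simp: alg_over_def)
  define xs where "xs = coeffs p"
  have xs: "set xs \<subseteq> carrier ambient" "\<And>c. c \<in> set xs \<Longrightarrow> (ring.algebraic ambient over K) c"
    using polys_overD[OF p(1)] by (auto simp: xs_def coeffs_def alg_clos_def alg_over_iff[OF K] split: if_splits)
  define F where "F = ring.finite_extension ambient K xs"
  have sK: "?sf K" using K by (simp add: subfield_ambient_iff)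
  have sF: "?sf F"
    unfolding F_def by (rule domain.finite_extension_is_subfield[OF amb_domain sK xs(1)]) (rule xs(2))
  have finF: "ring.finite_dimension ambient K F"
    unfolding F_def by (rule domain.finite_extension_finite_dimension(1)[OF amb_domain sK xs(1)]) (rule xs(2))
  have xsF: "set xs \<subseteq> F"
    unfolding F_def using domain.finite_extension_mem[OF amb_domain subfieldE(1)[OF sK] xs(1)] .
  have fF: "field_closed F" using sF by (simp add: subfield_ambient_iff)
  have "p \<in> polys_over F"
    using xsF ring_closedD(2)[OF field_closedD(1)[OF fF]]
    by (auto simp: polys_over_def xs_def) (metis coeff_in_coeffs coeff_eq_0 le_degree p(2) subsetD)
  then have "(ring.algebraic ambient over F) y"
    using alg_over_iff[OF fF, of y] p by (auto simp: alg_over_def)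
  then have E: "ring.finite_dimension ambient F (ring.simple_extension ambient F y)"
    using domain.finite_dimension_simple_extension[OF amb_domain sF, of y] by simp
  have "ring.finite_dimension ambient K (ring.simple_extension ambient F y)"
    by (rule amb.telescopic_base_dim(1)[OF sK sF finF E])
  then have "(ring.algebraic ambient over K) y"
    using amb.finite_dimension_imp_algebraic[OF sK
        domain.simple_extension_is_subring[OF amb_domain subfieldE(1)[OF sF], of y]]
      amb.simple_extension_mem[OF subfieldE(1)[OF sF], of y] by simp
  then show ?thesis by (simp add: alg_over_iff[OF K])
qed

lemma root_in_alg_clos:
  assumes "p \<in> polys_over (alg_clos K)" "p \<noteq> 0" "poly p b = 0" shows "b \<in> alg_clos K"
  using alg_over_trans[of b] assms by (auto simp: alg_clos_def alg_over_def)

lemma simple_ext_degree_Irr: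
  assumes "alg_over K b"
  shows "simple_ext_degree K b = Polynomials.degree (ring.Irr ambient K b)"
proof -
  have sK: "subfield K (ambient :: 'a ring)" using K by (simp add: subfield_ambient_iff)
  have b: "(ring.algebraic ambient over K) b" using assms by (simp add: alg_over_iff[OF K])
  let ?S = "ring.simple_extension ambient K b"
  have sS: "subfield ?S (ambient :: 'a ring)"
    using domain.simple_extension_is_subfield[OF amb_domain sK, of b] b by simp
  have "adjoin K b = ?S"
  proof
    show "adjoin K b \<subseteq> ?S"
      using sS amb.simple_extension_incl[of K b] amb.simple_extension_mem[OF subfieldE(1)[OF sK], of b]
      by (intro adjoin_least) (auto simp: subfield_ambient_iff)
    show "?S \<subseteq> adjoin K b"
      using field_closed_adjoin[of K b] adjoin_incl
      by (intro amb.simple_extension_subring_incl subfieldE(1)) (auto simp: subfield_ambient_iff)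
  qed
  then show ?thesis
    using domain.simple_extension_dim[OF amb_domain sK _ b]
    by (simp add: simple_ext_degree_def over_def)
qed

lemma minimal_polynomial:
  assumes "alg_over K b"
  obtains p where "p \<in> polys_over K" "Polynomial.lead_coeff p = 1"
    "Polynomial.degree p = simple_ext_degree K b" "poly p b = 0"
proof -
  have sK: "subfield K (ambient :: 'a ring)" using K by (simp add: subfield_ambient_iff)
  have b: "(ring.algebraic ambient over K) b" using assms by (simp add: alg_over_iff[OF K])
  define q where "q = ring.Irr ambient K b"
  note I = domain.IrrE[OF amb_domain sK _ b, folded q_def, simplified]
  have q: "q \<noteq> []"
    using domain.pirreducibleE(1)[OF amb_domain subfieldE(1)[OF sK] I(1,2)] .
  have "Polynomial.coeffs (Poly (rev q)) = rev q"
    using I(3) q by (cases q) simp_all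
  then have "Polynomial.degree (Poly (rev q)) = length q - 1" "Polynomial.lead_coeff (Poly (rev q)) = 1"
    using I(3) q by (auto simp: degree_eq_length_coeffs nth_default_def rev_nth hd_conv_nth)
  then show ?thesis
    using that[of "Poly (rev q)"] Poly_rev_polys_over[OF field_closedD(1)[OF K] I(1)] I(4)
    by (simp add: simple_ext_degree_Irr[OF assms] q_def[symmetric] eval_ambient)
qed

text \<open>The minimal polynomial of \<open>b\<close> divides \<open>f\<close>.\<close>

lemma simple_ext_degree_le:
  assumes "f \<in> polys_over K" "f \<noteq> 0" "poly f b = 0"
  shows "simple_ext_degree K b \<le> Polynomial.degree f"
proof -
  have sK: "subfield K (ambient :: 'a ring)" using K by (simp add: subfield_ambient_iff)
  have alg: "alg_over K b" using assms by (auto simp: alg_over_def)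
  then have b: "(ring.algebraic ambient over K) b" by (simp add: alg_over_iff[OF K])
  have "ring.Irr ambient K b pdivides\<^bsub>ambient\<^esub> rev (coeffs f)"
    by (rule domain.Irr_minimal[OF amb_domain sK _ b])
      (use assms in \<open>auto simp: rev_coeffs_univ_poly eval_ambient\<close>)
  then have "Polynomials.degree (ring.Irr ambient K b) \<le> Polynomials.degree (rev (coeffs f))"
    by (intro domain.pdivides_imp_degree_le[OF amb_domain subfieldE(1)[OF sK]])
      (use assms in \<open>auto simp: rev_coeffs_univ_poly domain.IrrE[OF amb_domain sK _ b]\<close>)
  then show ?thesis
    by (simp add: simple_ext_degree_Irr[OF alg] degree_eq_length_coeffs)
qed

end

subsection \<open>Valuations of a field type\<close>

lemma extval_add_simps [simp]: "Infty + (y::'g::linordered_ab_group_add extval) = Infty"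
  "y + Infty = (Infty::'g extval)"
  by (cases y; simp)+

lemma extval_le_Infty [simp]: "y \<le> (Infty::'g::linordered_ab_group_add extval)"
  "(Infty \<le> y) = (y = Infty)" "(y < Infty) = (y \<noteq> Infty)" "\<not> Infty < y"
  by (cases y; simp add: less_extval_def)+

lemma extval_less_Fin [simp]: "(Fin a < Fin b) = (a < (b::'g::linordered_ab_group_add))"
  by (auto simp: less_extval_def)

lemma extval_add_cancel:
  fixes a b c :: "'g::linordered_ab_group_add extval"
  assumes "c \<noteq> Infty"
  shows "a + c \<le> b + c \<longleftrightarrow> a \<le> b" "a + c < b + c \<longleftrightarrow> a < b"
  using assms by (cases a; cases b; cases c; simp)+

text \<open>The valuation is total on the field type, so its laws carry no membership conditions.
  Every valuation of the theorem agrees with one such \<open>V\<close> on its own field.\<close>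

locale valued =
  fixes V :: "'a::Fields.field \<Rightarrow> 'g::linordered_ab_group_add extval"
  assumes V_Infty_iff: "V a = Infty \<longleftrightarrow> a = 0"
    and V_mult: "V (a * b) = V a + V b"
    and V_add: "min (V a) (V b) \<le> V (a + b)"
begin

lemma V_0 [simp]: "V 0 = Infty"
  by (simp add: V_Infty_iff)

lemma V_1 [simp]: "V 1 = 0"
  using V_mult[of 1 1] V_Infty_iff[of 1] by (cases "V 1") (auto simp: zero_extval_def)

lemma V_mult_cancel:
  assumes "c \<noteq> 0"
  shows "V (a * c) \<le> V (b * c) \<longleftrightarrow> V a \<le> V b" "V (a * c) < V (b * c) \<longleftrightarrow> V a < V b"
    "V (a * c) = V (b * c) \<longleftrightarrow> V a = V b"
proof -
  have "V c \<noteq> Infty" using assms V_Infty_iff by auto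
  then show *: "V (a * c) \<le> V (b * c) \<longleftrightarrow> V a \<le> V b" "V (a * c) < V (b * c) \<longleftrightarrow> V a < V b" for a b
    by (simp_all add: V_mult extval_add_cancel)
  show "V (a * c) = V (b * c) \<longleftrightarrow> V a = V b" using * by (metis order.eq_iff)
qed

lemma V_minus [simp]: "V (- a) = V a"
proof -
  have "V (-1) + V (-1) = 0" using V_mult[of "-1" "-1"] by simp
  then have "V (-1) = 0"
    by (cases "V (-1)") (auto simp: zero_extval_def double_zero)
  then show ?thesis using V_mult[of "-1" a] by (simp add: add.commute[of 0])
qed

lemma V_minus_commute: "V (a - b) = V (b - a)"
  using V_minus[of "b - a"] by simp

lemma V_add_ge: "c \<le> V a \<Longrightarrow> c \<le> V b \<Longrightarrow> c \<le> V (a + b)"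
  using V_add[of a b] by (meson min.boundedI order_trans)

lemma V_add_gt: "c < V a \<Longrightarrow> c < V b \<Longrightarrow> c < V (a + b)"
  using V_add[of a b] by (meson min_less_iff_conj order.strict_trans2)

lemma V_diff_gt: "c < V a \<Longrightarrow> c < V b \<Longrightarrow> c < V (a - b)"
  using V_add_gt[of c a "-b"] by simp

lemma V_add_eq: "V a < V b \<Longrightarrow> V (a + b) = V a"
proof -
  assume *: "V a < V b"
  have "V (a + b) \<le> V a"
  proof (rule ccontr)
    assume "\<not> ?thesis"
    then have "V a < V (a + b - b)" using * by (intro V_diff_gt) auto
    then show False by simp
  qed
  moreover have "V a \<le> V (a + b)" using * by (intro V_add_ge) auto
  ultimately show ?thesis by simp
qed

lemma V_add_eq': "V b < V a \<Longrightarrow> V (a + b) = V b"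
  using V_add_eq[of b a] by (simp add: add.commute)

lemma V_diff_eq: "V a < V b \<Longrightarrow> V (a - b) = V a"
  using V_add_eq[of a "-b"] by simp

lemma V_diff_eq': "V b < V a \<Longrightarrow> V (a - b) = V b"
  using V_diff_eq[of b a] by (simp add: V_minus_commute)

lemma V_ultra_eq: "V (y - r) < V (y - a) \<Longrightarrow> V (a - r) = V (y - r)"
  using V_diff_eq[of "y - r" "y - a"] by simp

lemma V_mult_mono: "V a \<le> V a' \<Longrightarrow> V b \<le> V b' \<Longrightarrow> V (a * b) \<le> V (a' * b')"
  by (simp add: V_mult add_mono)

lemma V_mult_less_le: "V a < V a' \<Longrightarrow> V b \<le> V b' \<Longrightarrow> b \<noteq> 0 \<Longrightarrow> V (a * b) < V (a' * b')"
  using V_mult_cancel(2)[of b a a'] V_mult_mono[of a' a' b b'] by auto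

lemma V_mult_le_less: "V a \<le> V a' \<Longrightarrow> V b < V b' \<Longrightarrow> a \<noteq> 0 \<Longrightarrow> V (a * b) < V (a' * b')"
  using V_mult_less_le[of b b' a a'] by (simp add: mult.commute)

lemma V_power: "V (a ^ n) = (\<Sum>j<n. V a)"
  by (induction n) (simp_all add: V_mult add.commute)

lemma V_power_mono: "V a \<le> V b \<Longrightarrow> V (a ^ n) \<le> V (b ^ n)"
  by (induction n) (auto intro: V_mult_mono)

lemma V_power_strict_mono: "V a < V b \<Longrightarrow> n > 0 \<Longrightarrow> V (a ^ n) < V (b ^ n)"
proof (induction n)
  case (Suc n)
  show ?case
  proof (cases "n = 0")
    case False
    have "a ^ n \<noteq> 0" using Suc by (auto simp: V_Infty_iff)
    then show ?thesis using Suc False by (auto intro!: V_mult_less_le)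
  qed (use Suc in auto)
qed simp

lemma V_nonneg_power: "0 \<le> V a \<Longrightarrow> 0 \<le> V (a ^ n)"
  using V_power_mono[of 1 a n] by simp

lemma V_nonneg_mult: "0 \<le> V a \<Longrightarrow> 0 \<le> V b \<Longrightarrow> 0 \<le> V (a * b)"
  using V_mult_mono[of 1 a 1 b] by simp

lemma V_pos_mult: "0 < V a \<Longrightarrow> 0 \<le> V b \<Longrightarrow> 0 < V (a * b)"
  using V_mult_less_le[of 1 a 1 b] by simp

lemma V_divide_le_iff: "b \<noteq> 0 \<Longrightarrow> V c \<le> V (a / b) \<longleftrightarrow> V (c * b) \<le> V a"
  using V_mult_cancel(1)[of b c "a / b"] by simp

lemma V_divide_less_iff: "b \<noteq> 0 \<Longrightarrow> V c < V (a / b) \<longleftrightarrow> V (c * b) < V a"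
  using V_mult_cancel(2)[of b c "a / b"] by simp

lemma V_divide_nonneg: "b \<noteq> 0 \<Longrightarrow> 0 \<le> V (a / b) \<longleftrightarrow> V b \<le> V a"
  using V_divide_le_iff[of b 1 a] by simp

lemma V_divide_pos: "b \<noteq> 0 \<Longrightarrow> 0 < V (a / b) \<longleftrightarrow> V b < V a"
  using V_divide_less_iff[of b 1 a] by simp

lemma V_divide_unit: "b \<noteq> 0 \<Longrightarrow> V (a / b) = 0 \<longleftrightarrow> V a = V b"
  using V_mult_cancel(3)[of b "a / b" 1] by simp

lemma V_unit_mult: "V u = 0 \<Longrightarrow> V (a * u) = V a" "V u = 0 \<Longrightarrow> V (u * a) = V a"
  by (simp_all add: V_mult)

lemma V_sum_gt: "c \<noteq> Infty \<Longrightarrow> (\<And>i. i \<in> A \<Longrightarrow> c < V (t i)) \<Longrightarrow> c < V (sum t A)"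
  by (induction A rule: infinite_finite_induct) (auto intro: V_add_gt)

text \<open>Adding a term of different value yields the minimum. Zero summands are exempt: they all
  have value \<open>Infty\<close>, so their values may coincide without affecting the sum.\<close>

lemma V_sum_distinct:
  assumes "finite A" "A \<noteq> {}"
    and "\<And>i j. i \<in> A \<Longrightarrow> j \<in> A \<Longrightarrow> i \<noteq> j \<Longrightarrow> t i \<noteq> 0 \<Longrightarrow> t j \<noteq> 0 \<Longrightarrow> V (t i) \<noteq> V (t j)"
  shows "V (sum t A) = Min ((\<lambda>i. V (t i)) ` A)"
  using assms
proof (induction A rule: finite_ne_induct)
  case (insert i A)
  have IH: "V (sum t A) = Min ((\<lambda>i. V (t i)) ` A)" using insert by blast
  have "Min ((\<lambda>i. V (t i)) ` A) \<in> (\<lambda>i. V (t i)) ` A" using insert by (intro Min_in) auto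
  then obtain j where j: "j \<in> A" "V (sum t A) = V (t j)" using IH by auto
  have M: "Min ((\<lambda>i. V (t i)) ` insert i A) = min (V (t i)) (V (sum t A))"
    using insert IH by simp
  have S: "sum t (insert i A) = t i + sum t A" using insert by simp
  show ?case
  proof (cases "V (t i)" "V (sum t A)" rule: linorder_cases)
    case less
    then show ?thesis unfolding M S by (simp add: V_add_eq min_absorb1 less_imp_le)
  next
    case greater
    then show ?thesis unfolding M S by (simp add: V_add_eq' min_absorb2 less_imp_le)
  next
    case equal
    \<comment> \<open>The rest of the sum has the value of a single term \<open>t j\<close>, so
      equality with \<open>V (t i)\<close> is possible only if both values are
      \<open>Infty\<close>.\<close>
    have "i \<noteq> j" using j insert.hyps by auto
    then have "t i = 0 \<or> t j = 0" using equal j insert.prems[of i j] by auto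
    then have "t i = 0" using equal j V_Infty_iff by metis
    with equal show ?thesis unfolding M S by simp
  qed
qed auto

lemma ring_closed_valuation_ring: "ring_closed {a. 0 \<le> V a}"
  by (auto simp: ring_closed_def intro: V_add_ge V_nonneg_mult)

lemma poly_over_V_ge: "p \<in> polys_over {a. 0 \<le> V a} \<Longrightarrow> 0 \<le> V b \<Longrightarrow> 0 \<le> V (poly p b)"
  using poly_in_ring_closed[OF ring_closed_valuation_ring, of p b] by simp

subsection \<open>Polynomials dominated by their constant term\<close>

lemma dominated_poly:
  assumes "\<And>k. k > 0 \<Longrightarrow> V (coeff p 0) < V (coeff p k)" "0 \<le> V t"
  shows "V (poly p t) = V (coeff p 0)"
proof -
  have "poly p t = coeff p 0 + (\<Sum>k\<in>{1..degree p}. coeff p k * t ^ k)"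
  proof -
    have "{..degree p} = insert 0 {1..degree p}" by auto
    then show ?thesis by (simp add: poly_altdef)
  qed
  moreover have "V (coeff p 0) < V (\<Sum>k\<in>{1..degree p}. coeff p k * t ^ k)"
  proof (rule V_sum_gt)
    show "V (coeff p 0) \<noteq> Infty" using assms(1)[of 1] by auto
    fix k assume "k \<in> {1..degree p}"
    then show "V (coeff p 0) < V (coeff p k * t ^ k)"
      using V_mult_less_le[of "coeff p 0" "coeff p k" 1 "t ^ k"] assms V_nonneg_power[of t k] by auto
  qed
  ultimately show ?thesis by (simp add: V_add_eq)
qed

end

text \<open>Splitting off one linear factor at a time replaces products over the roots with
  multiplicity.\<close>

lemma alg_closed_poly_induct [consumes 1, case_names const root]:
  fixes p :: "'a::alg_closed_field poly"
  assumes "p \<noteq> 0"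
    and "\<And>c. c \<noteq> 0 \<Longrightarrow> P [:c:]"
    and "\<And>r p. p \<noteq> 0 \<Longrightarrow> P p \<Longrightarrow> P ([:-r, 1:] * p)"
  shows "P p"
  using assms(1)
proof (induction "degree p" arbitrary: p)
  case 0
  then show ?case using assms(2) by (metis degree_eq_zeroE pCons_eq_0_iff)
next
  case (Suc n)
  then obtain r where "poly p r = 0" using alg_closed_imp_poly_has_root[of p] by auto
  then obtain q where q: "p = [:-r, 1:] * q" by (metis dvdE poly_eq_0_iff_dvd)
  then have "q \<noteq> 0" using Suc.prems by auto
  moreover have "degree p = Suc (degree q)" unfolding q using \<open>q \<noteq> 0\<close> by (subst degree_mult_eq) auto
  ultimately show ?case using Suc q assms(3) by auto
qed

locale alg_closed_valued = valued V for V :: "'a::alg_closed_field \<Rightarrow> 'g::linordered_ab_group_add extval"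
begin

text \<open>The translate is \<open>h(c) \<Prod>\<^sub>j (1 + u T / (c - r\<^sub>j))\<close> over the roots \<open>r\<^sub>j\<close> of \<open>h\<close>.\<close>

lemma dominated_translate:
  assumes "h \<noteq> 0" "\<And>r. poly h r = 0 \<Longrightarrow> V (c - r) < V u"
  shows "poly h c \<noteq> 0" "\<And>k. k > 0 \<Longrightarrow> V (poly h c) < V (coeff (pcompose h [:c, u:]) k)"
proof -
  have "poly h c \<noteq> 0 \<and> (\<forall>k>0. V (poly h c) < V (coeff (pcompose h [:c, u:]) k))"
    using assms
  proof (induction h rule: alg_closed_poly_induct)
    case (const a)
    then show ?case by (auto simp: coeff_pCons V_Infty_iff split: nat.split)
  next
    case (root r p)
    let ?C = "\<lambda>k. coeff (pcompose p [:c, u:]) k"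
    have IH: "poly p c \<noteq> 0" "\<And>k. k > 0 \<Longrightarrow> V (poly p c) < V (?C k)" using root by auto
    have C0: "?C 0 = poly p c" by (simp add: coeff_pcompose_0)
    have r: "V (c - r) < V u" "c \<noteq> r" using root.prems[of r] by auto
    have "V ((c - r) * poly p c) < V (coeff (pcompose ([:-r, 1:] * p) [:c, u:]) k)" if "k > 0" for k
    proof -
      have "pcompose ([:-r, 1:] * p) [:c, u:] = [:c - r, u:] * pcompose p [:c, u:]"
        unfolding pcompose_mult by (simp add: pcompose_pCons)
      then have "coeff (pcompose ([:-r, 1:] * p) [:c, u:]) k = (c - r) * ?C k + u * ?C (k - 1)"
        using that by (cases k) (simp_all add: add.commute)
      moreover have "V ((c - r) * poly p c) < V ((c - r) * ?C k)"
        using V_mult_cancel(2)[of "c - r" "poly p c" "?C k"] IH(2)[OF that] r by (simp add: mult.commute)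
      moreover have "V (poly p c) \<le> V (?C (k - 1))"
        using C0 IH(2)[of "k - 1"] that by (cases "k = 1") (auto intro: less_imp_le)
      then have "V ((c - r) * poly p c) < V (u * ?C (k - 1))"
        using IH(1) r by (intro V_mult_less_le) auto
      ultimately show ?thesis by (simp add: V_add_gt)
    qed
    moreover have "poly ([:-r, 1:] * p) c = (c - r) * poly p c" by (simp add: algebra_simps)
    moreover have "(c - r) * poly p c \<noteq> 0" using IH(1) r by simp
    ultimately show ?case by metis
  qed
  then show "poly h c \<noteq> 0" "\<And>k. k > 0 \<Longrightarrow> V (poly h c) < V (coeff (pcompose h [:c, u:]) k)" by auto
qed

text \<open>Each factor \<open>y - r = (y - c) + (c - r)\<close> has the value of
  \<open>c - r\<close>. Formally this is the dominated translate with scale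
  \<open>u = y - c\<close>, evaluated at 1.\<close>

lemma V_poly_eq_of_close:
  assumes "h \<noteq> 0" "\<And>r. poly h r = 0 \<Longrightarrow> V (c - r) < V (y - c)"
  shows "V (poly h y) = V (poly h c)"
proof -
  have "V (poly (pcompose h [:c, y - c:]) 1) = V (coeff (pcompose h [:c, y - c:]) 0)"
    using dominated_translate[OF assms] by (intro dominated_poly) (auto simp: coeff_pcompose_0)
  then show ?thesis by (simp add: poly_pcompose coeff_pcompose_0)
qed

text \<open>Roots that are indistinguishable from \<open>a\<close> along \<open>F\<close> are counted by \<open>m\<close>, the others are absorbed
  into \<open>e\<close>.\<close>

lemma eventually_monomial:
  fixes y :: "'i \<Rightarrow> 'a"
  assumes dich: "\<And>r. (\<forall>\<^sub>F i in F. V (y i - r) = V (a - r) \<and> a \<noteq> r) \<or> (\<forall>\<^sub>F i in F. V (y i - r) = V (y i - a))"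
    and "p \<noteq> 0"
  shows "\<exists>e m. e \<noteq> 0 \<and> (\<forall>\<^sub>F i in F. V (poly p (y i)) = V (e * (y i - a) ^ m)) \<and>
    (m = 0 \<longrightarrow> (\<forall>r. poly p r = 0 \<longrightarrow> (\<forall>\<^sub>F i in F. V (y i - r) = V (a - r) \<and> a \<noteq> r))) \<and>
    (m > 0 \<longrightarrow> (\<exists>r. poly p r = 0 \<and> (\<forall>\<^sub>F i in F. V (y i - r) = V (y i - a))))"
  using \<open>p \<noteq> 0\<close>
proof (induction p rule: alg_closed_poly_induct)
  case (const c)
  then show ?case by (intro exI[of _ c] exI[of _ 0]) auto
next
  case (root r p)
  then obtain e m where em: "e \<noteq> 0" "\<forall>\<^sub>F i in F. V (poly p (y i)) = V (e * (y i - a) ^ m)"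
    "m = 0 \<Longrightarrow> \<forall>r. poly p r = 0 \<longrightarrow> (\<forall>\<^sub>F i in F. V (y i - r) = V (a - r) \<and> a \<noteq> r)"
    "m > 0 \<Longrightarrow> \<exists>r. poly p r = 0 \<and> (\<forall>\<^sub>F i in F. V (y i - r) = V (y i - a))" by auto
  have ev: "\<forall>\<^sub>F i in F. V (poly ([:-r, 1:] * p) (y i)) = V (b i * (e * (y i - a) ^ m))"
    if "\<forall>\<^sub>F i in F. V (y i - r) = V (b i)" for b
    using em(2) that by eventually_elim (simp add: V_mult flip: left_diff_distrib)
  from dich[of r] show ?case
  proof
    assume d: "\<forall>\<^sub>F i in F. V (y i - r) = V (a - r) \<and> a \<noteq> r"
    show ?thesis
    proof (cases "a = r")
      case True
      with d have "\<forall>\<^sub>F i in F. False" by simp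
      then have F: "F = bot" by (simp add: trivial_limit_def)
      show ?thesis using em(1) unfolding F by (intro exI[of _ e] exI[of _ 0]) auto
    next
      case False
      have "\<forall>\<^sub>F i in F. V (poly ([:-r, 1:] * p) (y i)) = V (((a - r) * e) * (y i - a) ^ m)"
        using ev[of "\<lambda>_. a - r"] d by (simp add: eventually_conj_iff mult.assoc)
      then show ?thesis using em(1,3,4) False d
        by (intro exI[of _ "(a - r) * e"] exI[of _ m]) auto
    qed
  next
    assume d: "\<forall>\<^sub>F i in F. V (y i - r) = V (y i - a)"
    have "\<forall>\<^sub>F i in F. V (poly ([:-r, 1:] * p) (y i)) = V (e * (y i - a) ^ Suc m)"
      using ev[OF d] by (simp add: mult_ac)
    then show ?thesis using em(1) d
      by (intro exI[of _ e] exI[of _ "Suc m"]) auto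
  qed
qed

end

subsection \<open>Hensel's lemma in an algebraically closed valued field\<close>

text \<open>The remainder keeps its factor in \<open>S\<close>; with \<open>S\<close> the valuation
  ring this controls the quadratic term.\<close>

lemma poly_taylor2:
  assumes S: "ring_closed S" and "f \<in> polys_over S" "c \<in> S" "y \<in> S"
  shows "\<exists>e\<in>S. poly f y = poly f c + (y - c) * poly (pderiv f) c + (y - c)\<^sup>2 * e"
  using assms(2)
proof (induction f)
  case 0
  then show ?case using ring_closedD(2)[OF S] by (intro bexI[of _ 0]) auto
next
  case (pCons k p)
  then have p: "p \<in> polys_over S" by (simp add: polys_over_pCons[OF S])
  then obtain e where e: "e \<in> S" "poly p y = poly p c + (y - c) * poly (pderiv p) c + (y - c)\<^sup>2 * e"
    using pCons by auto
  show ?case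
  \<comment> \<open>Obtained by writing \<open>y = c + (y - c)\<close> in
    \<open>y * poly p y\<close>: the linear term of \<open>p\<close> contributes
    \<open>poly (pderiv p) c\<close> to the new remainder, the old remainder contributes
    \<open>y * e\<close>.\<close>
  proof (rule bexI[of _ "poly (pderiv p) c + y * e"])
    show "poly (pderiv p) c + y * e \<in> S"
      using p e(1) assms(3,4) by (intro ring_closedD[OF S] poly_in_ring_closed[OF S] polys_over_closed[OF S])
    show "poly (pCons k p) y = poly (pCons k p) c + (y - c) * poly (pderiv (pCons k p)) c +
        (y - c)\<^sup>2 * (poly (pderiv p) c + y * e)"
      by (simp add: pderiv_pCons e(2) power2_eq_square algebra_simps)
  qed
qed

context valued
begin

abbreviation integral_polys :: "'a poly set" where
  "integral_polys \<equiv> polys_over {a. 0 \<le> V a}"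

lemma pderiv_integral: "f \<in> integral_polys \<Longrightarrow> pderiv f \<in> integral_polys"
  by (rule polys_over_closed(9)[OF ring_closed_valuation_ring])

lemma V_nonneg_shift: "0 \<le> V b \<Longrightarrow> 0 < V (y - b) \<Longrightarrow> 0 \<le> V y"
  using V_add_ge[of 0 b "y - b"] by (simp add: less_imp_le)

lemma V_unit_shift:
  assumes "f \<in> integral_polys" "0 \<le> V b" "V (poly f b) = 0" "0 < V (y - b)"
  shows "V (poly f y) = 0"
proof -
  obtain e where e: "0 \<le> V e" "poly f y = poly f b + (y - b) * poly (pderiv f) b + (y - b)\<^sup>2 * e"
    using poly_taylor2[OF ring_closed_valuation_ring assms(1), of b y] assms V_nonneg_shift[of b y] by auto
  have "0 < V ((y - b) * (poly (pderiv f) b + (y - b) * e))"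
    using assms e V_nonneg_mult[of "y - b" e]
    by (intro V_pos_mult V_add_ge poly_over_V_ge pderiv_integral) (auto simp: less_imp_le)
  then have "V (poly f b + (y - b) * (poly (pderiv f) b + (y - b) * e)) = V (poly f b)"
    by (intro V_add_eq) (simp add: assms(3))
  moreover have "poly f y = poly f b + (y - b) * (poly (pderiv f) b + (y - b) * e)"
    unfolding e(2) by (simp add: power2_eq_square distrib_left mult.assoc)
  ultimately show ?thesis using assms(3) by simp
qed

text \<open>Expanded at the root, \<open>poly f c\<close> is \<open>c - a\<close> times a unit. Thus
  the distance from \<open>c\<close> to a possibly unreachable root is the value of an element
  computed from \<open>f\<close> and \<open>c\<close> alone.\<close>

lemma V_near_simple_root:
  assumes f: "f \<in> integral_polys" and "0 \<le> V b" "V (poly (pderiv f) b) = 0"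
    and "poly f a = 0" "0 < V (a - b)" "0 < V (c - b)"
  shows "V (poly f c) = V (c - a)"
proof -
  have a: "0 \<le> V a" "0 \<le> V c" using assms V_nonneg_shift by auto
  obtain e where e: "0 \<le> V e" "poly f c = poly f a + (c - a) * poly (pderiv f) a + (c - a)\<^sup>2 * e"
    using poly_taylor2[OF ring_closed_valuation_ring f, of a c] a by auto
  have u: "V (poly (pderiv f) a) = 0"
    by (rule V_unit_shift[OF pderiv_integral[OF f] assms(2,3,5)])
  have "0 < V (c - a)" using V_diff_gt[of 0 "c - b" "a - b"] assms by simp
  then have "V (poly (pderiv f) a + (c - a) * e) = V (poly (pderiv f) a)"
    using e(1) u by (intro V_add_eq) (simp add: V_pos_mult)
  moreover have "poly f c = (c - a) * (poly (pderiv f) a + (c - a) * e)"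
    unfolding e(2) using assms(4) by (simp add: power2_eq_square distrib_left mult.assoc)
  ultimately show ?thesis using u by (simp add: V_unit_mult)
qed

lemma simple_root_unique:
  assumes "f \<in> integral_polys" "0 \<le> V b" "V (poly (pderiv f) b) = 0"
    and "poly f a = 0" "0 < V (a - b)" "poly f a' = 0" "0 < V (a' - b)"
  shows "a = a'"
  using V_near_simple_root[of f b a a'] assms by (simp add: V_Infty_iff) (metis V_Infty_iff V_0 right_minus_eq)

text \<open>\<open>a - c\<close> and \<open>poly f c\<close> have the same value, so
  \<open>a\<close> is \<open>c + t * poly f c\<close> with a unit \<open>t\<close>, and the
  dominated translate is evaluated at \<open>t\<close>. The hypothesis \<open>dom\<close> does not
  involve \<open>a\<close>, which is what allows its transfer to germs.\<close>

lemma V_eq_of_dominated_translate: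
  assumes f: "f \<in> integral_polys" "0 \<le> V b" "V (poly (pderiv f) b) = 0"
    and "poly f a = 0" "0 < V (a - b)" "0 < V (c - b)" "poly f c \<noteq> 0"
    and dom: "\<And>k. k > 0 \<Longrightarrow> V (poly h c) < V (coeff (pcompose h [:c, poly f c:]) k)"
  shows "V (poly h a) = V (poly h c)"
proof -
  define t where "t = (a - c) / poly f c"
  have "V t = 0"
    using V_near_simple_root[of f b a c] assms V_minus_commute[of a c] unfolding t_def
    by (subst V_divide_unit) auto
  then have "V (poly (pcompose h [:c, poly f c:]) t) = V (poly h c)"
    using dominated_poly[of "pcompose h [:c, poly f c:]" t] dom by (simp add: coeff_pcompose_0)
  moreover have "c + t * poly f c = a" using assms(7) by (simp add: t_def)
  ultimately show ?thesis by (simp add: poly_pcompose)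
qed

end

context alg_closed_valued
begin

text \<open>The logarithmic derivative \<open>\<Sum>\<^sub>j 1 / (b - r\<^sub>j)\<close> is integral.\<close>

lemma V_poly_le_V_pderiv:
  assumes "p \<noteq> 0" "\<And>r. poly p r = 0 \<Longrightarrow> V (b - r) \<le> 0"
  shows "V (poly p b) \<le> V (poly (pderiv p) b)"
  using assms
proof (induction p rule: alg_closed_poly_induct)
  case (root r p)
  have IH: "V (poly p b) \<le> V (poly (pderiv p) b)" and r: "V (b - r) \<le> 0" using root by auto
  have "V ((b - r) * poly p b) \<le> V (1 * poly p b)" using r by (intro V_mult_mono) auto
  moreover have "V ((b - r) * poly p b) \<le> V ((b - r) * poly (pderiv p) b)"
    using IH by (intro V_mult_mono) auto
  ultimately have "V ((b - r) * poly p b) \<le> V (1 * poly p b + (b - r) * poly (pderiv p) b)"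
    by (intro V_add_ge)
  moreover have "pderiv ([:-r, 1:] * p) = p + [:-r, 1:] * pderiv p"
    unfolding pderiv_mult by (simp add: pderiv_pCons)
  moreover have "poly [:-r, 1:] b = b - r" by simp
  ultimately show ?case by (simp only: poly_add poly_mult mult_1_left)
qed auto

text \<open>If no root were that near to \<open>b\<close>, the bound on the derivative would give
  \<open>V (poly f b) <= V (poly (pderiv f) b) = 0\<close>.\<close>

lemma simple_root_exists:
  assumes "0 < V (poly f b)" "V (poly (pderiv f) b) = 0"
  shows "\<exists>a. poly f a = 0 \<and> 0 < V (a - b)"
proof (rule ccontr)
  assume "\<not> ?thesis"
  moreover have "f \<noteq> 0" using assms by (auto simp: zero_extval_def)
  ultimately have "V (poly f b) \<le> V (poly (pderiv f) b)"
    using V_poly_le_V_pderiv[of f b] V_minus_commute[of b] by (metis linorder_not_less)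
  with assms show False by simp
qed

end

section \<open>Hensel data, and one of least degree without a root in the field\<close>

context valued
begin

definition hensel_datum :: "'a set \<Rightarrow> 'a poly \<Rightarrow> 'a \<Rightarrow> bool" where
  "hensel_datum M f b \<longleftrightarrow> f \<in> polys_over (val_ring M V) \<and> b \<in> val_ring M V \<and>
     0 < V (poly f b) \<and> V (poly (pderiv f) b) = 0"

lemma hensel_datumD:
  assumes "hensel_datum M f b"
  shows "f \<in> integral_polys" "f \<in> polys_over M" "b \<in> M" "0 \<le> V b"
    "0 < V (poly f b)" "V (poly (pderiv f) b) = 0"
  using assms by (auto simp: hensel_datum_def val_ring_def polys_over_def)

lemma henselian_iff:
  assumes M: "field_closed M"
  shows "henselian M V \<longleftrightarrow> (\<forall>f b. hensel_datum M f b \<longrightarrow> (\<exists>a\<in>M. poly f a = 0 \<and> 0 < V (a - b)))"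
proof -
  have "(\<exists>a\<in>val_ring M V. poly f a = 0 \<and> 0 < V (a - b)) \<longleftrightarrow> (\<exists>a\<in>M. poly f a = 0 \<and> 0 < V (a - b))"
    if "b \<in> val_ring M V" for f b
    using that V_nonneg_shift[of b] by (auto simp: val_ring_def)
  then show ?thesis unfolding henselian_def hensel_datum_def by blast
qed

end

text \<open>A failure of henselianity of \<open>M\<close> in least degree: the root \<open>a\<close>
  exists in the algebraically closed field but not in \<open>M\<close>. The locale is set up in
  order to be refuted for the field of a maximal germ ring.\<close>

locale hensel_gap = alg_closed_valued V for V :: "'a::alg_closed_field \<Rightarrow> 'g::linordered_ab_group_add extval" +
  fixes M :: "'a set" and f :: "'a poly" and b a :: 'a
  assumes M: "field_closed M"
    and datum: "hensel_datum M f b"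
    and root: "poly f a = 0" "0 < V (a - b)" "a \<notin> M"
    and minimal: "hensel_datum M g c \<Longrightarrow> degree g < degree f \<Longrightarrow> \<exists>y\<in>M. poly g y = 0 \<and> 0 < V (y - c)"
begin

lemmas f = hensel_datumD[OF datum]
lemmas ringM = field_closedD(1)[OF M]

lemma V_f: "0 < V (c - b) \<Longrightarrow> V (poly f c) = V (c - a)"
  by (rule V_near_simple_root) (use f root in auto)

text \<open>The witness is the Newton iterate of \<open>c\<close>.\<close>

lemma closer:
  assumes c: "c \<in> M" shows "\<exists>c'\<in>M. V (c - a) < V (c' - a) \<and> 0 < V (c' - b)"
proof (cases "0 < V (c - a)")
  \<comment> \<open>This far from \<open>a\<close> the Newton step gives no guarantee, but
    \<open>b\<close> itself is already closer.\<close>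
  case False
  then have "V (c - a) < V (b - a)" using root(2) by (simp add: V_minus_commute[of b])
  then show ?thesis using f by (intro bexI[of _ b]) (auto simp: zero_extval_def)
next
  case True
  have cb: "0 < V (c - b)" using V_add_gt[OF True root(2)] by simp
  have cO: "0 \<le> V c" "0 \<le> V a" using V_nonneg_shift[OF f(4)] cb root(2) by auto
  obtain e where e: "0 \<le> V e" "poly f a = poly f c + (a - c) * poly (pderiv f) c + (a - c)\<^sup>2 * e"
    using poly_taylor2[OF ring_closed_valuation_ring f(1), of c a] cO by auto
  define D where "D = poly (pderiv f) c"
  have D: "V D = 0" unfolding D_def
    by (rule V_unit_shift[OF pderiv_integral[OF f(1)] f(4) f(6) cb])
  then have D0: "D \<noteq> 0" by (auto simp: zero_extval_def)
  define c' where "c' = c - poly f c / D"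
  have "D \<in> M" unfolding D_def by (intro poly_in_ring_closed[OF ringM] polys_over_closed[OF ringM] f c)
  then have c': "c' \<in> M" unfolding c'_def
    by (intro ring_closedD[OF ringM] field_closedD(3)[OF M] c poly_in_ring_closed[OF ringM] f)
  \<comment> \<open>The Newton step cancels the linear term of the Taylor expansion of
    \<open>f(a) = 0\<close> at \<open>c\<close>, so only the quadratic one remains.\<close>
  have "(c' - a) * D = (a - c)\<^sup>2 * e"
    using e(2) root(1) D0 by (simp add: c'_def D_def[symmetric] field_simps)
  then have "V (c' - a) = V ((a - c) * ((a - c) * e))"
    using V_unit_mult(1)[OF D, of "c' - a"] by (simp add: power2_eq_square mult.assoc)
  moreover have "V (1 * (a - c)) < V (((a - c) * e) * (a - c))"
    using True root(3) c e(1) by (intro V_mult_less_le) (auto simp: V_pos_mult V_minus_commute[of a])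
  ultimately have "V (c - a) < V (c' - a)" by (simp add: V_minus_commute[of c] mult.commute)
  moreover from this have "0 < V (c' - b)" using V_add_gt[of 0 "c' - a" "a - b"] root(2) True by simp
  ultimately show ?thesis using c' by blast
qed

text \<open>\<open>M\<close> cannot separate such an \<open>r\<close> from \<open>a\<close>:
  \<open>V (c - r) = V (c - a)\<close> for every \<open>c\<close> in \<open>M\<close>. The element
  \<open>a\<close> is close to itself because it lies outside \<open>M\<close>.\<close>

definition close :: "'a \<Rightarrow> bool" where
  "close r \<longleftrightarrow> (\<forall>c\<in>M. V (c - a) < V (r - a))"

lemma close_notin: "close r \<Longrightarrow> r \<notin> M"
  by (auto simp: close_def)

text \<open>An \<open>r\<close> that is not close is at most as near to \<open>a\<close> as some
  element of \<open>M\<close>. Among finitely many such elements one is best, and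
  \<open>closer\<close> makes the inequality strict and supplies the bound relative to
  \<open>b\<close>.\<close>

lemma not_close_beyond:
  assumes "finite A" "\<And>r. r \<in> A \<Longrightarrow> \<not> close r"
  shows "\<exists>c\<in>M. 0 < V (c - b) \<and> (\<forall>r\<in>A. V (r - a) < V (c - a))"
  using assms
proof (induction A)
  case empty
  then show ?case using closer[OF f(3)] by blast
next
  case (insert r A)
  then obtain c where c: "c \<in> M" "\<forall>r\<in>A. V (r - a) < V (c - a)" by auto
  obtain c' where c': "c' \<in> M" "V (r - a) \<le> V (c' - a)"
    using insert.prems[of r] by (auto simp: close_def not_less)
  define d where "d = (if V (c - a) \<le> V (c' - a) then c' else c)"
  have d: "d \<in> M" "V (c - a) \<le> V (d - a)" "V (c' - a) \<le> V (d - a)" using c c' by (auto simp: d_def)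
  obtain e where e: "e \<in> M" "V (d - a) < V (e - a)" "0 < V (e - b)" using closer[OF d(1)] by auto
  then show ?case using c c' d by (intro bexI[of _ e]) (auto intro: less_le_trans le_less_trans)
qed

text \<open>Stands for a pseudo convergent sequence in \<open>M\<close> with limit \<open>a\<close>,
  without choosing one; the sets are directed because values are totally ordered. As a filter it can
  be used in \<open>eventually_monomial\<close>, just like \<open>at_top\<close> for the sequence
  \<open>E\<close>.\<close>

definition approach :: "'a filter" where
  "approach = (INF c1\<in>M. principal {c\<in>M. V (c1 - a) \<le> V (c - a)})"

lemma eventually_approach:
  "eventually P approach \<longleftrightarrow> (\<exists>c1\<in>M. \<forall>c\<in>M. V (c1 - a) \<le> V (c - a) \<longrightarrow> P c)"
  unfolding approach_def
proof (subst eventually_INF_base)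
  show "M \<noteq> {}" using f(3) by auto
  fix c d assume cd: "c \<in> M" "d \<in> M"
  show "\<exists>x\<in>M. principal {y \<in> M. V (x - a) \<le> V (y - a)}
         \<le> inf (principal {y \<in> M. V (c - a) \<le> V (y - a)}) (principal {y \<in> M. V (d - a) \<le> V (y - a)})"
  proof (cases "V (c - a) \<le> V (d - a)")
    case True
    then show ?thesis using cd by (intro bexI[of _ d]) (auto intro: order_trans)
  next
    case False
    then have "V (d - a) \<le> V (c - a)" by simp
    then show ?thesis using cd by (intro bexI[of _ c]) (auto intro: order_trans)
  qed
qed (auto simp: eventually_principal)

lemma eventually_approach_beyond:
  assumes "c1 \<in> M" shows "\<forall>\<^sub>F c in approach. c \<in> M \<and> V (c1 - a) \<le> V (c - a)"
  using assms by (auto simp: eventually_approach)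

lemma approach_proper: "approach \<noteq> bot"
  using f(3) by (auto simp: trivial_limit_def eventually_approach)

lemma close_approach: "close r \<Longrightarrow> \<forall>\<^sub>F c in approach. V (c - r) = V (c - a)"
  using eventually_approach_beyond[OF f(3)]
proof eventually_elim
  case (elim c)
  then have "V (c - a) < V (r - a)" by (auto simp: close_def)
  then show ?case using V_diff_eq[of "c - a" "r - a"] by simp
qed

lemma not_close_approach:
  assumes "\<not> close r" shows "\<forall>\<^sub>F c in approach. V (c - r) = V (a - r) \<and> a \<noteq> r"
proof -
  obtain c1 where c1: "c1 \<in> M" "V (r - a) < V (c1 - a)" using not_close_beyond[of "{r}"] assms by auto
  from eventually_approach_beyond[OF c1(1)] show ?thesis
  proof eventually_elim
    case (elim c)
    then have "V (r - a) < V (c - a)" using c1(2) by auto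
    then show ?case using V_diff_eq'[of "r - a" "c - a"] c1(2) V_minus_commute[of r a] by auto
  qed
qed

lemma approach_dichotomy:
  "(\<forall>\<^sub>F c in approach. V (c - r) = V (a - r) \<and> a \<noteq> r) \<or> (\<forall>\<^sub>F c in approach. V (c - r) = V (c - a))"
  using close_approach not_close_approach by blast

text \<open>If \<open>h\<close> had exactly one root close to \<open>a\<close>, a rescaled translate of \<open>h\<close> would be a Hensel datum
  of smaller degree than \<open>f\<close> for that root.\<close>

lemma no_isolated_close_root:
  assumes h: "[:-r, 1:] * h1 \<in> polys_over M" "h1 \<noteq> 0" "degree ([:-r, 1:] * h1) < degree f"
    and r: "close r" and h1: "\<And>r'. poly h1 r' = 0 \<Longrightarrow> \<not> close r'"
  shows False
proof -
  let ?h = "[:-r, 1:] * h1"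
  obtain c1 where c1: "c1 \<in> M" "\<And>r'. poly h1 r' = 0 \<Longrightarrow> V (r' - a) < V (c1 - a)"
    using not_close_beyond[of "{r'. poly h1 r' = 0}"] poly_roots_finite[OF h(2)] h1 by auto
  obtain c0 where c0: "c0 \<in> M" "V (c1 - a) < V (c0 - a)" using closer[OF c1(1)] by auto
  \<comment> \<open>A scale from \<open>M\<close> that separates the roots: in the coordinate
    \<open>T\<close> with \<open>X = c0 + u T\<close>, the root \<open>r\<close> has positive value
    and all roots of \<open>h1\<close> have negative value.\<close>
  define u where "u = c1 - c0"
  have u: "u \<in> M" "V u = V (c1 - a)" unfolding u_def
    using c0 c1 V_diff_eq[of "c1 - a" "c0 - a"] by (auto intro: ring_closedD[OF ringM])
  have u0: "u \<noteq> 0" using u(2) c1(1) root(3) by (auto simp: V_Infty_iff) (metis V_Infty_iff V_0 right_minus_eq)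
  define P where "P = pcompose h1 [:c0, u:]"
  define k where "k = poly h1 c0"
  have far: "V (c0 - r') < V u" if "poly h1 r' = 0" for r'
  proof -
    have "V (r' - a) < V (c0 - a)" using c1(2)[OF that] c0(2) by auto
    then have "V (c0 - r') = V (r' - a)" using V_diff_eq'[of "r' - a" "c0 - a"] by simp
    then show ?thesis using c1(2)[OF that] u(2) by simp
  qed
  have P: "k \<noteq> 0" "\<And>j. j > 0 \<Longrightarrow> V k < V (coeff P j)" "coeff P 0 = k"
    using dominated_translate[OF h(2) far] by (auto simp: k_def P_def coeff_pcompose_0)
  then have Pge: "V k \<le> V (coeff P j)" for j by (cases "j = 0") (auto intro: less_imp_le)
  have c0r: "V u < V (c0 - r)"
    using r c0 u(2) V_diff_eq[of "c0 - a" "r - a"] by (auto simp: close_def)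
  define G where "G = pcompose ?h [:c0, u:]"
  have G: "G \<in> polys_over M" unfolding G_def
    by (intro polys_over_closed(7)[OF ringM] h) (auto simp: polys_over_pCons[OF ringM] polys_over_closed[OF ringM] c0 u)
  have Gmul: "G = [:c0 - r, u:] * P"
    unfolding G_def P_def pcompose_mult by (simp add: pcompose_pCons)
  have G0: "coeff G 0 = (c0 - r) * k" and GS: "\<And>j. coeff G (Suc j) = (c0 - r) * coeff P (Suc j) + u * coeff P j"
    unfolding Gmul using P(3) by (simp_all add: add.commute)
  have VG0: "V (u * k) < V (coeff G 0)" unfolding G0 using c0r P(1) by (intro V_mult_less_le) auto
  have small: "V (u * k) < V ((c0 - r) * coeff P j)" for j
    using c0r P(1) Pge by (intro V_mult_less_le) auto
  \<comment> \<open>The linear coefficient has the least value among the coefficients of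
    \<open>G\<close>, strictly below that of the constant one. Division by it gives an integral
    polynomial with unit derivative at 0.\<close>
  define e where "e = coeff G 1"
  have Ve: "V e = V (u * k)" unfolding e_def One_nat_def GS P(3) using small[of "Suc 0"] by (intro V_add_eq')
  then have e0: "e \<noteq> 0" using u0 P(1) by (auto simp: V_Infty_iff) (metis V_Infty_iff V_0 mult_eq_0_iff)
  have VG: "V e \<le> V (coeff G j)" for j
  proof (cases j)
    case 0
    then show ?thesis using VG0 Ve by simp
  next
    case (Suc i)
    show ?thesis unfolding Suc GS Ve using small[of "Suc i"] V_mult_mono[of u u k "coeff P i"] Pge
      by (intro V_add_ge) (auto intro: less_imp_le)
  qed
  define g where "g = smult (1 / e) G"
  have eM: "1 / e \<in> M" unfolding e_def
    by (intro field_closedD(3)[OF M] ring_closedD[OF ringM] polys_overD[OF G])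
  have "hensel_datum M g 0"
    unfolding hensel_datum_def
  proof (intro conjI)
    have "coeff g j \<in> val_ring M V" for j
      using VG[of j] e0 polys_overD[OF polys_over_closed(6)[OF ringM eM G], of j]
      by (auto simp: g_def val_ring_def V_divide_nonneg)
    then show "g \<in> polys_over (val_ring M V)" by (rule polys_overI)
    show "0 \<in> val_ring M V" using ring_closedD(2)[OF ringM] by (simp add: val_ring_def)
    show "0 < V (poly g 0)" using VG0 Ve e0 by (simp add: g_def poly_0_coeff_0 V_divide_pos)
    show "V (poly (pderiv g) 0) = 0" using e0 by (simp add: g_def poly_0_coeff_0 coeff_pderiv e_def)
  qed
  moreover have "degree g < degree f"
  proof -
    have "degree g \<le> degree G" by (simp add: g_def)
    also have "\<dots> \<le> degree ?h" unfolding G_def using degree_pcompose_le[of ?h "[:c0, u:]"]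
      by (auto simp: degree_pCons_eq_if split: if_splits)
    finally show ?thesis using h(3) by simp
  qed
  ultimately obtain y where y: "y \<in> M" "poly g y = 0" "0 < V y" using minimal[of g 0] by auto
  \<comment> \<open>The constant term of \<open>P\<close> dominates, so \<open>y\<close> is no root
    of \<open>P\<close> but the coordinate of \<open>r\<close>; this puts \<open>r\<close> into
    \<open>M\<close>.\<close>
  have "V (poly P y) = V k" using dominated_poly[of P y] P y(3) by (auto intro: less_imp_le)
  then have "poly P y \<noteq> 0" using P(1) V_Infty_iff by metis
  moreover have "poly g y = (c0 - r + y * u) * poly P y / e"
    by (simp add: g_def Gmul distrib_right mult.assoc)
  ultimately have "c0 - r + y * u = 0" using y(2) e0 by simp
  then have "r = c0 + u * y" by (simp add: algebra_simps)
  then have "r \<in> M" using c0 u y by (auto intro: ring_closedD[OF ringM])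
  then show False using close_notin[OF r] by simp
qed

text \<open>Take \<open>h\<close> of least degree with a close root \<open>r\<close> and divide:
  \<open>f = q h + s\<close>. The remainder, if nonzero, has no close root, so near \<open>a\<close>
  its value is constantly \<open>V (poly s r) = V (poly f r) = V (r - a)\<close>, which exceeds
  \<open>V (c - a)\<close>. Hence along \<open>approach\<close> the product \<open>q h\<close> has
  the value \<open>V (c - a)\<close> of a single linear factor. So \<open>r\<close> is its only
  close root, counted with multiplicity, and \<open>no_isolated_close_root\<close> applies to
  \<open>h\<close>.\<close>

lemma not_close_of_small_degree:
  assumes "h \<in> polys_over M" "h \<noteq> 0" "degree h < degree f" "poly h r = 0"
  shows "\<not> close r"
  using assms
proof (induction "degree h" arbitrary: h r rule: less_induct)
  case less
  show ?case
  proof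
    assume r: "close r"
    define q s where "q = f div h" and "s = f mod h"
    have fqs: "f - s = q * h" by (simp add: q_def s_def minus_mod_eq_div_mult)
    have s: "s \<in> polys_over M" unfolding s_def by (rule poly_div_mod_over[OF M f(2) less.prems(1)])
    have q0: "q \<noteq> 0" unfolding q_def using less.prems by (auto simp: div_poly_eq_0_iff)
    have "degree h \<noteq> 0" 
    proof
      assume "degree h = 0"
      then obtain k where "h = [:k:]" by (rule degree_eq_zeroE)
      then show False using less.prems(2,4) by simp
    qed
    have near: "\<forall>\<^sub>F c in approach. c \<in> M \<and> V (poly f c) = V (c - a)"
      using eventually_approach_beyond[OF f(3)]
    proof eventually_elim
      case (elim c)
      have "0 < V (b - a)" using root(2) by (simp add: V_minus_commute[of b])
      then have "0 < V (c - a)" using elim by auto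
      then show ?case using V_add_gt[of 0 "c - a" "a - b"] root(2) V_f elim by simp
    qed
    have main: "\<forall>\<^sub>F c in approach. V (poly (q * h) c) = V (c - a)"
    proof (cases "s = 0")
      case True
      then show ?thesis using near fqs by (auto elim: eventually_mono)
    next
      case False
      have ds: "degree s < degree h" using False \<open>degree h \<noteq> 0\<close> degree_mod_less'[of h f] less.prems(2)
        by (auto simp: s_def)
      then have "\<not> close r'" if "poly s r' = 0" for r'
        using less.hyps[OF ds s False _ that] less.prems(3) by simp
      then obtain c1 where c1: "c1 \<in> M" "\<And>r'. poly s r' = 0 \<Longrightarrow> V (r' - a) < V (c1 - a)"
        using not_close_beyond[of "{r'. poly s r' = 0}"] poly_roots_finite[OF False] by auto
      have eq: "V (poly s y) = V (poly s a)" if "V (c1 - a) \<le> V (y - a)" for y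
        using False by (rule V_poly_eq_of_close) (use c1(2) that V_minus_commute[of a] in \<open>auto intro: less_le_trans\<close>)
      have "V (b - a) < V (r - a)" using r f(3) by (auto simp: close_def)
      then have "0 < V (r - a)" using root(2) by (simp add: V_minus_commute[of b])
      then have "V (poly f r) = V (r - a)" using V_add_gt[of 0 "r - a" "a - b"] root(2) V_f by simp
      moreover have "poly f r = poly s r"
        using fqs less.prems(4) by (metis diff_eq_diff_eq diff_self eq_iff_diff_eq_0 mult_zero_right poly_diff poly_mult)
      moreover have "V (poly s r) = V (poly s a)"
        using r c1(1) by (intro eq) (auto simp: close_def intro: less_imp_le)
      ultimately have sa: "V (poly s a) = V (r - a)" by simp
      from near eventually_approach_beyond[OF c1(1)] show ?thesis
      proof eventually_elim
        case (elim c)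
        have "V (poly s c) = V (r - a)" using eq elim sa by simp
        moreover have "V (c - a) < V (r - a)" using r elim by (auto simp: close_def)
        ultimately have "V (poly f c - poly s c) = V (poly f c)" using elim by (intro V_diff_eq) simp
        then show ?case using elim fqs[symmetric] by simp
      qed
    qed
    obtain h1 where h1: "h = [:-r, 1:] * h1" using less.prems(4) by (metis dvdE poly_eq_0_iff_dvd)
    have h10: "h1 \<noteq> 0" using h1 less.prems(2) by auto
    have "q * h1 \<noteq> 0" using q0 h10 by simp
    from eventually_monomial[OF approach_dichotomy this] obtain e m where em: "e \<noteq> 0"
      "\<forall>\<^sub>F c in approach. V (poly (q * h1) c) = V (e * (c - a) ^ m)"
      "m = 0 \<Longrightarrow> \<forall>r. poly (q * h1) r = 0 \<longrightarrow> (\<forall>\<^sub>F c in approach. V (c - r) = V (a - r) \<and> a \<noteq> r)"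
      by blast
    have "\<forall>\<^sub>F c in approach. c \<in> M \<and> V (e * (c - a) ^ m) = 0"
      using main em(2) near close_approach[OF r]
    proof eventually_elim
      case (elim c)
      have "c - a \<noteq> 0" using elim root(3) by auto
      moreover have "poly (q * h) c = poly (q * h1) c * (c - r)" by (simp add: h1 algebra_simps)
      then have "V (poly (q * h) c) = V (poly (q * h1) c) + V (c - r)" by (simp only: V_mult)
      then have "V (poly (q * h) c) = V ((e * (c - a) ^ m) * (c - a))"
        using elim by (simp only: V_mult)
      then have "V ((e * (c - a) ^ m) * (c - a)) = V (1 * (c - a))" using elim by simp
      ultimately show ?case using V_mult_cancel(3)[of "c - a" "e * (c - a) ^ m" 1] elim by simp
    qed
    then obtain c1 where c1: "c1 \<in> M" "\<And>c. c \<in> M \<Longrightarrow> V (c1 - a) \<le> V (c - a) \<Longrightarrow> V (e * (c - a) ^ m) = 0"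
      by (auto simp: eventually_approach)
    obtain c2 where c2: "c2 \<in> M" "V (c1 - a) < V (c2 - a)" using closer[OF c1(1)] by auto
    \<comment> \<open>A positive power of \<open>c - a\<close> has no constant value along
      \<open>approach\<close>, since \<open>M\<close> contains ever closer elements.\<close>
    have "m = 0"
    proof (rule ccontr)
      assume "m \<noteq> 0"
      then have "V (e * (c1 - a) ^ m) < V (e * (c2 - a) ^ m)"
        using c2 em(1) by (intro V_mult_le_less V_power_strict_mono) auto
      then show False using c1 c2 by (simp add: less_imp_le)
    qed
    have "\<not> close r'" if "poly h1 r' = 0" for r'
    proof
      assume r': "close r'"
      have "\<forall>\<^sub>F c in approach. V (c - r') = V (a - r') \<and> a \<noteq> r'" using em(3)[OF \<open>m = 0\<close>] that by simp
      with close_approach[OF r'] near have "\<forall>\<^sub>F c in approach. False"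
      proof eventually_elim
        case (elim c)
        then show False using r' V_minus_commute[of a r'] by (auto simp: close_def)
      qed
      then show False using approach_proper by (simp add: trivial_limit_def)
    qed
    then show False using no_isolated_close_root[of r h1] less.prems r h10 by (simp add: h1)
  qed
qed

text \<open>For \<open>c\<close> beyond all roots \<open>r\<close> of \<open>h\<close>, every
  \<open>V (c - r)\<close> lies below \<open>V (c - a)\<close>, which is the value of the scale
  \<open>poly f c\<close>.\<close>

lemma dominated_translate_near:
  assumes h: "h \<in> polys_over M" "h \<noteq> 0" "degree h < degree f"
  shows "\<exists>c\<in>M. 0 < V (c - b) \<and> poly f c \<noteq> 0 \<and> poly h c \<noteq> 0 \<and>
    (\<forall>k>0. V (poly h c) < V (coeff (pcompose h [:c, poly f c:]) k))"
proof -
  obtain c where c: "c \<in> M" "0 < V (c - b)" "\<And>r. poly h r = 0 \<Longrightarrow> V (r - a) < V (c - a)"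
    using not_close_beyond[of "{r. poly h r = 0}"] poly_roots_finite[OF h(2)]
      not_close_of_small_degree[OF h] by auto
  have "V (c - r) < V (poly f c)" if "poly h r = 0" for r
    using c(3)[OF that] V_diff_eq'[of "r - a" "c - a"] V_f[OF c(2)] by simp
  moreover have "poly f c \<noteq> 0" using V_f[OF c(2)] root(3) c(1) by (metis V_Infty_iff right_minus_eq)
  ultimately show ?thesis using dominated_translate[OF h(2), of c "poly f c"] c by blast
qed

end

subsection \<open>Rings of functions and polynomials over them\<close>

definition fun_ring :: "('o \<Rightarrow> 'a::comm_ring_1) set \<Rightarrow> bool" where
  "fun_ring R \<longleftrightarrow> (\<lambda>_. 1) \<in> R \<and> (\<forall>r\<in>R. (\<lambda>i. - r i) \<in> R) \<and>
     (\<forall>r\<in>R. \<forall>s\<in>R. (\<lambda>i. r i + s i) \<in> R \<and> (\<lambda>i. r i * s i) \<in> R)"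

text \<open>Polynomials over the ring \<open>R\<close>, stored index by index; the uniform degree
  bound makes such a family one polynomial with coefficients in \<open>R\<close>.\<close>

definition fun_polys :: "('o \<Rightarrow> 'a::comm_ring_1) set \<Rightarrow> ('o \<Rightarrow> 'a poly) set" where
  "fun_polys R = {H. (\<exists>N. \<forall>i. degree (H i) \<le> N) \<and> (\<forall>k. (\<lambda>i. coeff (H i) k) \<in> R)}"

lemma pcompose_monom: "pcompose (monom c n) q = smult c (q ^ n)"
  by (induction n) (simp_all add: monom_0 monom_Suc pcompose_pCons)

context
  fixes R :: "('o \<Rightarrow> 'a::Fields.field) set"
  assumes R: "fun_ring R"
begin

lemma fun_ringD:
  shows "(\<lambda>_. 1) \<in> R" "(\<lambda>_. 0) \<in> R" "r \<in> R \<Longrightarrow> (\<lambda>i. - r i) \<in> R"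
    "r \<in> R \<Longrightarrow> s \<in> R \<Longrightarrow> (\<lambda>i. r i + s i) \<in> R" "r \<in> R \<Longrightarrow> s \<in> R \<Longrightarrow> (\<lambda>i. r i - s i) \<in> R"
    "r \<in> R \<Longrightarrow> s \<in> R \<Longrightarrow> (\<lambda>i. r i * s i) \<in> R"
proof -
  show *: "(\<lambda>_. 1) \<in> R" "r \<in> R \<Longrightarrow> (\<lambda>i. - r i) \<in> R" "r \<in> R \<Longrightarrow> s \<in> R \<Longrightarrow> (\<lambda>i. r i + s i) \<in> R"
    "r \<in> R \<Longrightarrow> s \<in> R \<Longrightarrow> (\<lambda>i. r i * s i) \<in> R" for r s
    using R by (auto simp: fun_ring_def)
  show "(\<lambda>_. 0) \<in> R" using *(3)[OF *(1) *(2)[OF *(1)]] by simp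
  show "r \<in> R \<Longrightarrow> s \<in> R \<Longrightarrow> (\<lambda>i. r i - s i) \<in> R" using *(3)[OF _ *(2), of r s] by simp
qed

lemma fun_ring_power: "r \<in> R \<Longrightarrow> (\<lambda>i. r i ^ k) \<in> R"
  by (induction k) (auto intro: fun_ringD)

lemma fun_ring_sum: "(\<And>k. k \<in> A \<Longrightarrow> r k \<in> R) \<Longrightarrow> (\<lambda>i. \<Sum>k\<in>A. r k i) \<in> R"
  by (induction A rule: infinite_finite_induct) (auto intro: fun_ringD)

lemma fun_ring_of_nat: "(\<lambda>_. of_nat k) \<in> R"
  by (induction k) (auto intro: fun_ringD)

lemma fun_polysI: "(\<And>i. degree (H i) \<le> N) \<Longrightarrow> (\<And>k. (\<lambda>i. coeff (H i) k) \<in> R) \<Longrightarrow> H \<in> fun_polys R"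
  by (auto simp: fun_polys_def)

lemma fun_polysE:
  assumes "H \<in> fun_polys R"
  obtains N where "\<And>i. degree (H i) \<le> N" "\<And>k. (\<lambda>i. coeff (H i) k) \<in> R"
  using assms by (auto simp: fun_polys_def)

lemma fun_polys_coeff: "H \<in> fun_polys R \<Longrightarrow> (\<lambda>i. coeff (H i) k) \<in> R"
  by (auto simp: fun_polys_def)

lemma fun_polys_monom: "r \<in> R \<Longrightarrow> (\<lambda>i. monom (r i) k) \<in> fun_polys R"
proof (rule fun_polysI[of _ k])
  assume "r \<in> R"
  then show "(\<lambda>i. coeff (monom (r i) k) l) \<in> R" for l
    by (cases "k = l") (auto intro: fun_ringD)
qed (rule degree_monom_le)

lemma fun_polys_pCons:
  assumes "r \<in> R" "H \<in> fun_polys R" shows "(\<lambda>i. pCons (r i) (H i)) \<in> fun_polys R"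
  using assms(2)
proof (rule fun_polysE)
  fix N assume H: "\<And>i. degree (H i) \<le> N" "\<And>k. (\<lambda>i. coeff (H i) k) \<in> R"
  show ?thesis
  proof (rule fun_polysI[of _ "Suc N"])
    show "degree (pCons (r i) (H i)) \<le> Suc N" for i using H(1)[of i] by (simp add: degree_pCons_eq_if)
    show "(\<lambda>i. coeff (pCons (r i) (H i)) k) \<in> R" for k using H(2) assms(1) by (cases k) auto
  qed
qed

lemma fun_polys_0: "(\<lambda>_. 0) \<in> fun_polys R"
  by (rule fun_polysI[of _ 0]) (auto intro: fun_ringD)

lemma fun_polys_const: "r \<in> R \<Longrightarrow> (\<lambda>i. [:r i:]) \<in> fun_polys R"
  by (intro fun_polys_pCons fun_polys_0)

lemma fun_polys_add:
  assumes "H \<in> fun_polys R" "H' \<in> fun_polys R" shows "(\<lambda>i. H i + H' i) \<in> fun_polys R"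
proof -
  obtain N N' where "\<And>i. degree (H i) \<le> N" "\<And>i. degree (H' i) \<le> N'"
    using assms by (auto elim!: fun_polysE)
  then show ?thesis using assms
    by (intro fun_polysI[of _ "max N N'"]) (auto intro!: fun_ringD fun_polys_coeff degree_add_le intro: le_max_iff_disj[THEN iffD2])
qed

lemma fun_polys_mult:
  assumes "H \<in> fun_polys R" "H' \<in> fun_polys R" shows "(\<lambda>i. H i * H' i) \<in> fun_polys R"
proof -
  obtain N N' where "\<And>i. degree (H i) \<le> N" "\<And>i. degree (H' i) \<le> N'"
    using assms by (auto elim!: fun_polysE)
  then show ?thesis using assms
    by (intro fun_polysI[of _ "N + N'"])
      (auto simp: coeff_mult intro!: fun_ringD fun_ring_sum fun_polys_coeff intro: order_trans[OF degree_mult_le] add_mono)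
qed

lemma fun_polys_smult: "r \<in> R \<Longrightarrow> H \<in> fun_polys R \<Longrightarrow> (\<lambda>i. smult (r i) (H i)) \<in> fun_polys R"
  using fun_polys_mult[OF fun_polys_const, of r H] by simp

lemma fun_polys_uminus: "H \<in> fun_polys R \<Longrightarrow> (\<lambda>i. - H i) \<in> fun_polys R"
  using fun_polys_smult[OF fun_ringD(3)[OF fun_ringD(1)], of H] by simp

lemma fun_polys_diff: "H \<in> fun_polys R \<Longrightarrow> H' \<in> fun_polys R \<Longrightarrow> (\<lambda>i. H i - H' i) \<in> fun_polys R"
  using fun_polys_add[OF _ fun_polys_uminus, of H H'] by simp

lemma fun_polys_power: "H \<in> fun_polys R \<Longrightarrow> (\<lambda>i. H i ^ k) \<in> fun_polys R"
  by (induction k) (auto intro: fun_polys_mult fun_polys_const[OF fun_ringD(1), folded one_pCons])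

lemma fun_polys_sum: "(\<And>k. k \<in> A \<Longrightarrow> H k \<in> fun_polys R) \<Longrightarrow> (\<lambda>i. \<Sum>k\<in>A. H k i) \<in> fun_polys R"
  by (induction A rule: infinite_finite_induct) (auto intro: fun_polys_0 fun_polys_add)

lemma fun_polys_pderiv:
  assumes "H \<in> fun_polys R" shows "(\<lambda>i. pderiv (H i)) \<in> fun_polys R"
  using assms
proof (rule fun_polysE)
  fix N assume H: "\<And>i. degree (H i) \<le> N" "\<And>k. (\<lambda>i. coeff (H i) k) \<in> R"
  show ?thesis
  proof (rule fun_polysI[of _ N])
    show "degree (pderiv (H i)) \<le> N" for i
    proof (rule degree_le, intro allI impI)
      fix k assume "N < k"
      then show "coeff (pderiv (H i)) k = 0" using H(1)[of i] by (simp add: coeff_pderiv coeff_eq_0)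
    qed
    show "(\<lambda>i. coeff (pderiv (H i)) k) \<in> R" for k
      unfolding coeff_pderiv using H(2) fun_ring_of_nat by (intro fun_ringD)
  qed
qed

lemma fun_polys_poly:
  assumes "H \<in> fun_polys R" "r \<in> R" shows "(\<lambda>i. poly (H i) (r i)) \<in> R"
  using assms(1)
proof (rule fun_polysE)
  fix N assume H: "\<And>i. degree (H i) \<le> N" "\<And>k. (\<lambda>i. coeff (H i) k) \<in> R"
  have "poly (H i) (r i) = (\<Sum>k\<le>N. coeff (H i) k * r i ^ k)" for i
    by (subst poly_as_sum_of_monoms'[OF H(1)[of i], symmetric]) (simp add: poly_sum poly_monom)
  then show ?thesis using H(2) assms(2) by (simp add: fun_ring_sum fun_ringD fun_ring_power)
qed

lemma fun_polys_pcompose: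
  assumes "H \<in> fun_polys R" "L \<in> fun_polys R" shows "(\<lambda>i. pcompose (H i) (L i)) \<in> fun_polys R"
  using assms(1)
proof (rule fun_polysE)
  fix N assume H: "\<And>i. degree (H i) \<le> N" "\<And>k. (\<lambda>i. coeff (H i) k) \<in> R"
  have "pcompose (H i) (L i) = (\<Sum>k\<le>N. smult (coeff (H i) k) (L i ^ k))" for i
    by (subst poly_as_sum_of_monoms'[OF H(1)[of i], symmetric]) (simp add: pcompose_sum pcompose_monom)
  then show ?thesis using H(2) assms(2) by (simp add: fun_polys_sum fun_polys_smult fun_polys_power)
qed

text \<open>Because the divisor is monic of the same degree at every index, one division step lowers
  the common degree bound \<open>N\<close> everywhere at once.\<close>

lemma fun_polys_mod_monic:
  assumes G: "G \<in> fun_polys R" "\<And>i. degree (G i) = n" "\<And>i. coeff (G i) n = 1" "n > 0"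
    and "H \<in> fun_polys R"
  shows "\<exists>H'\<in>fun_polys R. \<forall>i. degree (H' i) < n \<and> (\<exists>q. H i = q * G i + H' i)"
  using assms(5)
proof (rule fun_polysE)
  fix N assume "\<And>i. degree (H i) \<le> N"
  with assms(5) show ?thesis
  proof (induction N arbitrary: H)
    case 0
    then show ?case using \<open>n > 0\<close> by (intro bexI[of _ H]) (auto intro: exI[of _ 0])
  next
    case (Suc N)
    show ?case
    proof (cases "Suc N < n")
      case True
      then show ?thesis using Suc.prems
        by (intro bexI[of _ H]) (auto intro: exI[of _ 0] le_less_trans)
    next
      case False
      define D where "D = (\<lambda>i. monom (coeff (H i) (Suc N)) (Suc N - n) * G i)"
      have D: "D \<in> fun_polys R" unfolding D_def
        using Suc.prems(1) G(1) by (intro fun_polys_mult fun_polys_monom fun_polys_coeff)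
      have dD: "degree (D i) \<le> Suc N" for i
      proof -
        show ?thesis
          using degree_mult_le[of "monom (coeff (H i) (Suc N)) (Suc N - n)" "G i"]
            degree_monom_le[of "coeff (H i) (Suc N)" "Suc N - n"] G(2)[of i] False
          unfolding D_def by linarith
      qed
      have cD: "coeff (D i) (Suc N) = coeff (H i) (Suc N)" for i
        unfolding D_def coeff_monom_mult using False G(3) by simp
      have "degree (H i - D i) \<le> N" for i
      proof (rule degree_le, intro allI impI)
        fix k assume "N < k"
        then show "coeff (H i - D i) k = 0"
          using cD[of i] dD[of i] Suc.prems(2)[of i]
          by (cases "k = Suc N") (auto simp: coeff_eq_0)
      qed
      from Suc.IH[OF fun_polys_diff[OF Suc.prems(1) D] this]
      obtain H' where H': "H' \<in> fun_polys R" "\<And>i. degree (H' i) < n"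
        "\<And>i. \<exists>q. H i - D i = q * G i + H' i" by blast
      have "\<exists>q. H i = q * G i + H' i" for i
      proof -
        obtain q where "H i - D i = q * G i + H' i" using H'(3) by blast
        then have "H i = (monom (coeff (H i) (Suc N)) (Suc N - n) + q) * G i + H' i"
          by (simp add: D_def algebra_simps)
        then show ?thesis by blast
      qed
      then show ?thesis using H' by blast
    qed
  qed
qed

end

subsection \<open>Germs of valued field embeddings\<close>

text \<open>A function \<open>r\<close> on \<^typ>\<open>'i option\<close> pairs a field element \<open>r None\<close> with a family \<open>r (Some i)\<close>, read
  as a germ along the filter \<open>F\<close>. A ring \<open>R\<close> of such functions with property \<open>val_respecting\<close> below is the
  graph of a valuation preserving homomorphism into the germs.\<close>

definition germ_filter :: "'i filter \<Rightarrow> 'i option filter" where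
  "germ_filter F = sup (principal {None}) (filtermap Some F)"

lemma eventually_germ_filter:
  "eventually P (germ_filter F) \<longleftrightarrow> P None \<and> (\<forall>\<^sub>F i in F. P (Some i))"
  by (simp add: germ_filter_def eventually_sup eventually_principal eventually_filtermap)

context valued
begin

text \<open>In a ring, the first clause applied to 0 and \<open>r - s\<close> shows that
  \<open>r None\<close> determines the germ of \<open>r\<close>. The strict clause is stated
  separately because the negation of an eventual inequality is not an eventual inequality.\<close>

definition val_respecting :: "'i filter \<Rightarrow> ('i option \<Rightarrow> 'a) set \<Rightarrow> bool" where
  "val_respecting F R \<longleftrightarrow> (\<forall>r\<in>R. \<forall>s\<in>R.
     (V (r None) \<le> V (s None) \<longrightarrow> (\<forall>\<^sub>F j in germ_filter F. V (r j) \<le> V (s j))) \<and>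
     (V (r None) < V (s None) \<longrightarrow> (\<forall>\<^sub>F j in germ_filter F. V (r j) < V (s j))))"

text \<open>The point \<open>None\<close> belongs to \<open>germ_filter F\<close>, so one hypothesis
  serves twice: it turns a comparison at \<open>None\<close> into one between old functions, and
  carries the eventual comparison back.\<close>

lemma val_respecting_extension:
  assumes R: "val_respecting F R" and "\<And>t. t \<in> R' \<Longrightarrow> \<exists>r\<in>R. \<forall>\<^sub>F j in germ_filter F. V (t j) = V (r j)"
  shows "val_respecting F R'"
  unfolding val_respecting_def
proof (intro ballI conjI impI)
  fix t u assume "t \<in> R'" "u \<in> R'"
  then obtain r s where rs: "r \<in> R" "s \<in> R" and ev: "\<forall>\<^sub>F j in germ_filter F. V (t j) = V (r j)"
    "\<forall>\<^sub>F j in germ_filter F. V (u j) = V (s j)" using assms(2) by metis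
  from ev have None: "V (t None) = V (r None)" "V (u None) = V (s None)"
    by (auto simp: eventually_germ_filter)
  {
    assume "V (t None) \<le> V (u None)"
    then have "\<forall>\<^sub>F j in germ_filter F. V (r j) \<le> V (s j)" using R rs None by (auto simp: val_respecting_def)
    then show "\<forall>\<^sub>F j in germ_filter F. V (t j) \<le> V (u j)" using ev by eventually_elim simp
  next
    assume "V (t None) < V (u None)"
    then have "\<forall>\<^sub>F j in germ_filter F. V (r j) < V (s j)" using R rs None by (auto simp: val_respecting_def)
    then show "\<forall>\<^sub>F j in germ_filter F. V (t j) < V (u j)" using ev by eventually_elim simp
  }
qed

lemma maximal_germ_ring:
  assumes "fun_ring B" "val_respecting F B"
  obtains R where "B \<subseteq> R" "fun_ring R" "val_respecting F R"
    "\<And>R'. fun_ring R' \<Longrightarrow> val_respecting F R' \<Longrightarrow> R \<subseteq> R' \<Longrightarrow> R' = R"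
proof -
  define \<A> where "\<A> = {R. B \<subseteq> R \<and> fun_ring R \<and> val_respecting F R}"
  have "\<exists>R\<in>\<A>. \<forall>S\<in>\<A>. R \<subseteq> S \<longrightarrow> S = R"
  proof (rule subset_Zorn_nonempty)
    show "\<A> \<noteq> {}" using assms by (auto simp: \<A>_def)
    fix C assume C: "C \<noteq> {}" "subset.chain \<A> C"
    have inA: "\<And>R. R \<in> C \<Longrightarrow> R \<in> \<A>" using C(2) by (auto simp: subset_chain_def)
    have two: "\<exists>R\<in>C. r \<in> R \<and> s \<in> R" if rs: "r \<in> \<Union>C" "s \<in> \<Union>C" for r s
    proof -
      obtain P Q where PQ: "P \<in> C" "r \<in> P" "Q \<in> C" "s \<in> Q" using rs by blast
      then have "P \<subseteq> Q \<or> Q \<subseteq> P" using C(2) by (auto simp: subset_chain_def)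
      then show ?thesis using PQ by blast
    qed
    have "fun_ring (\<Union>C)"
      unfolding fun_ring_def
    proof (intro conjI ballI)
      obtain R where R: "R \<in> C" using C(1) by auto
      then show "(\<lambda>_. 1) \<in> \<Union>C" using inA[of R] fun_ringD(1)[of R] by (auto simp: \<A>_def)
    next
      fix r assume "r \<in> \<Union>C"
      then obtain R where R: "R \<in> C" "r \<in> R" by auto
      then show "(\<lambda>i. - r i) \<in> \<Union>C" using inA[of R] fun_ringD(3)[of R] by (auto simp: \<A>_def)
    next
      fix r s assume "r \<in> \<Union>C" "s \<in> \<Union>C"
      then obtain R where R: "R \<in> C" "r \<in> R" "s \<in> R" using two by blast
      then show "(\<lambda>i. r i + s i) \<in> \<Union>C" "(\<lambda>i. r i * s i) \<in> \<Union>C"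
        using inA[of R] fun_ringD(4,6)[of R r s] by (auto simp: \<A>_def)
    qed
    moreover have "val_respecting F (\<Union>C)"
      unfolding val_respecting_def
    proof (intro ballI)
      fix r s assume "r \<in> \<Union>C" "s \<in> \<Union>C"
      then obtain R where R: "R \<in> C" "r \<in> R" "s \<in> R" using two by blast
      then have "val_respecting F R" using inA by (auto simp: \<A>_def)
      with R show "(V (r None) \<le> V (s None) \<longrightarrow> (\<forall>\<^sub>F j in germ_filter F. V (r j) \<le> V (s j))) \<and>
          (V (r None) < V (s None) \<longrightarrow> (\<forall>\<^sub>F j in germ_filter F. V (r j) < V (s j)))"
        unfolding val_respecting_def by blast
    qed
    moreover have "B \<subseteq> \<Union>C" using C(1) inA by (auto simp: \<A>_def)
    ultimately show "\<Union>C \<in> \<A>" by (simp add: \<A>_def)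
  qed
  then obtain R where R: "R \<in> \<A>" "\<And>S. S \<in> \<A> \<Longrightarrow> R \<subseteq> S \<Longrightarrow> S = R" by blast
  show ?thesis
  proof (rule that[of R])
    show "R' = R" if "fun_ring R'" "val_respecting F R'" "R \<subseteq> R'" for R'
      using R that by (auto simp: \<A>_def)
  qed (use R(1) in \<open>auto simp: \<A>_def\<close>)
qed

end

section \<open>Maximal germ rings: fractions, lifting of polynomials, Hensel roots\<close>

locale maximal_germs = alg_closed_valued V for V :: "'a::alg_closed_field \<Rightarrow> 'g::linordered_ab_group_add extval" +
  fixes F :: "'i filter" and R :: "('i option \<Rightarrow> 'a) set"
  assumes proper: "F \<noteq> bot"
    and R: "fun_ring R" and val_respecting: "val_respecting F R"
    and maximal: "\<And>R'. fun_ring R' \<Longrightarrow> val_respecting F R' \<Longrightarrow> R \<subseteq> R' \<Longrightarrow> R' = R"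
begin

lemmas RD = fun_ringD[OF R]

abbreviation "G \<equiv> germ_filter F"

definition dom_field :: "'a set" where "dom_field = (\<lambda>r. r None) ` R"

lemma germ_le: "r \<in> R \<Longrightarrow> s \<in> R \<Longrightarrow> V (r None) \<le> V (s None) \<Longrightarrow> \<forall>\<^sub>F j in G. V (r j) \<le> V (s j)"
  and germ_less: "r \<in> R \<Longrightarrow> s \<in> R \<Longrightarrow> V (r None) < V (s None) \<Longrightarrow> \<forall>\<^sub>F j in G. V (r j) < V (s j)"
  using val_respecting by (auto simp: val_respecting_def)

lemma germ_None: "eventually P G \<Longrightarrow> P None"
  by (simp add: eventually_germ_filter)

lemma germ_zero: "r \<in> R \<Longrightarrow> r None = 0 \<Longrightarrow> \<forall>\<^sub>F j in G. r j = 0"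
  using germ_le[OF RD(2), of r] by (simp add: V_Infty_iff)

lemma germ_nonzero: "r \<in> R \<Longrightarrow> r None \<noteq> 0 \<Longrightarrow> \<forall>\<^sub>F j in G. r j \<noteq> 0"
  using germ_less[OF _ RD(2), of r] by (simp add: V_Infty_iff)

lemma germ_nonneg: "r \<in> R \<Longrightarrow> 0 \<le> V (r None) \<Longrightarrow> \<forall>\<^sub>F j in G. 0 \<le> V (r j)"
  using germ_le[OF RD(1), of r] by simp

lemma germ_pos: "r \<in> R \<Longrightarrow> 0 < V (r None) \<Longrightarrow> \<forall>\<^sub>F j in G. 0 < V (r j)"
  using germ_less[OF RD(1), of r] by simp

lemma germ_unit: "r \<in> R \<Longrightarrow> V (r None) = 0 \<Longrightarrow> \<forall>\<^sub>F j in G. V (r j) = 0"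
  using eventually_conj[OF germ_nonneg[of r] germ_le[OF _ RD(1), of r]] by (auto elim: eventually_mono)

text \<open>Fractions of members again respect values, so maximality puts them into
  \<open>R\<close>. The relation is cross-multiplied and only eventual, which makes membership in
  \<open>R\<close> a property of the germ and \<open>dom_field\<close> a field.\<close>

lemma germ_fraction:
  assumes "p \<in> R" "q \<in> R" "q None \<noteq> 0" "\<forall>\<^sub>F j in G. r j * q j = p j"
  shows "r \<in> R"
proof -
  define R' where "R' = {r. \<exists>p\<in>R. \<exists>q\<in>R. q None \<noteq> 0 \<and> (\<forall>\<^sub>F j in G. r j * q j = p j)}"
  have R'I: "r \<in> R'" if "p \<in> R" "q \<in> R" "q None \<noteq> 0" "\<forall>\<^sub>F j in G. r j * q j = p j" for r p q
    using that unfolding R'_def by blast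
  have "fun_ring R'"
    unfolding fun_ring_def
  proof (intro conjI ballI)
    show "(\<lambda>_. 1) \<in> R'" by (rule R'I[OF RD(1) RD(1)]) auto
  next
    fix r assume "r \<in> R'"
    then obtain p q where pq: "p \<in> R" "q \<in> R" "q None \<noteq> 0" "\<forall>\<^sub>F j in G. r j * q j = p j"
      unfolding R'_def by blast
    show "(\<lambda>i. - r i) \<in> R'"
      by (rule R'I[OF RD(3)[OF pq(1)] pq(2,3)]) (use pq(4) in \<open>auto elim: eventually_mono\<close>)
  next
    fix r s assume "r \<in> R'" "s \<in> R'"
    then obtain p q p' q' where pq: "p \<in> R" "q \<in> R" "q None \<noteq> 0" "\<forall>\<^sub>F j in G. r j * q j = p j"
      "p' \<in> R" "q' \<in> R" "q' None \<noteq> 0" "\<forall>\<^sub>F j in G. s j * q' j = p' j"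
      unfolding R'_def by blast
    have q: "(\<lambda>j. q j * q' j) \<in> R" "q None * q' None \<noteq> 0" using pq by (auto intro: RD)
    show "(\<lambda>i. r i + s i) \<in> R'"
    proof (rule R'I[OF _ q])
      show "(\<lambda>j. p j * q' j + p' j * q j) \<in> R" using pq by (intro RD)
      show "\<forall>\<^sub>F j in G. (r j + s j) * (q j * q' j) = p j * q' j + p' j * q j"
        using pq(4,8)
      proof eventually_elim
        case (elim j)
        show ?case unfolding elim[symmetric] by (simp add: algebra_simps)
      qed
    qed
    show "(\<lambda>i. r i * s i) \<in> R'"
    proof (rule R'I[OF _ q])
      show "(\<lambda>j. p j * p' j) \<in> R" using pq by (intro RD)
      show "\<forall>\<^sub>F j in G. (r j * s j) * (q j * q' j) = p j * p' j"
        using pq(4,8)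
      proof eventually_elim
        case (elim j)
        show ?case unfolding elim[symmetric] by (simp add: mult_ac)
      qed
    qed
  qed
  moreover have "val_respecting F R'"
    unfolding val_respecting_def
  proof (intro ballI conjI impI)
    fix r s assume "r \<in> R'" "s \<in> R'"
    then obtain p q p' q' where pq: "p \<in> R" "q \<in> R" "q None \<noteq> 0" "\<forall>\<^sub>F j in G. r j * q j = p j"
      "p' \<in> R" "q' \<in> R" "q' None \<noteq> 0" "\<forall>\<^sub>F j in G. s j * q' j = p' j"
      unfolding R'_def by blast
    have R12: "(\<lambda>j. p j * q' j) \<in> R" "(\<lambda>j. p' j * q j) \<in> R" using pq by (auto intro: RD)
    have ev: "\<forall>\<^sub>F j in G. (V (r j) \<le> V (s j) \<longleftrightarrow> V (p j * q' j) \<le> V (p' j * q j)) \<and>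
        (V (r j) < V (s j) \<longleftrightarrow> V (p j * q' j) < V (p' j * q j))"
      using pq(4,8) germ_nonzero[OF pq(2,3)] germ_nonzero[OF pq(6,7)]
    proof eventually_elim
      case (elim j)
      have eq: "p j * q' j = r j * (q j * q' j)" "p' j * q j = s j * (q j * q' j)"
        unfolding elim(1,2)[symmetric] by (simp_all add: mult_ac)
      show ?case
        unfolding eq using V_mult_cancel(1,2)[of "q j * q' j" "r j" "s j"] elim(3,4) by simp
    qed
    {
      assume "V (r None) \<le> V (s None)"
      then have "\<forall>\<^sub>F j in G. V (p j * q' j) \<le> V (p' j * q j)"
        using germ_None[OF ev] R12 by (intro germ_le) auto
      with ev show "\<forall>\<^sub>F j in G. V (r j) \<le> V (s j)" by eventually_elim simp
    next
      assume "V (r None) < V (s None)"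
      then have "\<forall>\<^sub>F j in G. V (p j * q' j) < V (p' j * q j)"
        using germ_None[OF ev] R12 by (intro germ_less) auto
      with ev show "\<forall>\<^sub>F j in G. V (r j) < V (s j)" by eventually_elim simp
    }
  qed
  moreover have "R \<subseteq> R'"
  proof
    fix r assume "r \<in> R"
    then show "r \<in> R'" by (rule R'I[OF _ RD(1)]) auto
  qed
  ultimately have "R' = R" by (rule maximal)
  with R'I[OF assms] show ?thesis by simp
qed

lemma germ_eq: "p \<in> R \<Longrightarrow> \<forall>\<^sub>F j in G. r j = p j \<Longrightarrow> r \<in> R"
  by (rule germ_fraction[OF _ RD(1)]) auto

lemma germ_inverse:
  assumes "r \<in> R" shows "(\<lambda>j. inverse (r j)) \<in> R"
proof (cases "r None = 0")
  case True
  then show ?thesis using germ_zero[OF assms True] by (intro germ_eq[OF RD(2)]) (auto elim: eventually_mono)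
next
  case False
  show ?thesis
    by (rule germ_fraction[OF RD(1) assms False]) (use germ_nonzero[OF assms False] in \<open>auto elim: eventually_mono\<close>)
qed

lemma field_closed_dom_field: "field_closed dom_field"
  unfolding field_closed_def ring_closed_def dom_field_def
  using RD(1) imageI[OF RD(3), of _ "\<lambda>r. r None"] imageI[OF RD(4), of _ _ "\<lambda>r. r None"]
    imageI[OF RD(6), of _ _ "\<lambda>r. r None"] imageI[OF germ_inverse, of _ "\<lambda>r. r None"]
  by (auto intro: image_eqI[OF _ RD(1)])

text \<open>\<open>S\<close> will be \<open>R\<close> or the members of \<open>R\<close> that
  eventually take values in a given field. Summation up to \<open>degree h\<close> bounds the degree
  at every index.\<close>

lemma lift_poly:
  assumes "\<And>k. coeff h k \<in> (\<lambda>r. r None) ` S" "S \<subseteq> R"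
  obtains \<rho> H where "\<And>k. \<rho> k \<in> S" "H = (\<lambda>j. \<Sum>k\<le>degree h. monom (\<rho> k j) k)" "H \<in> fun_polys R"
    "H None = h" "\<And>j. degree (H j) \<le> degree h"
proof -
  obtain \<rho> where \<rho>: "\<And>k. \<rho> k \<in> S" "\<And>k. coeff h k = \<rho> k None"
  proof -
    have "\<forall>k. \<exists>r. r \<in> S \<and> coeff h k = r None" using assms(1) by blast
    then show ?thesis using that by metis
  qed
  define H where "H = (\<lambda>j. \<Sum>k\<le>degree h. monom (\<rho> k j) k)"
  show ?thesis
  proof (rule that[OF \<rho>(1) H_def])
    show "H \<in> fun_polys R" unfolding H_def
      using \<rho>(1) assms(2) by (intro fun_polys_sum[OF R] fun_polys_monom[OF R]) auto
    show "H None = h" unfolding H_def \<rho>(2)[symmetric] by (rule poly_as_sum_of_monoms)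
    show "degree (H j) \<le> degree h" for j unfolding H_def
      by (intro degree_sum_le) (auto intro: order_trans[OF degree_monom_le])
  qed
qed

text \<open>The degree bound leaves finitely many coefficients to compare, so the Hensel conditions
  pass to the germs.\<close>

lemma lift_datum:
  assumes "H \<in> fun_polys R" "\<And>j. degree (H j) \<le> n" "\<beta> \<in> R" "hensel_datum M (H None) (\<beta> None)"
  shows "\<forall>\<^sub>F j in G. H j \<in> integral_polys \<and> 0 \<le> V (\<beta> j) \<and> 0 < V (poly (H j) (\<beta> j)) \<and>
    V (poly (pderiv (H j)) (\<beta> j)) = 0"
proof -
  note d = hensel_datumD[OF assms(4)]
  have "\<forall>\<^sub>F j in G. \<forall>k\<in>{..n}. 0 \<le> V (coeff (H j) k)"
    by (intro eventually_ball_finite ballI germ_nonneg fun_polys_coeff[OF R assms(1)])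
      (use polys_overD[OF d(1)] in auto)
  then have "\<forall>\<^sub>F j in G. H j \<in> integral_polys"
  proof eventually_elim
    case (elim j)
    have "0 \<le> V (coeff (H j) k)" for k
      using elim assms(2)[of j] by (cases "k \<le> n") (auto simp: coeff_eq_0)
    then show ?case by (simp add: polys_over_def)
  qed
  moreover have "\<forall>\<^sub>F j in G. 0 \<le> V (\<beta> j)" by (rule germ_nonneg[OF assms(3) d(4)])
  moreover have "\<forall>\<^sub>F j in G. 0 < V (poly (H j) (\<beta> j))"
    by (rule germ_pos[OF fun_polys_poly[OF R assms(1,3)] d(5)])
  moreover have "\<forall>\<^sub>F j in G. V (poly (pderiv (H j)) (\<beta> j)) = 0"
    by (rule germ_unit[OF fun_polys_poly[OF R fun_polys_pderiv[OF R assms(1)] assms(3)] d(6)])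
  ultimately show ?thesis by eventually_elim simp
qed

end

context maximal_germs
begin

lemma dom_field_lift:
  assumes "h \<in> polys_over dom_field"
  obtains H where "H \<in> fun_polys R" "H None = h" "\<And>j. degree (H j) \<le> degree h"
proof -
  have "coeff h k \<in> (\<lambda>r. r None) ` R" for k
    using polys_overD[OF assms] by (simp add: dom_field_def)
  then show ?thesis by (rule lift_poly[OF _ subset_refl]) (rule that)
qed

text \<open>The leading coefficient of \<open>H\<close> at \<open>None\<close> may vanish at some
  other indices, whereas uniform division asks for a monic divisor at every index. So
  \<open>P\<close> is monic everywhere and proportional to \<open>H\<close> only eventually.\<close>

lemma monic_associate:
  assumes H: "H \<in> fun_polys R" "\<And>j. degree (H j) \<le> degree (H None)" and "H None \<noteq> 0"
  obtains P where "P \<in> fun_polys R" "\<And>j. degree (P j) = degree (H None)"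
    "\<And>j. coeff (P j) (degree (H None)) = 1" "\<forall>\<^sub>F j in G. \<exists>c. c \<noteq> 0 \<and> smult c (P j) = H j"
proof -
  define n where "n = degree (H None)"
  define l where "l = (\<lambda>j. coeff (H j) n)"
  have l: "l \<in> R" "l None \<noteq> 0" using H(1) assms(3) by (auto simp: l_def n_def fun_polys_coeff[OF R])
  define P where "P = (\<lambda>j. monom 1 n + (\<Sum>k<n. monom (coeff (H j) k * inverse (l j)) k))"
  have cP: "coeff (P j) k = (if k = n then 1 else if k < n then coeff (H j) k * inverse (l j) else 0)" for j k
    by (auto simp: P_def coeff_sum sum.delta)
  have dP: "degree (P j) = n" for j
    by (rule antisym[OF degree_le le_degree]) (auto simp: cP)
  show ?thesis
  proof (rule that[of P])
    show "P \<in> fun_polys R" unfolding P_def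
      using l(1) by (intro fun_polys_add[OF R] fun_polys_sum[OF R] fun_polys_monom[OF R] RD fun_polys_coeff[OF R H(1)] germ_inverse)
    show "degree (P j) = degree (H None)" "coeff (P j) (degree (H None)) = 1" for j
      using dP cP by (auto simp: n_def)
    show "\<forall>\<^sub>F j in G. \<exists>c. c \<noteq> 0 \<and> smult c (P j) = H j"
      using germ_nonzero[OF l]
    proof eventually_elim
      case (elim j)
      have "smult (l j) (P j) = H j"
      proof (rule poly_eqI)
        fix k show "coeff (smult (l j) (P j)) k = coeff (H j) k"
          using elim H(2)[of j] by (auto simp: cP l_def n_def coeff_eq_0)
      qed
      then show ?case using elim by blast
    qed
  qed
qed

lemma fun_ring_adjoin: "fun_ring ((\<lambda>H j. poly (H j) (\<alpha> j)) ` fun_polys R)"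
  unfolding fun_ring_def
proof (intro conjI ballI)
  show "(\<lambda>_. 1) \<in> (\<lambda>H j. poly (H j) (\<alpha> j)) ` fun_polys R"
    by (rule image_eqI[OF _ fun_polys_const[OF R RD(1)]]) simp
next
  fix r assume "r \<in> (\<lambda>H j. poly (H j) (\<alpha> j)) ` fun_polys R"
  then obtain H where H: "H \<in> fun_polys R" "r = (\<lambda>j. poly (H j) (\<alpha> j))" by blast
  show "(\<lambda>i. - r i) \<in> (\<lambda>H j. poly (H j) (\<alpha> j)) ` fun_polys R"
    by (rule image_eqI[OF _ fun_polys_uminus[OF R H(1)]]) (simp add: H(2))
next
  fix r s assume "r \<in> (\<lambda>H j. poly (H j) (\<alpha> j)) ` fun_polys R" "s \<in> (\<lambda>H j. poly (H j) (\<alpha> j)) ` fun_polys R"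
  then obtain H H' where H: "H \<in> fun_polys R" "r = (\<lambda>j. poly (H j) (\<alpha> j))"
    "H' \<in> fun_polys R" "s = (\<lambda>j. poly (H' j) (\<alpha> j))" by blast
  show "(\<lambda>i. r i + s i) \<in> (\<lambda>H j. poly (H j) (\<alpha> j)) ` fun_polys R"
    by (rule image_eqI[OF _ fun_polys_add[OF R H(1,3)]]) (simp add: H(2,4))
  show "(\<lambda>i. r i * s i) \<in> (\<lambda>H j. poly (H j) (\<alpha> j)) ` fun_polys R"
    by (rule image_eqI[OF _ fun_polys_mult[OF R H(1,3)]]) (simp add: H(2,4))
qed

text \<open>A Hensel root \<open>a\<close> over \<open>dom_field\<close> can be adjoined: the conditions of \<open>dominated_translate_near\<close>
  only involve elements of \<open>dom_field\<close>, so they pass to the germs and determine the values there.\<close>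

lemma hensel_gap_impossible:
  assumes gap: "hensel_gap V dom_field f b a" shows False
proof -
  interpret hensel_gap V dom_field f b a by (rule gap)
  define n where "n = degree f"
  obtain H where H: "H \<in> fun_polys R" "H None = f" "\<And>j. degree (H j) \<le> n"
    using dom_field_lift[OF f(2)] unfolding n_def by blast
  obtain \<beta> where \<beta>: "\<beta> \<in> R" "\<beta> None = b" using f(3) by (auto simp: dom_field_def)
  have evd: "\<forall>\<^sub>F j in G. H j \<in> integral_polys \<and> 0 \<le> V (\<beta> j) \<and> 0 < V (poly (H j) (\<beta> j)) \<and>
      V (poly (pderiv (H j)) (\<beta> j)) = 0"
    by (rule lift_datum[OF H(1,3) \<beta>(1), of dom_field]) (simp add: H(2) \<beta>(2) datum)
  \<comment> \<open>At \<open>None\<close> the root is the given \<open>a\<close>. Elsewhere it is a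
    Hensel root near \<open>\<beta> j\<close> where one exists, and an arbitrary element at the
    remaining indices.\<close>
  define \<alpha> where "\<alpha> = (\<lambda>j. if j = None then a else SOME y. poly (H j) y = 0 \<and> 0 < V (y - \<beta> j))"
  have ev\<alpha>: "\<forall>\<^sub>F j in G. poly (H j) (\<alpha> j) = 0 \<and> 0 < V (\<alpha> j - \<beta> j)"
    using evd
  proof eventually_elim
    case (elim j)
    show ?case
    proof (cases j)
      case None
      then show ?thesis using root H(2) \<beta>(2) by (simp add: \<alpha>_def)
    next
      case (Some i)
      then show ?thesis using someI_ex[OF simple_root_exists[of "H j" "\<beta> j"]] elim by (simp add: \<alpha>_def)
    qed
  qed
  have f0: "f \<noteq> 0" using f(6) by (auto simp: zero_extval_def)
  obtain P where P: "P \<in> fun_polys R" "\<And>j. degree (P j) = n" "\<And>j. coeff (P j) n = 1"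
    "\<forall>\<^sub>F j in G. \<exists>c. c \<noteq> 0 \<and> smult c (P j) = H j"
    using monic_associate[of H] H f0 unfolding n_def by auto
  have n0: "n > 0" using f0 root(1) unfolding n_def by (auto elim!: degree_eq_zeroE intro!: gr0I)
  define R' where "R' = (\<lambda>H j. poly (H j) (\<alpha> j)) ` fun_polys R"
  have same_value: "\<exists>r\<in>R. \<forall>\<^sub>F j in G. V (poly (E j) (\<alpha> j)) = V (r j)" if E: "E \<in> fun_polys R" for E
  proof -
    \<comment> \<open>Reduction modulo the monic associate of \<open>H\<close> leads to degrees
      below \<open>n\<close>, where \<open>dominated_translate_near\<close> applies.\<close>
    obtain D where D: "D \<in> fun_polys R" "\<And>j. degree (D j) < n" "\<And>j. \<exists>q. E j = q * P j + D j"
      using fun_polys_mod_monic[OF R P(1-3) n0 E] by blast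
    have evD: "\<forall>\<^sub>F j in G. poly (E j) (\<alpha> j) = poly (D j) (\<alpha> j)"
      using P(4) ev\<alpha>
    proof eventually_elim
      case (elim j)
      obtain q where "E j = q * P j + D j" using D(3) by blast
      moreover have "poly (P j) (\<alpha> j) = 0" using elim by (metis mult_eq_0_iff poly_smult)
      ultimately show ?case by simp
    qed
    define h where "h = D None"
    have h: "h \<in> polys_over dom_field" unfolding h_def dom_field_def
      by (intro polys_overI image_eqI[OF _ fun_polys_coeff[OF R D(1)]]) simp
    show ?thesis
    proof (cases "h = 0")
      case True
      have "\<forall>\<^sub>F j in G. \<forall>k\<in>{..<n}. coeff (D j) k = 0"
        using True by (intro eventually_ball_finite ballI germ_zero fun_polys_coeff[OF R D(1)]) (auto simp: h_def)
      then have "\<forall>\<^sub>F j in G. V (poly (E j) (\<alpha> j)) = V 0"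
        using evD
      proof eventually_elim
        case (elim j)
        have "D j = 0"
        proof (rule poly_eqI)
          fix k show "coeff (D j) k = coeff 0 k"
            using elim(1) D(2)[of j] by (cases "k < n") (auto simp: coeff_eq_0)
        qed
        then show ?case using elim by simp
      qed
      then show ?thesis using RD(2) by (intro bexI[of _ "\<lambda>_. 0"])
    next
      case False
      obtain c where c: "c \<in> dom_field" "0 < V (c - b)" "poly f c \<noteq> 0" "poly h c \<noteq> 0"
        "\<And>k. k > 0 \<Longrightarrow> V (poly h c) < V (coeff (pcompose h [:c, poly f c:]) k)"
        using dominated_translate_near[OF h False] D(2)[of None] unfolding h_def n_def by blast
      obtain \<gamma> where \<gamma>: "\<gamma> \<in> R" "\<gamma> None = c" using c(1) by (auto simp: dom_field_def)
      define \<phi> where "\<phi> = (\<lambda>j. poly (H j) (\<gamma> j))"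
      define r where "r = (\<lambda>j. poly (D j) (\<gamma> j))"
      define T where "T = (\<lambda>j. pcompose (D j) [:\<gamma> j, \<phi> j:])"
      have \<phi>: "\<phi> \<in> R" "\<phi> None = poly f c" unfolding \<phi>_def
        by (rule fun_polys_poly[OF R H(1) \<gamma>(1)]) (simp add: H(2) \<gamma>(2))
      have r: "r \<in> R" "r None = poly h c" unfolding r_def
        by (rule fun_polys_poly[OF R D(1) \<gamma>(1)]) (simp add: h_def \<gamma>(2))
      have T: "T \<in> fun_polys R" unfolding T_def
        by (intro fun_polys_pcompose[OF R D(1)] fun_polys_pCons[OF R] fun_polys_0[OF R] \<gamma>(1) \<phi>(1))
      have T_None: "T None = pcompose h [:c, poly f c:]" by (simp add: T_def h_def \<gamma>(2) \<phi>(2))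
      have "\<forall>\<^sub>F j in G. \<forall>k\<in>{0<..<n}. V (r j) < V (coeff (T j) k)"
        by (intro eventually_ball_finite ballI germ_less[OF r(1) fun_polys_coeff[OF R T]])
          (auto simp: r(2) T_None c(5))
      moreover have "\<forall>\<^sub>F j in G. r j \<noteq> 0" by (rule germ_nonzero[OF r(1)]) (simp add: r(2) c(4))
      moreover have "\<forall>\<^sub>F j in G. \<phi> j \<noteq> 0" by (rule germ_nonzero[OF \<phi>(1)]) (simp add: \<phi>(2) c(3))
      moreover have "\<forall>\<^sub>F j in G. 0 < V (\<gamma> j - \<beta> j)"
        by (rule germ_pos[OF RD(5)[OF \<gamma>(1) \<beta>(1)]]) (simp add: \<gamma>(2) \<beta>(2) c(2))
      ultimately have "\<forall>\<^sub>F j in G. V (poly (E j) (\<alpha> j)) = V (r j)"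
        using evD evd ev\<alpha>
      proof eventually_elim
        case (elim j)
        have "V (poly (D j) (\<gamma> j)) < V (coeff (pcompose (D j) [:\<gamma> j, poly (H j) (\<gamma> j):]) k)" if "k > 0" for k
        proof (cases "k < n")
          case True
          then show ?thesis using elim(1) that by (simp add: r_def T_def \<phi>_def)
        next
          \<comment> \<open>Coefficients of index at least \<open>n\<close> vanish and have value
            \<open>Infty\<close>, while \<open>r j\<close> is nonzero; so comparing finitely many
            coefficients suffices.\<close>
          case False
          have "degree (T j) \<le> degree (D j)" unfolding T_def
            by (rule order_trans[OF degree_pcompose_le]) (auto simp: degree_pCons_eq_if)
          then have "coeff (T j) k = 0" using False D(2)[of j] by (intro coeff_eq_0) linarith
          then show ?thesis using elim(2) by (simp add: r_def T_def \<phi>_def V_Infty_iff)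
        qed
        then have "V (poly (D j) (\<alpha> j)) = V (poly (D j) (\<gamma> j))"
          using elim by (intro V_eq_of_dominated_translate[of "H j" "\<beta> j"]) (auto simp: \<phi>_def)
        then show ?case using elim by (simp add: r_def)
      qed
      then show ?thesis using r(1) by blast
    qed
  qed
  have "val_respecting F R'"
    by (rule val_respecting_extension[OF val_respecting]) (use same_value in \<open>auto simp: R'_def\<close>)
  moreover have "R \<subseteq> R'"
  proof
    fix r assume "r \<in> R"
    then show "r \<in> R'" unfolding R'_def by (intro image_eqI[OF _ fun_polys_const[OF R]]) auto
  qed
  moreover have "fun_ring R'" unfolding R'_def by (rule fun_ring_adjoin)
  ultimately have "R' = R" by (intro maximal)
  \<comment> \<open>\<open>\<alpha>\<close> is the value of the polynomial \<open>X\<close>, so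
    maximality forces \<open>a\<close> into \<open>dom_field\<close>.\<close>
  moreover have "\<alpha> \<in> R'" unfolding R'_def
    by (rule image_eqI[OF _ fun_polys_monom[OF R RD(1), of 1]]) (simp add: poly_monom)
  ultimately have "\<alpha> None \<in> dom_field" by (auto simp: dom_field_def)
  then show False using root(3) by (simp add: \<alpha>_def)
qed

text \<open>Induction on the degree supplies the minimality clause of
  \<open>hensel_gap\<close>.\<close>

lemma hensel_dom_field:
  assumes "hensel_datum dom_field f b" shows "\<exists>y\<in>dom_field. poly f y = 0 \<and> 0 < V (y - b)"
  using assms
proof (induction "degree f" arbitrary: f b rule: less_induct)
  case less
  show ?case
  proof (rule ccontr)
    assume no: "\<not> ?thesis"
    note d = hensel_datumD[OF less.prems]
    obtain a where a: "poly f a = 0" "0 < V (a - b)" using simple_root_exists[OF d(5,6)] by blast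
    have "hensel_gap V dom_field f b a"
      using field_closed_dom_field less a no by unfold_locales auto
    then show False by (rule hensel_gap_impossible)
  qed
qed

section \<open>Preimages of subfields under the germ embedding\<close>

lemma germ_tail: "eventually P G \<Longrightarrow> \<forall>\<^sub>F i in F. P (Some i)"
  by (simp add: eventually_germ_filter)

definition germs_in :: "'a set \<Rightarrow> 'a set" where
  "germs_in N = (\<lambda>r. r None) ` {r\<in>R. \<forall>\<^sub>F i in F. r (Some i) \<in> N}"

context
  fixes N :: "'a set"
  assumes N: "field_closed N"
begin

lemma germs_inI: "r \<in> R \<Longrightarrow> \<forall>\<^sub>F i in F. r (Some i) \<in> N \<Longrightarrow> r None \<in> germs_in N"
  by (auto simp: germs_in_def)

lemma germs_inE:
  assumes "y \<in> germs_in N"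
  obtains r where "r \<in> R" "y = r None" "\<forall>\<^sub>F i in F. r (Some i) \<in> N"
  using assms by (auto simp: germs_in_def)

lemma field_closed_germs_in: "field_closed (germs_in N)"
proof -
  note N' = ring_closedD(1,3-5)[OF field_closedD(1)[OF N]] field_closedD(2)[OF N]
  show ?thesis
    unfolding field_closed_def ring_closed_def
  proof (intro conjI ballI)
    show "1 \<in> germs_in N" using germs_inI[OF RD(1)] N' by simp
  next
    fix y assume "y \<in> germs_in N"
    then obtain r where r: "r \<in> R" "y = r None" "\<forall>\<^sub>F i in F. r (Some i) \<in> N" by (rule germs_inE)
    have "\<forall>\<^sub>F i in F. - r (Some i) \<in> N" "\<forall>\<^sub>F i in F. inverse (r (Some i)) \<in> N"
      by (use r(3) in eventually_elim, rule N'; assumption)+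
    then show "- y \<in> germs_in N" "inverse y \<in> germs_in N"
      using germs_inI[OF RD(3)[OF r(1)]] germs_inI[OF germ_inverse[OF r(1)]] r(2) by auto
  next
    fix y y' assume "y \<in> germs_in N" "y' \<in> germs_in N"
    then obtain r r' where r: "r \<in> R" "y = r None" "\<forall>\<^sub>F i in F. r (Some i) \<in> N"
      "r' \<in> R" "y' = r' None" "\<forall>\<^sub>F i in F. r' (Some i) \<in> N" by (metis germs_inE)
    have "\<forall>\<^sub>F i in F. r (Some i) + r' (Some i) \<in> N" "\<forall>\<^sub>F i in F. r (Some i) * r' (Some i) \<in> N"
      by (use r(3,6) in eventually_elim, rule N'; assumption)+
    then show "y + y' \<in> germs_in N" "y * y' \<in> germs_in N"
      using germs_inI[OF RD(4)[OF r(1,4)]] germs_inI[OF RD(6)[OF r(1,4)]] r by auto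
  qed
qed

text \<open>A Hensel root exists in \<open>dom_field\<close>. At each large index \<open>N\<close>
  contains a Hensel root of the specialised polynomial, and uniqueness of simple roots identifies it
  with the germ of the first.\<close>

lemma henselian_germs_in:
  assumes hN: "henselian N V" shows "henselian (germs_in N) V"
  unfolding henselian_iff[OF field_closed_germs_in]
proof (intro allI impI)
  fix f b assume datum: "hensel_datum (germs_in N) f b"
  note d = hensel_datumD[OF datum]
  let ?S = "{r\<in>R. \<forall>\<^sub>F i in F. r (Some i) \<in> N}"
  have sub: "germs_in N \<subseteq> dom_field" by (auto simp: germs_in_def dom_field_def)
  have "hensel_datum dom_field f b"
    using datum sub by (auto simp: hensel_datum_def val_ring_def polys_over_def)
  then obtain a where a: "a \<in> dom_field" "poly f a = 0" "0 < V (a - b)" using hensel_dom_field by blast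
  obtain \<alpha> where \<alpha>: "\<alpha> \<in> R" "\<alpha> None = a" using a(1) by (auto simp: dom_field_def)
  obtain \<beta> where \<beta>: "\<beta> \<in> R" "b = \<beta> None" "\<forall>\<^sub>F i in F. \<beta> (Some i) \<in> N" using d(3) by (rule germs_inE)
  obtain \<rho> H where H: "\<And>k. \<rho> k \<in> ?S" "H = (\<lambda>j. \<Sum>k\<le>degree f. monom (\<rho> k j) k)" "H \<in> fun_polys R"
    "H None = f" "\<And>j. degree (H j) \<le> degree f"
  proof -
    have "coeff f k \<in> (\<lambda>r. r None) ` ?S" for k
      using polys_overD[OF d(2)] by (simp add: germs_in_def)
    moreover have "?S \<subseteq> R" by blast
    ultimately show ?thesis by (rule lift_poly) (rule that)
  qed
  have evd: "\<forall>\<^sub>F j in G. H j \<in> integral_polys \<and> 0 \<le> V (\<beta> j) \<and> 0 < V (poly (H j) (\<beta> j)) \<and>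
      V (poly (pderiv (H j)) (\<beta> j)) = 0"
    by (rule lift_datum[OF H(3,5) \<beta>(1), of "germs_in N"]) (simp add: H(4) \<beta>(2)[symmetric] datum)
  have ev0: "\<forall>\<^sub>F j in G. poly (H j) (\<alpha> j) = 0"
    by (rule germ_zero[OF fun_polys_poly[OF R H(3) \<alpha>(1)]]) (simp add: H(4) \<alpha>(2) a(2))
  have ev1: "\<forall>\<^sub>F j in G. 0 < V (\<alpha> j - \<beta> j)"
    by (rule germ_pos[OF RD(5)[OF \<alpha>(1) \<beta>(1)]]) (simp add: \<alpha>(2) \<beta>(2)[symmetric] a(3))
  have ev2: "\<forall>\<^sub>F i in F. \<forall>k\<in>{..degree f}. \<rho> k (Some i) \<in> N"
    using H(1) by (intro eventually_ball_finite) auto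
  have "\<forall>\<^sub>F i in F. \<alpha> (Some i) \<in> N"
    using germ_tail[OF ev0] germ_tail[OF ev1] germ_tail[OF evd] ev2 \<beta>(3)
  proof eventually_elim
    case (elim i)
    have "coeff (H (Some i)) k \<in> N" for k
      using elim ring_closedD(2)[OF field_closedD(1)[OF N]]
      by (cases "k \<le> degree f") (auto simp: H(2) coeff_sum sum.delta)
    then have "hensel_datum N (H (Some i)) (\<beta> (Some i))"
      using elim by (auto simp: hensel_datum_def val_ring_def polys_over_def)
    then obtain y where y: "y \<in> N" "poly (H (Some i)) y = 0" "0 < V (y - \<beta> (Some i))"
      using hN henselian_iff[OF N] by blast
    have "\<alpha> (Some i) = y"
      by (rule simple_root_unique[of "H (Some i)" "\<beta> (Some i)"]) (use elim y in blast)+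
    then show ?case using y(1) by simp
  qed
  then have "a \<in> germs_in N" using germs_inI[OF \<alpha>(1)] \<alpha>(2) by simp
  then show "\<exists>a\<in>germs_in N. poly f a = 0 \<and> 0 < V (a - b)" using a by blast
qed

end

text \<open>The germ attached to \<open>c\<close> is unique, hence eventually the constant
  \<open>c\<close>; as the filter is proper, \<open>c\<close> lies in \<open>N\<close>.\<close>

lemma germs_in_constant:
  assumes "(\<lambda>_. c) \<in> R" "c \<in> germs_in N" shows "c \<in> N"
proof -
  obtain r where r: "r \<in> R" "c = r None" "\<forall>\<^sub>F i in F. r (Some i) \<in> N"
    using assms(2) by (auto simp: germs_in_def)
  have "\<forall>\<^sub>F j in G. r j - c = 0" by (rule germ_zero[OF RD(5)[OF r(1) assms(1)]]) (simp add: r(2))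
  then have "\<forall>\<^sub>F i in F. r (Some i) = c" by (simp add: eventually_germ_filter)
  with r(3) have "\<forall>\<^sub>F i in F. c \<in> N" by eventually_elim simp
  then show ?thesis using proper by (simp add: eventually_const)
qed

end

subsection \<open>Henselizations\<close>

context alg_closed_valued
begin

lemma henselian_alg_clos:
  assumes K: "field_closed K" shows "henselian (alg_clos K) V"
  unfolding henselian_iff[OF field_closed_alg_clos[OF K]]
proof (intro allI impI)
  fix f b assume "hensel_datum (alg_clos K) f b"
  note d = hensel_datumD[OF this]
  obtain a where a: "poly f a = 0" "0 < V (a - b)" using simple_root_exists[OF d(5,6)] by blast
  have "f \<noteq> 0" using d(6) by (auto simp: zero_extval_def)
  then have "a \<in> alg_clos K" using root_in_alg_clos[OF K d(2)] a(1) by blast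
  with a show "\<exists>a\<in>alg_clos K. poly f a = 0 \<and> 0 < V (a - b)" by blast
qed

lemma henselization_incl: "F \<subseteq> henselization F V"
  by (auto simp: henselization_def)

lemma henselization_least:
  "field_closed L \<Longrightarrow> F \<subseteq> L \<Longrightarrow> henselian L V \<Longrightarrow> henselization F V \<subseteq> L"
  by (auto simp: henselization_def subfield_ambient_iff)

lemma henselization_mono: "F \<subseteq> F' \<Longrightarrow> henselization F V \<subseteq> henselization F' V"
  by (auto simp: henselization_def)

lemma field_closed_henselization: "field_closed (henselization F V)"
  unfolding henselization_def by (rule field_closed_Inter) (auto simp: subfield_ambient_iff)

text \<open>The simple root near \<open>b\<close> is unique in the ambient field, so all henselian
  fields in the intersection contain the same one.\<close>

lemma henselian_henselization: "henselian (henselization F V) V"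
  unfolding henselian_iff[OF field_closed_henselization]
proof (intro allI impI)
  fix f b assume datum: "hensel_datum (henselization F V) f b"
  note d = hensel_datumD[OF datum]
  obtain a where a: "poly f a = 0" "0 < V (a - b)" using simple_root_exists[OF d(5,6)] by blast
  have "a \<in> L" if L: "field_closed L" "F \<subseteq> L" "henselian L V" for L
  proof -
    have "hensel_datum L f b"
      using datum henselization_least[OF L] by (auto simp: hensel_datum_def val_ring_def polys_over_def)
    then obtain a' where a': "a' \<in> L" "poly f a' = 0" "0 < V (a' - b)"
      using L(3) henselian_iff[OF L(1)] by blast
    have "a = a'"
      by (rule simple_root_unique[OF d(1,4,6) a a'(2,3)])
    then show ?thesis using a'(1) by simp
  qed
  then have "a \<in> henselization F V" by (auto simp: henselization_def subfield_ambient_iff)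
  with a show "\<exists>a\<in>henselization F V. poly f a = 0 \<and> 0 < V (a - b)" by blast
qed

end

subsection \<open>Pseudo convergent sequences\<close>

lemma less_succ_index: "i < succ_index (i :: 'i::{wellorder, no_top})"
  unfolding succ_index_def by (rule LeastI_ex) (rule gt_ex)

lemma succ_index_le: "i < j \<Longrightarrow> succ_index (i :: 'i::{wellorder, no_top}) \<le> j"
  unfolding succ_index_def by (rule Least_le)

lemma not_strict_mono_constant:
  fixes s :: "'i::{linorder, no_top} \<Rightarrow> 'b::order"
  assumes "ultimately_strict_mono s" "\<forall>\<^sub>F i in at_top. s i = c" shows False
proof -
  obtain i0 where i0: "strict_mono_on {i0..} s" using assms(1) by (auto simp: ultimately_strict_mono_def)
  obtain i1 where i1: "\<And>i. i \<ge> i1 \<Longrightarrow> s i = c" using assms(2) by (auto simp: eventually_at_top_linorder)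
  obtain j where j: "max i0 i1 < j" using gt_ex by blast
  then have "s (max i0 i1) < s j" using i0 by (auto simp: strict_mono_on_def)
  moreover have "s (max i0 i1) = c" "s j = c" using j by (auto intro: i1)
  ultimately show False by simp
qed

locale pcs_valued = alg_closed_valued V for V :: "'a::alg_closed_field \<Rightarrow> 'g::linordered_ab_group_add extval" +
  fixes z :: "'i::{wellorder, no_top} \<Rightarrow> 'a"
  assumes pc: "i < j \<Longrightarrow> j < k \<Longrightarrow> V (z i - z j) < V (z j - z k)"
begin

definition gauge :: "'i \<Rightarrow> 'g extval" where
  "gauge i = V (z i - z (succ_index i))"

lemma gauge_eq: "i < j \<Longrightarrow> V (z i - z j) = gauge i"
proof -
  assume ij: "i < j"
  show ?thesis
  proof (cases "succ_index i = j")
    case False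
    then have "succ_index i < j" using succ_index_le[OF ij] by simp
    then have "V (z i - z (succ_index i)) < V (z (succ_index i) - z j)" by (rule pc[OF less_succ_index])
    from V_add_eq[OF this] show ?thesis by (simp add: gauge_def)
  qed (simp add: gauge_def)
qed

lemma gauge_less: "i < j \<Longrightarrow> gauge i < gauge j"
  using pc[of i j "succ_index j"] less_succ_index[of j] by (simp add: gauge_eq)

lemma gauge_finite: "gauge i \<noteq> Infty"
  using gauge_less[OF less_succ_index, of i] by auto

text \<open>Imposed at every index. By \<open>is_limitI\<close> the eventual condition already
  implies this: an earlier \<open>z i\<close> is compared with a later \<open>z j\<close>.\<close>

definition is_limit :: "'a \<Rightarrow> bool" where
  "is_limit r \<longleftrightarrow> (\<forall>i. V (z i - r) = gauge i)"

lemma is_limitI: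
  assumes "\<forall>\<^sub>F i in at_top. V (z i - r) = gauge i" shows "is_limit r"
  unfolding is_limit_def
proof
  fix i
  obtain i0 where i0: "\<And>j. j \<ge> i0 \<Longrightarrow> V (z j - r) = gauge j" using assms by (auto simp: eventually_at_top_linorder)
  obtain j where j: "max i i0 < j" using gt_ex by blast
  then have "V (z i - z j) = gauge i" "V (z j - r) = gauge j" using i0 gauge_eq by auto
  then have "V ((z i - z j) + (z j - r)) = gauge i" using V_add_eq[of "z i - z j" "z j - r"] gauge_less j by auto
  then show "V (z i - r) = gauge i" by simp
qed

text \<open>If \<open>V (z i - r)\<close> differs from \<open>gauge i\<close> at one
  \<open>i\<close>, then for \<open>j > i\<close> the summands of
  \<open>(z j - z i) + (z i - r)\<close> have different values, and the sum has their minimum, which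
  does not depend on \<open>j\<close>.\<close>

lemma not_limit:
  assumes "\<not> is_limit r"
  shows "\<exists>c. \<forall>\<^sub>F j in at_top. V (z j - r) = c \<and> c < gauge j"
proof -
  obtain i where i: "V (z i - r) \<noteq> gauge i" using assms by (auto simp: is_limit_def)
  define c where "c = min (V (z i - r)) (gauge i)"
  have tail: "V (z j - r) = c \<and> c < gauge j" if "i < j" for j
  proof -
    have g: "V (z j - z i) = gauge i" using gauge_eq[OF that] V_minus_commute[of "z j"] by simp
    have "V ((z j - z i) + (z i - r)) = c"
      using i V_add_eq[of "z j - z i" "z i - r"] V_add_eq'[of "z i - r" "z j - z i"] g
      by (cases "V (z i - r)" "gauge i" rule: linorder_cases) (auto simp: c_def min_def)
    moreover have "c < gauge j" using gauge_less[OF that] by (auto simp: c_def min_less_iff_disj)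
    ultimately show ?thesis by simp
  qed
  have "\<forall>\<^sub>F j in at_top. V (z j - r) = c \<and> c < gauge j"
    using eventually_gt_at_top[of i] by (rule eventually_mono) (rule tail)
  then show ?thesis by blast
qed

lemma eventually_constant_value:
  assumes "p \<noteq> 0" "\<And>r. poly p r = 0 \<Longrightarrow> \<not> is_limit r"
  shows "\<exists>c. \<forall>\<^sub>F i in at_top. V (poly p (z i)) = c"
  using assms
proof (induction p rule: alg_closed_poly_induct)
  case (root r p)
  then obtain c where c: "\<forall>\<^sub>F i in at_top. V (poly p (z i)) = c" by auto
  obtain d where d: "\<forall>\<^sub>F i in at_top. V (z i - r) = d \<and> d < gauge i" using not_limit[of r] root.prems[of r] by auto
  have "\<forall>\<^sub>F i in at_top. V (poly ([:-r, 1:] * p) (z i)) = d + c"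
    using c d
  proof eventually_elim
    case (elim i)
    have "poly ([:-r, 1:] * p) (z i) = (z i - r) * poly p (z i)" by (simp add: left_diff_distrib)
    then show ?case using elim by (simp only: V_mult)
  qed
  then show ?case by blast
qed auto

text \<open>Otherwise every linear factor of \<open>p\<close> would have ultimately constant value
  along \<open>z\<close>.\<close>

lemma limit_root:
  assumes "ultimately_strict_mono (\<lambda>i. V (poly p (z i)))"
  shows "p \<noteq> 0" "\<exists>r. poly p r = 0 \<and> is_limit r"
proof -
  show "p \<noteq> 0"
  proof
    assume "p = 0"
    then have "\<forall>\<^sub>F i in at_top. V (poly p (z i)) = Infty" by simp
    then show False using not_strict_mono_constant[OF assms] by blast
  qed
  then show "\<exists>r. poly p r = 0 \<and> is_limit r"
    using eventually_constant_value[of p] not_strict_mono_constant[OF assms] by blast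
qed

end

section \<open>Values of polynomials along a sequence with a limit\<close>

locale pcs_with_limit = pcs_valued V z
  for V :: "'a::alg_closed_field \<Rightarrow> 'g::linordered_ab_group_add extval"
    and z :: "'i::{wellorder, no_top} \<Rightarrow> 'a" +
  fixes a :: 'a
  assumes a: "is_limit a"
begin

lemma V_limit: "is_limit r \<Longrightarrow> V (z i - r) = gauge i"
  by (simp add: is_limit_def)

lemma z_neq_limit: "z i \<noteq> a"
  using V_limit[OF a, of i] gauge_finite[of i] by auto

lemma pcs_dichotomy:
  "(\<forall>\<^sub>F i in at_top. V (z i - r) = V (a - r) \<and> a \<noteq> r) \<or> (\<forall>\<^sub>F i in at_top. V (z i - r) = V (z i - a))"
proof (cases "is_limit r")
  case False
  then obtain c where "\<forall>\<^sub>F j in at_top. V (z j - r) = c \<and> c < gauge j" using not_limit by blast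
  then have "\<forall>\<^sub>F j in at_top. V (z j - r) = V (a - r) \<and> a \<noteq> r"
  proof (rule eventually_mono)
    fix j assume "V (z j - r) = c \<and> c < gauge j"
    then have "V (z j - r) < V (z j - a)" by (simp add: V_limit a)
    then show "V (z j - r) = V (a - r) \<and> a \<noteq> r" using V_ultra_eq[of "z j" r a] False a by auto
  qed
  then show ?thesis by blast
qed (simp add: V_limit a)

lemma pcs_monomial:
  assumes "p \<noteq> 0"
  obtains e m where "e \<noteq> 0" "\<forall>\<^sub>F i in at_top. V (poly p (z i)) = V (e * (z i - a) ^ m)"
    "m > 0 \<longleftrightarrow> (\<exists>r. poly p r = 0 \<and> is_limit r)"
proof -
  from eventually_monomial[OF pcs_dichotomy assms] obtain e m where em: "e \<noteq> 0"
    "\<forall>\<^sub>F i in at_top. V (poly p (z i)) = V (e * (z i - a) ^ m)"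
    "m = 0 \<Longrightarrow> \<forall>r. poly p r = 0 \<longrightarrow> (\<forall>\<^sub>F i in at_top. V (z i - r) = V (a - r) \<and> a \<noteq> r)"
    "m > 0 \<Longrightarrow> \<exists>r. poly p r = 0 \<and> (\<forall>\<^sub>F i in at_top. V (z i - r) = V (z i - a))" by blast
  have "m > 0 \<longleftrightarrow> (\<exists>r. poly p r = 0 \<and> is_limit r)"
  proof
    assume "m > 0"
    then show "\<exists>r. poly p r = 0 \<and> is_limit r" using em(4) is_limitI V_limit[OF a] by auto
  next
    assume "\<exists>r. poly p r = 0 \<and> is_limit r"
    then obtain r where r: "poly p r = 0" "is_limit r" by blast
    show "m > 0"
    proof (rule ccontr)
      assume "\<not> m > 0"
      then have "\<forall>\<^sub>F i in at_top. V (z i - r) = V (a - r)" using em(3) r by (auto elim: eventually_mono)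
      then have "\<forall>\<^sub>F i in at_top. gauge i = V (a - r)" by (simp add: V_limit r)
      moreover have "ultimately_strict_mono gauge"
        by (auto simp: ultimately_strict_mono_def strict_mono_on_def gauge_less)
      ultimately show False using not_strict_mono_constant by blast
    qed
  qed
  with em(1,2) show ?thesis by (rule that)
qed

lemma strict_mono_of_limit_root:
  assumes "p \<noteq> 0" "poly p r = 0" "is_limit r"
  shows "ultimately_strict_mono (\<lambda>i. V (poly p (z i)))"
proof -
  obtain e m where em: "e \<noteq> 0" "\<forall>\<^sub>F i in at_top. V (poly p (z i)) = V (e * (z i - a) ^ m)" "m > 0"
    using pcs_monomial[OF assms(1)] assms by metis
  obtain i0 where i0: "\<And>i. i \<ge> i0 \<Longrightarrow> V (poly p (z i)) = V (e * (z i - a) ^ m)"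
    using em(2) by (auto simp: eventually_at_top_linorder)
  have "V (e * (z i - a) ^ m) < V (e * (z j - a) ^ m)" if "i < j" for i j
    using em that by (intro V_mult_le_less V_power_strict_mono) (auto simp: V_limit a gauge_less)
  then have "strict_mono_on {i0..} (\<lambda>i. V (poly p (z i)))"
    by (auto simp: strict_mono_on_def i0)
  then show ?thesis by (auto simp: ultimately_strict_mono_def)
qed

lemma eventually_poly_nonzero:
  assumes "p \<noteq> 0" shows "\<forall>\<^sub>F i in at_top. poly p (z i) \<noteq> 0"
proof -
  obtain e m where "e \<noteq> 0" "\<forall>\<^sub>F i in at_top. V (poly p (z i)) = V (e * (z i - a) ^ m)"
    using pcs_monomial[OF assms] by metis
  then show ?thesis
    by (elim eventually_mono) (use z_neq_limit V_Infty_iff in \<open>metis mult_eq_0_iff power_not_zero right_minus_eq\<close>)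
qed

text \<open>After cancellation of the smaller power of \<open>z i - a\<close>, one side is constant
  and the other is monotone in \<open>i\<close>, so the comparison stabilises.\<close>

lemma eventually_comparable:
  "(\<forall>\<^sub>F i in at_top. V (poly p (z i)) \<le> V (poly q (z i))) \<or> (\<forall>\<^sub>F i in at_top. V (poly q (z i)) < V (poly p (z i)))"
proof (cases "p = 0 \<or> q = 0")
  case True
  show ?thesis
  proof (cases "q = 0")
    case False
    then have "p = 0" using True by simp
    then show ?thesis using eventually_poly_nonzero[OF False] by (auto simp: V_Infty_iff elim: eventually_mono)
  qed simp
next
  case False
  obtain e m where e: "e \<noteq> 0" "\<forall>\<^sub>F i in at_top. V (poly p (z i)) = V (e * (z i - a) ^ m)"
    using pcs_monomial False by metis
  obtain e' m' where e': "e' \<noteq> 0" "\<forall>\<^sub>F i in at_top. V (poly q (z i)) = V (e' * (z i - a) ^ m')"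
    using pcs_monomial False by metis
  let ?P = "\<lambda>i. V (e * (z i - a) ^ m) \<le> V (e' * (z i - a) ^ m')"
  have up: "V (e * (z i - a) ^ k) \<le> V (e * (z j - a) ^ k)" if "i \<le> j" for e i j k
    using that by (intro V_mult_mono V_power_mono) (auto simp: V_limit a le_less gauge_less)
  have "(\<forall>\<^sub>F i in at_top. ?P i) \<or> (\<forall>\<^sub>F i in at_top. \<not> ?P i)"
  proof (cases "m \<le> m'")
    case True
    have P: "?P i \<longleftrightarrow> V e \<le> V (e' * (z i - a) ^ (m' - m))" for i
      using V_mult_cancel(1)[of "(z i - a) ^ m" e "e' * (z i - a) ^ (m' - m)"] z_neq_limit[of i] True
      by (simp add: mult.assoc flip: power_add)
    show ?thesis
    proof (cases "\<exists>i. ?P i")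
      case True
      then obtain i where "?P i" by blast
      then have tail: "?P j" if "i \<le> j" for j using up[OF that, of e' "m' - m"] unfolding P by (rule order_trans)
      show ?thesis
        by (intro disjI1 eventually_mono[OF eventually_ge_at_top[of i]]) (rule tail)
    qed auto
  next
    case False
    have P: "?P i \<longleftrightarrow> V (e * (z i - a) ^ (m - m')) \<le> V e'" for i
      using V_mult_cancel(1)[of "(z i - a) ^ m'" "e * (z i - a) ^ (m - m')" e'] z_neq_limit[of i] False
      by (simp add: mult.assoc flip: power_add)
    show ?thesis
    proof (cases "\<forall>i. ?P i")
      case False
      then obtain i where "\<not> ?P i" by blast
      then have tail: "\<not> ?P j" if "i \<le> j" for j using up[OF that, of e "m - m'"] unfolding P by (meson order_trans)
      show ?thesis
        by (intro disjI2 eventually_mono[OF eventually_ge_at_top[of i]]) (rule tail)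
    qed auto
  qed
  then show ?thesis
  proof
    assume "\<forall>\<^sub>F i in at_top. ?P i"
    then have "\<forall>\<^sub>F i in at_top. V (poly p (z i)) \<le> V (poly q (z i))"
      using e(2) e'(2) by eventually_elim simp
    then show ?thesis ..
  next
    assume "\<forall>\<^sub>F i in at_top. \<not> ?P i"
    then have "\<forall>\<^sub>F i in at_top. V (poly q (z i)) < V (poly p (z i))"
      using e(2) e'(2) by eventually_elim simp
    then show ?thesis ..
  qed
qed

end

text \<open>\<open>induced\<close> describes the valuation ring over the algebraic closure.
  \<open>Q_least\<close> restates the minimality of \<open>Q\<close> through roots: a polynomial has
  ultimately increasing values along the sequence exactly if it is nonzero and has a limit among its
  roots.\<close>

locale induced_pcs = pcs_with_limit V z a
  for V :: "'a::alg_closed_field \<Rightarrow> 'g::linordered_ab_group_add extval"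
    and z :: "'i::{wellorder, no_top} \<Rightarrow> 'a" and a :: 'a +
  fixes K :: "'a set" and x :: 'a and Q :: "'a poly"
  assumes K: "field_closed K" and transc: "\<not> alg_over K x" and zK: "z i \<in> K"
    and induced: "p \<in> polys_over (alg_clos K) \<Longrightarrow> q \<in> polys_over (alg_clos K) \<Longrightarrow> q \<noteq> 0 \<Longrightarrow>
      0 \<le> V (poly p x / poly q x) \<longleftrightarrow> (\<forall>\<^sub>F i in at_top. 0 \<le> V (poly p (z i) / poly q (z i)))"
    and Q: "Q \<in> polys_over K" "lead_coeff Q = 1" "poly Q a = 0"
    and Q_least: "f \<in> polys_over K \<Longrightarrow> f \<noteq> 0 \<Longrightarrow> poly f r = 0 \<Longrightarrow> is_limit r \<Longrightarrow> degree Q \<le> degree f"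
begin

abbreviation "C \<equiv> alg_clos K"

lemmas C = field_closed_alg_clos[OF K]
lemmas CR = field_closedD(1)[OF C]
lemmas KR = field_closedD(1)[OF K]
lemmas KC = alg_clos_incl[OF K]

lemma polys_KC: "p \<in> polys_over K \<Longrightarrow> p \<in> polys_over C"
  by (rule polys_over_mono[OF KC])

lemma poly_x_nonzero: "p \<in> polys_over C \<Longrightarrow> p \<noteq> 0 \<Longrightarrow> poly p x \<noteq> 0"
  using alg_over_trans[OF K, of x] transc by (auto simp: alg_over_def)

lemma V_poly_le_iff:
  assumes "p \<in> polys_over C" "q \<in> polys_over C"
  shows "V (poly p x) \<le> V (poly q x) \<longleftrightarrow> (\<forall>\<^sub>F i in at_top. V (poly p (z i)) \<le> V (poly q (z i)))"
proof (cases "p = 0")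
  case True
  show ?thesis
  proof (cases "q = 0")
    case False
    have "\<not> (\<forall>\<^sub>F i in at_top. poly q (z i) = 0)"
    proof
      assume "\<forall>\<^sub>F i in at_top. poly q (z i) = 0"
      with eventually_poly_nonzero[OF False] have "\<forall>\<^sub>F i in (at_top :: 'i filter). False"
        by eventually_elim simp
      then show False by simp
    qed
    then show ?thesis using True poly_x_nonzero[OF assms(2) False] by (simp add: V_Infty_iff)
  qed simp
next
  case False
  have "V (poly p x) \<le> V (poly q x) \<longleftrightarrow> 0 \<le> V (poly q x / poly p x)"
    using V_divide_nonneg poly_x_nonzero[OF assms(1) False] by simp
  also have "\<dots> \<longleftrightarrow> (\<forall>\<^sub>F i in at_top. 0 \<le> V (poly q (z i) / poly p (z i)))"
    by (rule induced[OF assms(2,1) False])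
  also have "\<dots> \<longleftrightarrow> (\<forall>\<^sub>F i in at_top. V (poly p (z i)) \<le> V (poly q (z i)))"
    by (rule eventually_cong[OF eventually_poly_nonzero[OF False]]) (simp add: V_divide_nonneg)
  finally show ?thesis .
qed

text \<open>Negating \<open>V_poly_le_iff\<close> yields only failure at arbitrarily large indices;
  \<open>eventually_comparable\<close> upgrades this to failure from some index on.\<close>

lemma V_poly_less_iff:
  assumes "p \<in> polys_over C" "q \<in> polys_over C"
  shows "V (poly p x) < V (poly q x) \<longleftrightarrow> (\<forall>\<^sub>F i in at_top. V (poly p (z i)) < V (poly q (z i)))"
proof -
  have "\<not> (\<forall>\<^sub>F i in at_top. V (poly q (z i)) \<le> V (poly p (z i)))"
    if less: "\<forall>\<^sub>F i in at_top. V (poly p (z i)) < V (poly q (z i))"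
  proof
    assume "\<forall>\<^sub>F i in at_top. V (poly q (z i)) \<le> V (poly p (z i))"
    with less have "\<forall>\<^sub>F i in (at_top :: 'i filter). False" by eventually_elim simp
    then show False by simp
  qed
  then show ?thesis
    using V_poly_le_iff[OF assms(2,1)] eventually_comparable[of q p] by (auto simp flip: not_le)
qed

lemma linear_over: "c \<in> C \<Longrightarrow> [:-c, 1:] \<in> polys_over C" "c \<in> C \<Longrightarrow> [:c:] \<in> polys_over C"
  using ring_closedD[OF CR] by (auto simp: polys_over_pCons[OF CR] polys_over_closed[OF CR])

lemma zC: "z i \<in> C"
  using zK KC by blast

lemma Q0: "Q \<noteq> 0" "0 < degree Q"
proof -
  show "Q \<noteq> 0" using Q(2) by auto
  then show "0 < degree Q" using Q(3) by (auto elim!: degree_eq_zeroE intro!: gr0I)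
qed

lemma a_alg: "a \<in> C"
  using root_in_alg_clos[OF K polys_KC[OF Q(1)] Q0(1) Q(3)] .

section \<open>Distances between \<open>x\<close> and constants; the minimal pair\<close>

lemma V_x_minus_le: "c \<in> C \<Longrightarrow> d \<in> C \<Longrightarrow>
    V (x - c) \<le> V (x - d) \<longleftrightarrow> (\<forall>\<^sub>F i in at_top. V (z i - c) \<le> V (z i - d))"
  using V_poly_le_iff[OF linear_over(1) linear_over(1), of c d] by simp

lemma V_x_minus_less: "c \<in> C \<Longrightarrow> d \<in> C \<Longrightarrow>
    V (x - c) < V (x - d) \<longleftrightarrow> (\<forall>\<^sub>F i in at_top. V (z i - c) < V (z i - d))"
  using V_poly_less_iff[OF linear_over(1) linear_over(1), of c d] by simp

lemma V_x_minus_limit: "c \<in> C \<Longrightarrow> V (x - c) \<le> V (x - a)"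
  using not_limit[of c] unfolding V_x_minus_le[OF _ a_alg]
  by (cases "is_limit c") (auto simp: V_limit a elim: eventually_mono)

lemma V_x_minus_not_limit: "c \<in> C \<Longrightarrow> \<not> is_limit c \<Longrightarrow> V (x - c) < V (x - a)"
  using not_limit[of c] unfolding V_x_minus_less[OF _ a_alg]
  by (auto simp: V_limit a elim: eventually_mono)

lemma V_x_minus_z_less: "V (x - z i) < V (x - z j) \<longleftrightarrow> i < j"
proof -
  have *: "V (x - z i) < V (x - z j)" if "i < j" for i j
    unfolding V_x_minus_less[OF zC zC]
    using eventually_gt_at_top[of j]
    by (rule eventually_mono) (use that gauge_less in \<open>simp add: gauge_eq V_minus_commute[of "z _" "z i"] V_minus_commute[of "z _" "z j"]\<close>)
  show ?thesis using *[of i j] *[of j i] by (cases i j rule: linorder_cases) auto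
qed

lemma V_x_minus_z_less_limit: "V (x - z i) < V (x - a)"
proof (rule V_x_minus_not_limit[OF zC])
  show "\<not> is_limit (z i)"
    using gauge_finite[of i] V_limit[of "z i" i] by auto
qed

text \<open>An element \<open>b\<close> at least as near to \<open>a\<close> as \<open>x\<close> is
  must itself be a limit, so its minimal polynomial competes with \<open>Q\<close> in
  degree.\<close>

lemma min_pair: "minimal_pair K x V a (V (x - a))"
  unfolding minimal_pair_def
proof (intro conjI ballI impI)
  show "a \<in> C" by (rule a_alg)
  have "x - a \<in> adjoin C x"
    using adjoin_incl(1)[of C x] adjoin_incl(2)[of x C] a_alg ring_closedD(6)[OF field_closedD(1)[OF field_closed_adjoin]] by blast
  moreover have "x - a \<noteq> 0" using poly_x_nonzero[OF linear_over(1)[OF a_alg]] by simp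
  ultimately show "V (x - a) \<in> value_group (adjoin C x) V" by (auto simp: value_group_def)
  show "V (x - c) \<le> V (x - a)" if "c \<in> C" for c by (rule V_x_minus_limit[OF that])
  fix b assume b: "b \<in> C" and ab: "V (x - a) \<le> V (a - b)"
  have "a - b \<in> C" using a_alg b by (rule ring_closedD[OF CR])
  then have "\<forall>\<^sub>F i in at_top. gauge i \<le> V (a - b)"
    using ab V_poly_le_iff[OF linear_over(1)[OF a_alg] linear_over(2), of "a - b"] by (simp add: V_limit a)
  then obtain i0 where i0: "\<And>i. i \<ge> i0 \<Longrightarrow> gauge i \<le> V (a - b)" by (auto simp: eventually_at_top_linorder)
  have lim: "is_limit b"
    unfolding is_limit_def
  proof
    fix i
    \<comment> \<open>A later index turns the weak bound on \<open>gauge\<close> into a strict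
      one.\<close>
    obtain j where j: "max i i0 < j" using gt_ex by blast
    then have "gauge i < V (a - b)" using i0[of j] gauge_less[of i j] by (auto intro: less_le_trans)
    then have "V ((z i - a) + (a - b)) = gauge i" using V_add_eq[of "z i - a" "a - b"] by (simp add: V_limit a)
    then show "V (z i - b) = gauge i" by simp
  qed
  have "alg_over K b" using b by (simp add: alg_clos_def)
  from minimal_polynomial[OF K this] obtain p where p: "p \<in> polys_over K" "lead_coeff p = 1"
    "degree p = simple_ext_degree K b" "poly p b = 0" by blast
  have "simple_ext_degree K a \<le> degree Q" by (rule simple_ext_degree_le[OF K Q(1) Q0(1) Q(3)])
  also have "degree Q \<le> degree p" using p lim by (intro Q_least[of p b]) auto
  finally show "simple_ext_degree K a \<le> simple_ext_degree K b" using p(3) by simp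
qed simp

section \<open>Key polynomials\<close>

lemma delta_Max:
  assumes "f \<in> polys_over K" "f \<noteq> 0"
  shows "delta K x V f = Max ((\<lambda>c. V (x - c)) ` {c. poly f c = 0})" "finite {c. poly f c = 0}"
    "\<And>c. poly f c = 0 \<Longrightarrow> c \<in> C"
proof -
  show c: "\<And>c. poly f c = 0 \<Longrightarrow> c \<in> C"
    using root_in_alg_clos[OF K polys_KC[OF assms(1)] assms(2)] .
  then have "{V (x - c) |c. c \<in> C \<and> poly f c = 0} = (\<lambda>c. V (x - c)) ` {c. poly f c = 0}" by auto
  then show "delta K x V f = Max ((\<lambda>c. V (x - c)) ` {c. poly f c = 0})" by (simp add: delta_def)
  show "finite {c. poly f c = 0}" by (rule poly_roots_finite[OF assms(2)])
qed

lemma linear_over_K: "[:- z i, 1:] \<in> polys_over K"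
  using ring_closedD[OF KR] zK by (auto simp: polys_over_pCons[OF KR] polys_over_closed[OF KR])

lemma delta_linear: "delta K x V [:- z i, 1:] = V (x - z i)"
  using delta_Max(1)[OF linear_over_K[of i]] by simp

lemma delta_Q: "delta K x V Q = V (x - a)"
  unfolding delta_Max(1)[OF Q(1) Q0(1)]
  by (rule Max_eqI) (use delta_Max(2,3)[OF Q(1) Q0(1)] V_x_minus_limit Q(3) in auto)

text \<open>A polynomial of smaller degree has no limit among its roots, and constants that are not
  limits are strictly farther from \<open>x\<close> than \<open>a\<close> is.\<close>

lemma key_Q: "key_polynomial K x V Q"
  unfolding key_polynomial_def delta_Q
proof (intro conjI ballI impI)
  fix f assume f: "f \<in> polys_over K" "0 < degree f" "degree f < degree Q"
  then have f0: "f \<noteq> 0" by auto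
  have "V (x - c) < V (x - a)" if "poly f c = 0" for c
    using Q_least[OF f(1) f0 that] f(3) V_x_minus_not_limit[OF delta_Max(3)[OF f(1) f0 that]] by auto
  moreover have "{c. poly f c = 0} \<noteq> {}" using alg_closed_imp_poly_has_root[OF f(2)] by auto
  ultimately show "delta K x V f < V (x - a)"
    unfolding delta_Max(1)[OF f(1) f0] using delta_Max(2)[OF f(1) f0] by simp
qed (use Q Q0 in auto)

text \<open>An adic coefficient has degree below that of \<open>Q\<close>, hence no limit root,
  hence ultimately constant value along the sequence if it is nonzero. If two nonzero terms had
  equal value, cancelling the smaller power of \<open>Q\<close> would make the value of a positive
  power of \<open>Q\<close> ultimately constant.\<close>

lemma truncation_Q:
  assumes f: "f \<in> polys_over K"
  shows "V (poly f x) = truncation x V Q f"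
proof -
  define c where "c = adic_coeff Q f"
  have cK: "c i \<in> polys_over K" for i
    unfolding c_def adic_coeff_def by (intro poly_div_mod_over[OF K] polys_over_power[OF KR] f Q(1))
  have cconst: "\<exists>e. e \<noteq> 0 \<and> (\<forall>\<^sub>F i in at_top. V (poly (c n) (z i)) = V e)" if nz: "c n \<noteq> 0" for n
  proof -
    have "degree (c n) < degree Q" unfolding c_def by (rule degree_adic_coeff[OF Q0(2)])
    then have no: "\<not> (\<exists>r. poly (c n) r = 0 \<and> is_limit r)" using Q_least[OF cK nz] by fastforce
    obtain e m where em: "e \<noteq> 0" "\<forall>\<^sub>F i in at_top. V (poly (c n) (z i)) = V (e * (z i - a) ^ m)"
      "m > 0 \<longleftrightarrow> (\<exists>r. poly (c n) r = 0 \<and> is_limit r)" using pcs_monomial[OF nz] .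
    then have "m = 0" using no by simp
    then show ?thesis using em(1,2) by auto
  qed
  have distinct: "V (poly (c m * Q ^ m) x) \<noteq> V (poly (c n * Q ^ n) x)"
    if mn: "m < n" "c m \<noteq> 0" "c n \<noteq> 0" for m n
  proof
    assume eq: "V (poly (c m * Q ^ m) x) = V (poly (c n * Q ^ n) x)"
    have over: "c k * Q ^ k \<in> polys_over C" for k
      by (intro polys_KC polys_over_closed[OF KR] polys_over_power[OF KR] cK Q(1))
    have ev: "\<forall>\<^sub>F i in at_top. V (poly (c m * Q ^ m) (z i)) = V (poly (c n * Q ^ n) (z i))"
      using eventually_conj[OF V_poly_le_iff[OF over over, THEN iffD1, of m n]
          V_poly_le_iff[OF over over, THEN iffD1, of n m]] eq by (auto elim: eventually_mono)
    obtain d where d: "d \<noteq> 0" "\<forall>\<^sub>F i in at_top. V (poly (c m) (z i)) = V d"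
      using cconst[OF mn(2)] by blast
    obtain e where e: "e \<noteq> 0" "\<forall>\<^sub>F i in at_top. V (poly (c n) (z i)) = V e"
      using cconst[OF mn(3)] by blast
    have "\<forall>\<^sub>F i in at_top. V (poly (Q ^ (n - m)) (z i)) = V (d / e)"
      using ev d(2) e(2) eventually_poly_nonzero[OF Q0(1)]
    proof eventually_elim
      case (elim i)
      define q where "q = poly Q (z i)"
      have "V (d * q ^ m) = V (e * q ^ n)"
        using elim(1-3) by (simp add: V_mult q_def)
      also have "e * q ^ n = (q ^ (n - m) * e) * q ^ m"
        using \<open>m < n\<close> by (simp add: mult.commute mult.left_commute flip: power_add)
      finally have "V d = V (q ^ (n - m) * e)"
        using V_mult_cancel(3)[of "q ^ m" d "q ^ (n - m) * e"] elim(4) by (simp add: q_def)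
      then have "V (q ^ (n - m) * e) = V ((d / e) * e)" using e(1) by simp
      then show ?case using V_mult_cancel(3)[of e "q ^ (n - m)" "d / e"] e(1) by (simp add: q_def)
    qed
    moreover have "ultimately_strict_mono (\<lambda>i. V (poly (Q ^ (n - m)) (z i)))"
      using Q0(1) Q(3) a mn by (intro strict_mono_of_limit_root[of _ a]) auto
    ultimately show False by (rule not_strict_mono_constant[rotated])
  qed
  have "poly f x = (\<Sum>i\<le>degree f. poly (c i * Q ^ i) x)"
    unfolding c_def by (subst adic_expansion[OF Q0(2), of f]) (simp add: poly_sum)
  also have "V \<dots> = Min ((\<lambda>i. V (poly (c i * Q ^ i) x)) ` {..degree f})"
  proof (rule V_sum_distinct)
    fix m n assume mn: "m \<noteq> n" "poly (c m * Q ^ m) x \<noteq> 0" "poly (c n * Q ^ n) x \<noteq> 0"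
    then have "c m \<noteq> 0" "c n \<noteq> 0" by auto
    with mn(1) show "V (poly (c m * Q ^ m) x) \<noteq> V (poly (c n * Q ^ n) x)"
      using distinct[of m n] distinct[of n m] by (cases m n rule: linorder_cases) auto
  qed auto
  also have "\<dots> = truncation x V Q f"
    by (simp add: truncation_def c_def V_mult V_power)
  finally show ?thesis .
qed

lemma complete_sequence: "complete_key_polys K x V V (range (\<lambda>i. [:- z i, 1:]) \<union> {Q})"
proof -
  let ?L = "range (\<lambda>i. [:- z i, 1:]) \<union> {Q}"
  let ?r = "{(P, P'). P \<in> ?L \<and> P' \<in> ?L \<and> (P = P' \<or> delta K x V P < delta K x V P')}"
  have lin: "delta K x V [:- z i, 1:] < delta K x V [:- z j, 1:] \<longleftrightarrow> i < j"
    "delta K x V [:- z i, 1:] < delta K x V Q" for i j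
    unfolding delta_linear delta_Q by (rule V_x_minus_z_less V_x_minus_z_less_limit)+
  have key: "\<forall>P\<in>?L. key_polynomial K x V P"
    using key_Q linear_over_K by (auto simp: key_polynomial_def)
  have neq: "\<forall>P\<in>?L. \<forall>P'\<in>?L. P \<noteq> P' \<longrightarrow> delta K x V P \<noteq> delta K x V P'"
  proof (intro ballI impI)
    fix P P' assume P: "P \<in> ?L" "P' \<in> ?L" "P \<noteq> P'"
    have inj: "i = j" if "delta K x V [:- z i, 1:] = delta K x V [:- z j, 1:]" for i j
      using that lin(1)[of i j] lin(1)[of j i] by (metis linorder_neq_iff order.irrefl)
    have linQ: "delta K x V [:- z i, 1:] \<noteq> delta K x V Q" for i using lin(2)[of i] by simp
    from P(1,2) consider i j where "P = [:- z i, 1:]" "P' = [:- z j, 1:]"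
      | i where "P = [:- z i, 1:]" "P' = Q" | i where "P = Q" "P' = [:- z i, 1:]" | "P = Q" "P' = Q"
      by blast
    then show "delta K x V P \<noteq> delta K x V P'"
    proof cases
      case (1 i j)
      then show ?thesis using P(3) inj[of i j] by blast
    next
      case (2 i)
      then show ?thesis using linQ[of i] by simp
    next
      case (3 i)
      then show ?thesis using linQ[of i] by simp
    next
      case 4
      then show ?thesis using P(3) by simp
    qed
  qed
  \<comment> \<open>The order is that of the index type followed by \<open>Q\<close>: the minimal
    member is the linear polynomial of least index, or \<open>Q\<close> if no linear one is
    present.\<close>
  have "wf (?r - Id)"
  proof (rule wfI_min)
    fix P S assume "P \<in> (S :: 'a poly set)"
    show "\<exists>m\<in>S. \<forall>y. (y, m) \<in> ?r - Id \<longrightarrow> y \<notin> S"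
    proof (cases "\<exists>i. [:- z i, 1:] \<in> S")
      case True
      define i where "i = (LEAST i. [:- z i, 1:] \<in> S)"
      have i: "[:- z i, 1:] \<in> S" "\<And>j. [:- z j, 1:] \<in> S \<Longrightarrow> i \<le> j"
        using True LeastI_ex[of "\<lambda>i. [:- z i, 1:] \<in> S"] by (auto simp: i_def intro: Least_le)
      have "y \<notin> S" if "(y, [:- z i, 1:]) \<in> ?r - Id" for y
      proof
        assume "y \<in> S"
        have y: "y \<in> ?L" "delta K x V y < delta K x V [:- z i, 1:]" using that by auto
        then show False
        proof (elim UnE rangeE)
          fix j assume "y = [:- z j, 1:]"
          then show False using y(2) i(2)[of j] \<open>y \<in> S\<close> lin(1)[of j i] by auto
        next
          assume "y \<in> {Q}"
          then show False using y(2) lin(2)[of i] by auto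
        qed
      qed
      with i(1) show ?thesis by blast
    next
      case False
      have "y \<notin> S" if "(y, P) \<in> ?r - Id" for y
      proof
        assume "y \<in> S"
        then have "y = Q" using that False by auto
        moreover have "P = Q" using that False \<open>P \<in> S\<close> by auto
        ultimately show False using that by auto
      qed
      then show ?thesis using \<open>P \<in> S\<close> by blast
    qed
  qed
  moreover have "linear_order_on ?L ?r"
    unfolding linear_order_on_def partial_order_on_def preorder_on_def
  proof (intro conjI)
    show "?r \<subseteq> ?L \<times> ?L" by blast
    show "refl_on ?L ?r" by (auto simp: refl_on_def)
    show "trans ?r" by (rule transI) (auto intro: less_trans)
    show "antisym ?r" by (rule antisymI) auto
    show "total_on ?L ?r" using neq unfolding total_on_def by (auto simp del: Un_iff) (meson linorder_neqE)+
  qed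
  ultimately have "well_order_on ?L ?r" by (simp add: well_order_on_def)
  moreover have "\<forall>f\<in>polys_over K. \<exists>P\<in>?L. V (poly f x) = truncation x V P f"
    using truncation_Q by blast
  ultimately show ?thesis using key neq unfolding complete_key_polys_def by blast
qed

section \<open>The implicit constant field\<close>

lemma implicit_constants: "implicit_constant_field K x V = henselization K V"
proof
  let ?H = "henselization K V"
  have HC: "?H \<subseteq> C" by (rule henselization_least[OF C KC henselian_alg_clos[OF K]])
  show "?H \<subseteq> implicit_constant_field K x V"
    using HC henselization_mono[OF adjoin_incl(1), of K x]
    by (auto simp: implicit_constant_field_def alg_clos_def)
  \<comment> \<open>The graph of the substitution of \<open>z\<close> for \<open>x\<close>: a
    polynomial is paired with the germ of its values along the sequence.\<close>
  define \<xi> where "\<xi> = case_option x z"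
  define B where "B = (\<lambda>p o'. poly p (\<xi> o')) ` polys_over C"
  have "fun_ring B"
    unfolding fun_ring_def
  proof (intro conjI ballI)
    show "(\<lambda>_. 1) \<in> B" unfolding B_def by (rule image_eqI[OF _ polys_over_closed(2)[OF CR]]) simp
  next
    fix r assume "r \<in> B"
    then obtain p where p: "p \<in> polys_over C" "r = (\<lambda>j. poly p (\<xi> j))" unfolding B_def by blast
    show "(\<lambda>i. - r i) \<in> B" unfolding B_def
      by (rule image_eqI[OF _ polys_over_closed(4)[OF CR polys_over_closed(1)[OF CR] p(1)]]) (simp add: p(2))
  next
    fix r s assume "r \<in> B" "s \<in> B"
    then obtain p q where p: "p \<in> polys_over C" "r = (\<lambda>j. poly p (\<xi> j))"
      "q \<in> polys_over C" "s = (\<lambda>j. poly q (\<xi> j))" unfolding B_def by blast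
    show "(\<lambda>i. r i + s i) \<in> B" unfolding B_def
      by (rule image_eqI[OF _ polys_over_closed(3)[OF CR p(1,3)]]) (simp add: p(2,4))
    show "(\<lambda>i. r i * s i) \<in> B" unfolding B_def
      by (rule image_eqI[OF _ polys_over_closed(5)[OF CR p(1,3)]]) (simp add: p(2,4))
  qed
  moreover have "val_respecting at_top B"
    unfolding val_respecting_def B_def eventually_germ_filter
    using V_poly_le_iff V_poly_less_iff by (auto simp: \<xi>_def)
  ultimately obtain R where R: "B \<subseteq> R" "fun_ring R" "val_respecting at_top R"
    "\<And>R'. fun_ring R' \<Longrightarrow> val_respecting at_top R' \<Longrightarrow> R \<subseteq> R' \<Longrightarrow> R' = R"
    by (rule maximal_germ_ring) (rule that)
  interpret G: maximal_germs V at_top R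
    by unfold_locales (use R in auto)
  have const: "(\<lambda>_. c) \<in> R" if "c \<in> C" for c
  proof -
    have "(\<lambda>_. c) \<in> B" unfolding B_def
      by (rule image_eqI[OF _ linear_over(2)[OF that]]) simp
    then show ?thesis using R(1) by blast
  qed
  have "\<xi> \<in> B" unfolding B_def
    by (rule image_eqI[OF _ polys_over_closed(8)[OF CR ring_closedD(1)[OF CR], of 1]]) (simp add: poly_monom)
  then have \<xi>: "\<xi> \<in> R" using R(1) by blast
  note H = field_closed_henselization[of K] henselian_henselization[of K] henselization_incl[of K]
  \<comment> \<open>\<open>x\<close> and the constants from \<open>K\<close> have germs with values
    in \<open>K\<close>, so the preimage of the henselization is a henselian field containing
    \<open>K(x)\<close>.\<close>
  have "K \<subseteq> G.germs_in ?H"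
  proof
    fix c assume c: "c \<in> K"
    then have "(\<lambda>_::'i option. c) None \<in> G.germs_in ?H"
      using H(3) KC by (intro G.germs_inI[OF H(1) const]) auto
    then show "c \<in> G.germs_in ?H" by simp
  qed
  moreover have "x \<in> G.germs_in ?H"
    using G.germs_inI[OF H(1) \<xi>] subsetD[OF H(3) zK] by (simp add: \<xi>_def)
  ultimately have "adjoin K x \<subseteq> G.germs_in ?H"
    by (intro adjoin_least G.field_closed_germs_in H(1))
  then have "henselization (adjoin K x) V \<subseteq> G.germs_in ?H"
    by (intro henselization_least G.field_closed_germs_in G.henselian_germs_in H(1,2))
  \<comment> \<open>An element algebraic over \<open>K\<close> is represented by a constant
    function, so its germ lies in the henselization only if the element does.\<close>
  then show "implicit_constant_field K x V \<subseteq> ?H"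
    using G.germs_in_constant[OF const] by (auto simp: implicit_constant_field_def alg_clos_def)
qed

end

section \<open>Transfer to the given valuations\<close>

theorem theorem7p1:
  fixes K :: "'a::alg_closed_field set"
    and x :: 'a
    and v vbar vE vEbar V :: "'a \<Rightarrow> 'g::linordered_ab_group_add extval"
    and z :: "'i::{wellorder, no_top} \<Rightarrow> 'a"
    and Q :: "'a poly"
  assumes "subfield K ambient"
    and "\<not> alg_over K x"
    and "alg_clos (adjoin K x) = UNIV"
    and "valuation_on K v"
    and "pcs K v z"
    and "algebraic_type K v z"
    and "\<forall>y\<in>K. \<not> pcs_limit v z y"
    and "valuation_on (alg_clos K) vbar" and "extends_on K v vbar"
    and "induced_valuation K v z x vE"
    and "induced_valuation (alg_clos K) vbar z x vEbar"
    and "extends_on (adjoin K x) vE vEbar"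
    and "valuation_on UNIV V" and "extends_on (adjoin (alg_clos K) x) vEbar V"
    and "assoc_min_poly K v z Q"
  shows "(\<exists>a. poly Q a = 0 \<and> minimal_pair K x vEbar a (vEbar (x - a))) \<and>
    complete_key_polys K x vE vEbar (range (\<lambda>i. [:- z i, 1:]) \<union> {Q}) \<and>
    implicit_constant_field K x V = henselization K V"
proof -
  have K: "field_closed K" using assms(1) by (simp add: subfield_ambient_iff)
  note KR = field_closedD(1)[OF K]
  define C where "C = alg_clos K"
  define A where "A = adjoin C x"
  have C: "field_closed C" unfolding C_def by (rule field_closed_alg_clos[OF K])
  note CR = field_closedD(1)[OF C]
  have KC: "K \<subseteq> C" unfolding C_def by (rule alg_clos_incl[OF K])
  have A: "field_closed A" "C \<subseteq> A" "x \<in> A" unfolding A_def by (rule field_closed_adjoin adjoin_incl)+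
  have KA: "adjoin K x \<subseteq> A" using A KC by (intro adjoin_least) auto
  \<comment> \<open>All given valuations agree with \<open>V\<close> on their fields, so the claims
    are proved for \<open>V\<close> and carried back.\<close>
  have V_A: "vEbar y = V y" if "y \<in> A" for y
    using assms(14) that by (auto simp: extends_on_def A_def C_def)
  have V_C: "vbar y = V y" if "y \<in> C" for y
    using assms(11) V_A[of y] that A(2) by (auto simp: induced_valuation_def extends_on_def C_def)
  have V_K: "v y = V y" if "y \<in> K" for y
    using assms(9) V_C[of y] that KC by (auto simp: extends_on_def)
  have V_Kx: "vE y = V y" if "y \<in> adjoin K x" for y
    using assms(12) V_A[of y] that KA by (auto simp: extends_on_def)
  have zK: "z i \<in> K" for i using assms(5) by (simp add: pcs_def)
  interpret pcs_valued V z
  proof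
    show "V y = Infty \<longleftrightarrow> y = 0" "V (y * y') = V y + V y'" "min (V y) (V y') \<le> V (y + y')" for y y'
      using assms(13) by (auto simp: valuation_on_def)
    show "V (z i - z j) < V (z j - z k)" if "i < j" "j < k" for i j k
      using assms(5) that V_K[OF ring_closedD(6)[OF KR zK zK]] by (auto simp: pcs_def)
  qed
  have V_poly: "v (poly f (z i)) = V (poly f (z i))" if "f \<in> polys_over K" for f i
    by (rule V_K[OF poly_in_ring_closed[OF KR that zK]])
  have QK: "Q \<in> polys_over K" "lead_coeff Q = 1" "ultimately_strict_mono (\<lambda>i. V (poly Q (z i)))"
    using assms(15) V_poly by (auto simp: assoc_min_poly_def)
  obtain a where root: "poly Q a = 0" "is_limit a" using limit_root(2)[OF QK(3)] by blast
  interpret pcs_with_limit V z a by unfold_locales (rule root(2))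
  have xpoly: "poly p x \<in> A" if "p \<in> polys_over C" for p
    using that A by (intro poly_in_ring_closed field_closedD(1)) (auto intro: polys_over_mono)
  have nonzero: "poly p x \<noteq> 0" if "p \<in> polys_over C" "p \<noteq> 0" for p
    using alg_over_trans[OF K, of x] assms(2) that by (auto simp: alg_over_def C_def)
  interpret I: induced_pcs V z a K x Q
  proof
    show "field_closed K" "\<not> alg_over K x" "\<And>i. z i \<in> K" "Q \<in> polys_over K" "lead_coeff Q = 1" "poly Q a = 0"
      by (fact K assms(2) zK QK root(1))+
    show "degree Q \<le> degree f"
      if f: "f \<in> polys_over K" "f \<noteq> 0" "poly f r = 0" "is_limit r" for f r
    proof -
      \<comment> \<open>\<open>assoc_min_poly\<close> compares only monic polynomials, so
        \<open>f\<close> is normalised.\<close>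
      define g where "g = smult (1 / lead_coeff f) f"
      have "1 / lead_coeff f \<in> K"
        by (intro field_closedD(3)[OF K] ring_closedD[OF KR] polys_overD[OF f(1)])
      then have g: "g \<in> polys_over K" "lead_coeff g = 1" "degree g = degree f"
        using polys_over_closed(6)[OF KR _ f(1)] f(2) by (auto simp: g_def)
      have "ultimately_strict_mono (\<lambda>i. V (poly g (z i)))"
        using f by (intro strict_mono_of_limit_root[of g r]) (auto simp: g_def)
      then show ?thesis
        using assms(15) g V_poly[OF g(1)] by (auto simp: assoc_min_poly_def)
    qed
    fix p q assume "p \<in> polys_over (alg_clos K)" "q \<in> polys_over (alg_clos K)" and q0: "q \<noteq> 0"
    then have pq: "p \<in> polys_over C" "q \<in> polys_over C" by (auto simp: C_def)
    have zC: "z i \<in> C" for i using zK KC by blast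
    have vC: "vbar (poly p (z i) / poly q (z i)) = V (poly p (z i) / poly q (z i))"
      if "p \<in> polys_over C" "q \<in> polys_over C" for p q i
      by (rule V_C[OF field_closedD(3)[OF C poly_in_ring_closed[OF CR that(1) zC] poly_in_ring_closed[OF CR that(2) zC]]])
    let ?y = "poly p x / poly q x"
    have yA: "?y \<in> A" by (intro field_closedD(3)[OF A(1)] xpoly pq)
    have "0 \<le> V ?y \<longleftrightarrow> ?y \<in> val_ring A vEbar" using V_A[OF yA] yA by (simp add: val_ring_def)
    also have "val_ring A vEbar = pcs_ring C vbar z x"
      using assms(11) by (simp add: induced_valuation_def A_def C_def)
    also have "?y \<in> pcs_ring C vbar z x \<longleftrightarrow> (\<forall>\<^sub>F i in at_top. 0 \<le> V (poly p (z i) / poly q (z i)))"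
    proof
      assume "?y \<in> pcs_ring C vbar z x"
      then obtain p' q' where p': "?y = poly p' x / poly q' x" "p' \<in> polys_over C" "q' \<in> polys_over C" "q' \<noteq> 0"
        "\<forall>\<^sub>F i in at_top. 0 \<le> vbar (poly p' (z i) / poly q' (z i))" by (auto simp: pcs_ring_def)
      \<comment> \<open>Membership in \<open>pcs_ring\<close> may be witnessed by another fraction.
        As \<open>x\<close> is transcendental, equality of the fractions at \<open>x\<close> is an
        identity of polynomials and can be evaluated at \<open>z i\<close>.\<close>
      have "poly (p * q' - p' * q) x = 0"
        using p'(1) nonzero[OF pq(2) q0] nonzero[OF p'(3,4)] by (simp add: field_simps)
      then have eq: "p * q' = p' * q"
        using nonzero[of "p * q' - p' * q"] polys_over_closed[OF CR] pq p'(2,3) by auto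
      show "\<forall>\<^sub>F i in at_top. 0 \<le> V (poly p (z i) / poly q (z i))"
        using p'(5) eventually_poly_nonzero[OF q0] eventually_poly_nonzero[OF p'(4)]
      proof eventually_elim
        case (elim i)
        have "poly p (z i) * poly q' (z i) = poly p' (z i) * poly q (z i)"
          using eq by (metis poly_mult)
        then have "poly p (z i) / poly q (z i) = poly p' (z i) / poly q' (z i)"
          using elim by (simp add: frac_eq_eq)
        then show ?case using elim vC[OF p'(2,3)] by simp
      qed
    next
      assume "\<forall>\<^sub>F i in at_top. 0 \<le> V (poly p (z i) / poly q (z i))"
      then have "\<forall>\<^sub>F i in at_top. 0 \<le> vbar (poly p (z i) / poly q (z i))" by (simp add: vC[OF pq])
      then show "?y \<in> pcs_ring C vbar z x" using pq q0 unfolding pcs_ring_def by blast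
    qed
    finally show "0 \<le> V ?y \<longleftrightarrow> (\<forall>\<^sub>F i in at_top. 0 \<le> V (poly p (z i) / poly q (z i)))" .
  qed
  have xA: "x - c \<in> A" if "c \<in> C" for c using A that ring_closedD(6)[OF field_closedD(1)[OF A(1)]] by blast
  have aC: "a \<in> C" using I.a_alg by (simp add: C_def)
  have "minimal_pair K x vEbar a (vEbar (x - a))"
  proof -
    have "value_group A vEbar = value_group A V"
      unfolding value_group_def using V_A by (intro image_cong) auto
    moreover have "a - b \<in> A" if "b \<in> C" for b
      using ring_closedD(6)[OF CR aC that] A(2) by blast
    ultimately show ?thesis
      using I.min_pair V_A xA aC unfolding minimal_pair_def C_def[symmetric] A_def[symmetric] by simp
  qed
  moreover have "complete_key_polys K x vE vEbar (range (\<lambda>i. [:- z i, 1:]) \<union> {Q})"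
  proof -
    have "delta K x vEbar f = delta K x V f" for f
    proof -
      have "{vEbar (x - c) |c. c \<in> C \<and> poly f c = 0} = {V (x - c) |c. c \<in> C \<and> poly f c = 0}"
        unfolding setcompr_eq_image by (rule image_cong) (simp_all add: V_A xA)
      then show ?thesis by (simp add: delta_def C_def)
    qed
    then have delta: "delta K x vEbar = delta K x V" by blast
    have key: "key_polynomial K x vEbar = key_polynomial K x V"
      unfolding key_polynomial_def delta by simp
    have vEx: "vE (poly f x) = V (poly f x)" if "f \<in> polys_over K" for f
      using that adjoin_incl(1)[of K x] adjoin_incl(2)[of x K] field_closed_adjoin[of K x]
      by (intro V_Kx poly_in_ring_closed field_closedD(1)) (auto intro: polys_over_mono)
    \<comment> \<open>The truncation applies the valuation only to adic coefficients and
      \<open>P\<close> evaluated at \<open>x\<close>; these lie in \<open>K(x)\<close>, where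
      \<open>vE\<close> and \<open>V\<close> agree.\<close>
    have "adic_coeff P f i \<in> polys_over K" if "P \<in> polys_over K" "f \<in> polys_over K" for P f i
      unfolding adic_coeff_def by (intro poly_div_mod_over[OF K] polys_over_power[OF KR] that)
    then have trunc: "truncation x vE P f = truncation x V P f" if "P \<in> polys_over K" "f \<in> polys_over K" for P f
      using that vEx by (simp add: truncation_def)
    have L: "P \<in> polys_over K" if "P \<in> range (\<lambda>i. [:- z i, 1:]) \<union> {Q}" for P
      using that I.linear_over_K QK(1) by auto
    let ?L = "range (\<lambda>i. [:- z i, 1:]) \<union> {Q}"
    have cs: "complete_key_polys K x V V ?L" by (rule I.complete_sequence)
    have "\<exists>P\<in>?L. vE (poly f x) = truncation x vE P f" if f: "f \<in> polys_over K" for f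
    proof -
      obtain P where P: "P \<in> ?L" "V (poly f x) = truncation x V P f"
        using cs f unfolding complete_key_polys_def by blast
      then have "vE (poly f x) = truncation x vE P f" using trunc[OF L[OF P(1)] f] vEx[OF f] by simp
      with P(1) show ?thesis by blast
    qed
    with cs show ?thesis unfolding complete_key_polys_def delta key by blast
  qed
  ultimately show ?thesis using root(1) I.implicit_constants by blast
qed

end
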